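(* Let $(M^{n}=G/K,g_{B})$ be a compact simply-connected isotropy irreducible standard homogeneous Riemannian manifold, endowed with an effective action of a compact connected simple Lie group $G$. Assume that $M=G/K$ is not a symmetric space of Type I. Then $(M^n=G/K,g_B)$ is a $\nabla^{\alpha}$-Einstein manifold for any $\alpha\in\mathbb{R}$. The same holds if $G$ is semi-simple but not simple, i.e. when $M$ is isometric to the coset $(G/\Delta Z)/(\Delta H/\Delta Z)$ with $G:=H\times\cdots\times H$ ($q$ times, $q\ge 2$) for a compact simply connected simple Lie group $H$.
   Context: Here $n=\dim M\geq 3$ and $M$ is assumed de Rham irreducible. $\mathfrak{g}=\mathfrak{k}\oplus\mathfrak{m}$ is the reductive decomposition with $\mathfrak{m}$ the orthogonal complement of $\mathfrak{k}$ with respect to the Killing form, and $g_B$ (the Killing, or standard, metric) is the $G$-invariant metric induced by the restriction to $\mathfrak{m}$ of the negative $B$ of the Killing form of $\mathfrak{g}$. Isotropy irreducible means that the isotropy representation of $K$ on $\mathfrak{m}\cong T_oM$ is irreducible over $\mathbb{R}$. In the second part, $\Delta H$ is the diagonal subgroup of $G$, $Z$ is the finite centre of $H$ and $\Delta Z$ its diagonal embedding. A $G$-invariant linear connection $\nabla$ on $M$ corresponds to its Nomizu map, an $\mathrm{Ad}(K)$-equivariant linear map $\Lambda:\mathfrak{m}\to\mathfrak{gl}(\mathfrak{m})$, with torsion $T(X,Y)=\Lambda(X)Y-\Lambda(Y)X-[X,Y]_{\mathfrak{m}}$ and curvature $R(X,Y)=[\Lambda(X),\Lambda(Y)]-\Lambda([X,Y]_{\mathfrak{m}})-\mathrm{ad}([X,Y]_{\mathfrak{k}})$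 at $o=eK$. For $\alpha\in\mathbb{R}$, $\nabla^{\alpha}$ is the $G$-invariant metric connection with Nomizu map $\Lambda^{\alpha}(X)Y=\frac{1-\alpha}{2}[X,Y]_{\mathfrak{m}}$; it has skew-symmetric torsion $T^{\alpha}=\alpha T^c$, where $T^c(X,Y)=-[X,Y]_{\mathfrak{m}}$ is the torsion of the canonical connection (the one with zero Nomizu map). A Riemannian manifold $(M^n,g)$ with a metric connection $\nabla$ with totally skew-symmetric torsion is called $\nabla$-Einstein if $\mathrm{Ric}_S=\frac{\mathrm{Scal}}{n}g$, where $\mathrm{Ric}_S$ is the symmetric part of the Ricci tensor $\mathrm{Ric}(X,Y)=\sum_i g(R(X,e_i)e_i,Y)$ of $\nabla$ and $\mathrm{Scal}$ is its scalar curvature. $\nabla^{\alpha}$-Einstein means this for $\nabla=\nabla^\alpha$. *)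

theory Defs
  imports
    "HOL-Analysis.Analysis"
    "HOL-Algebra.Left_Coset"
    "HOL-Algebra.Product_Groups"
begin

section \<open>Smooth maps between open subsets of Euclidean spaces\<close>

text \<open>\<open>Ck_on k S f\<close>: all iterated directional derivatives of \<open>f\<close> of order at most \<open>k\<close> exist and
  are continuous on the open set \<open>S\<close>.\<close>

primrec Ck_on ::
    "nat \<Rightarrow> 'a::euclidean_space set \<Rightarrow> ('a \<Rightarrow> 'b::euclidean_space) \<Rightarrow> bool" where
  "Ck_on 0 S f = continuous_on S f"
| "Ck_on (Suc k) S f =
     (f differentiable_on S \<and> (\<forall>v. Ck_on k S (\<lambda>x. frechet_derivative f (at x) v)))"

definition smooth_on :: "'a::euclidean_space set \<Rightarrow> ('a \<Rightarrow> 'b::euclidean_space) \<Rightarrow> bool" where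
  "smooth_on S f \<longleftrightarrow> (\<forall>k. Ck_on k S f)"


section \<open>Smooth manifolds\<close>

text \<open>A chart is its domain together with its coordinate map; the coordinate map is meaningful only
  on the domain, and \<open>inv_into U \<phi>\<close> is the corresponding local parametrisation.\<close>

type_synonym ('p, 'e) chart = "'p set \<times> ('p \<Rightarrow> 'e)"

definition smooth_manifold :: "'p topology \<Rightarrow> ('p, 'e::euclidean_space) chart set \<Rightarrow> bool" where
  "smooth_manifold X A \<longleftrightarrow>
     Hausdorff_space X \<and> second_countable X \<and>
     (\<Union>(U, \<phi>)\<in>A. U) = topspace X \<and>
     (\<forall>(U, \<phi>)\<in>A. openin X U \<and> open (\<phi> ` U) \<and>
        homeomorphic_map (subtopology X U) (top_of_set (\<phi> ` U)) \<phi>) \<and>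
     (\<forall>(U, \<phi>)\<in>A. \<forall>(V, \<psi>)\<in>A. smooth_on (\<phi> ` (U \<inter> V)) (\<psi> \<circ> inv_into U \<phi>))"

definition smooth_map ::
    "'p topology \<Rightarrow> ('p, 'e::euclidean_space) chart set \<Rightarrow>
     'r topology \<Rightarrow> ('r, 'f::euclidean_space) chart set \<Rightarrow> ('p \<Rightarrow> 'r) \<Rightarrow> bool" where
  "smooth_map X A Y B f \<longleftrightarrow>
     continuous_map X Y f \<and>
     (\<forall>(U, \<phi>)\<in>A. \<forall>(V, \<psi>)\<in>B. smooth_on (\<phi> ` (U \<inter> f -` V)) (\<psi> \<circ> f \<circ> inv_into U \<phi>))"

definition prod_atlas ::
    "('p, 'e) chart set \<Rightarrow> ('r, 'f) chart set \<Rightarrow> ('p \<times> 'r, 'e \<times> 'f) chart set" where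
  "prod_atlas A B = {(U \<times> V, map_prod \<phi> \<psi>) | U \<phi> V \<psi>. (U, \<phi>) \<in> A \<and> (V, \<psi>) \<in> B}"


section \<open>Lie groups\<close>

record ('g, 'e) lie_data = "'g monoid" +
  space_of :: "'g topology"
  atlas_of :: "('g, 'e) chart set"

definition lie_group :: "('g, 'e::euclidean_space) lie_data \<Rightarrow> bool" where
  "lie_group G \<longleftrightarrow>
     group G \<and> topspace (space_of G) = carrier G \<and>
     smooth_manifold (space_of G) (atlas_of G) \<and>
     smooth_map (prod_topology (space_of G) (space_of G)) (prod_atlas (atlas_of G) (atlas_of G))
       (space_of G) (atlas_of G) (\<lambda>(x, y). x \<otimes>\<^bsub>G\<^esub> y) \<and>
     smooth_map (space_of G) (atlas_of G) (space_of G) (atlas_of G) (\<lambda>x. inv\<^bsub>G\<^esub> x)"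

text \<open>The tangent space \<open>T\<^sub>e G\<close> is identified with the model space \<open>'e\<close> by means of one fixed
  chart around the neutral element, so the carrier of the Lie algebra of \<open>G\<close> is the type \<open>'e\<close>.\<close>

definition unit_chart :: "('g, 'e) lie_data \<Rightarrow> ('g, 'e) chart" where
  "unit_chart G = (SOME c. c \<in> atlas_of G \<and> \<one>\<^bsub>G\<^esub> \<in> fst c)"

definition crd :: "('g, 'e) lie_data \<Rightarrow> 'g \<Rightarrow> 'e" where
  "crd G = snd (unit_chart G)"

definition par :: "('g, 'e) lie_data \<Rightarrow> 'e \<Rightarrow> 'g" where
  "par G = inv_into (fst (unit_chart G)) (crd G)"

abbreviation unit_crd :: "('g, 'e) lie_data \<Rightarrow> 'e" where
  "unit_crd G \<equiv> crd G \<one>\<^bsub>G\<^esub>"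

text \<open>Coordinate expression of the left-invariant vector field with value \<open>v\<close> at the neutral
  element. The bracket is the commutator \<open>DW(V) - DV(W)\<close> of left-invariant vector fields,
  evaluated at the neutral element.\<close>

definition left_inv_field :: "('g, 'e::euclidean_space) lie_data \<Rightarrow> 'e \<Rightarrow> 'e \<Rightarrow> 'e" where
  "left_inv_field G v x =
     frechet_derivative (\<lambda>y. crd G (par G x \<otimes>\<^bsub>G\<^esub> par G y)) (at (unit_crd G)) v"

definition lie_bracket :: "('g, 'e::euclidean_space) lie_data \<Rightarrow> 'e \<Rightarrow> 'e \<Rightarrow> 'e" where
  "lie_bracket G v w =
     frechet_derivative (left_inv_field G w) (at (unit_crd G)) v -
     frechet_derivative (left_inv_field G v) (at (unit_crd G)) w"

definition Ad :: "('g, 'e::euclidean_space) lie_data \<Rightarrow> 'g \<Rightarrow> 'e \<Rightarrow> 'e" where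
  "Ad G g v =
     frechet_derivative (\<lambda>y. crd G (g \<otimes>\<^bsub>G\<^esub> par G y \<otimes>\<^bsub>G\<^esub> inv\<^bsub>G\<^esub> g)) (at (unit_crd G)) v"

text \<open>The Lie algebra of a closed subgroup \<open>K\<close> as its tangent space at the neutral element: the
  velocities of curves in \<open>K\<close>. Differentiability of the curve at \<open>0\<close> suffices, as \<open>K\<close> is closed.\<close>

definition lie_subalg :: "('g, 'e::euclidean_space) lie_data \<Rightarrow> 'g set \<Rightarrow> 'e set" where
  "lie_subalg G K =
     {v. \<exists>\<gamma>. continuous_map euclideanreal (space_of G) \<gamma> \<and> range \<gamma> \<subseteq> K \<and> \<gamma> 0 = \<one>\<^bsub>G\<^esub> \<and>
        ((\<lambda>t. crd G (\<gamma> t)) has_vector_derivative v) (at 0)}"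

text \<open>A simple Lie group is a connected Lie group whose Lie algebra is simple.\<close>

definition simple_lie_group :: "('g, 'e::euclidean_space) lie_data \<Rightarrow> bool" where
  "simple_lie_group G \<longleftrightarrow>
     lie_group G \<and> connected_space (space_of G) \<and>
     (\<exists>v w. lie_bracket G v w \<noteq> 0) \<and>
     (\<forall>I. subspace I \<and> (\<forall>v. \<forall>w\<in>I. lie_bracket G v w \<in> I) \<longrightarrow> I = {0} \<or> I = UNIV)"

definition lin_trace :: "('e::euclidean_space \<Rightarrow> 'e) \<Rightarrow> real" where
  "lin_trace f = (\<Sum>b\<in>Basis. f b \<bullet> b)"

definition killing :: "('g, 'e::euclidean_space) lie_data \<Rightarrow> 'e \<Rightarrow> 'e \<Rightarrow> real" where
  "killing G v w = lin_trace (\<lambda>u. lie_bracket G v (lie_bracket G w u))"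


section \<open>Homogeneous spaces\<close>

definition quotient_top :: "'p topology \<Rightarrow> ('p \<Rightarrow> 'r) \<Rightarrow> 'r topology" where
  "quotient_top X f =
     topology (\<lambda>U. U \<subseteq> f ` topspace X \<and> openin X {x \<in> topspace X. f x \<in> U})"

lemma openin_quotient_top:
  "openin (quotient_top X f) U \<longleftrightarrow> U \<subseteq> f ` topspace X \<and> openin X {x \<in> topspace X. f x \<in> U}"
proof -
  have "istopology (\<lambda>U. U \<subseteq> f ` topspace X \<and> openin X {x \<in> topspace X. f x \<in> U})"
    unfolding istopology_def
  proof (intro conjI allI impI)
    fix S T
    assume S: "S \<subseteq> f ` topspace X \<and> openin X {x \<in> topspace X. f x \<in> S}"
      and T: "T \<subseteq> f ` topspace X \<and> openin X {x \<in> topspace X. f x \<in> T}"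
    then show "S \<inter> T \<subseteq> f ` topspace X" by blast
    have "{x \<in> topspace X. f x \<in> S \<inter> T} =
        {x \<in> topspace X. f x \<in> S} \<inter> {x \<in> topspace X. f x \<in> T}" by blast
    then show "openin X {x \<in> topspace X. f x \<in> S \<inter> T}"
      using S T by (simp add: openin_Int)
  next
    fix \<K>
    assume K: "\<forall>S\<in>\<K>. S \<subseteq> f ` topspace X \<and> openin X {x \<in> topspace X. f x \<in> S}"
    then show "\<Union>\<K> \<subseteq> f ` topspace X" by blast
    have "{x \<in> topspace X. f x \<in> \<Union>\<K>} = (\<Union>S\<in>\<K>. {x \<in> topspace X. f x \<in> S})" by blast
    then show "openin X {x \<in> topspace X. f x \<in> \<Union>\<K>}"
      using K by auto
  qed
  then show ?thesis
    by (simp add: quotient_top_def topology_inverse')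
qed

lemma quotient_map_quotient_top: "quotient_map X (quotient_top X f) f"
proof -
  have "openin (quotient_top X f) (f ` topspace X)"
    by (simp add: openin_quotient_top)
       (metis (mono_tags, lifting) Collect_cong Collect_mem_eq imageI openin_topspace)
  then have "topspace (quotient_top X f) = f ` topspace X"
    by (meson openin_quotient_top openin_subset openin_topspace subset_antisym)
  then show ?thesis
    by (auto simp: quotient_map_def openin_quotient_top)
qed

text \<open>\<open>G/K\<close> is the space of left cosets, on which \<open>G\<close> acts from the left.\<close>

definition coset_space :: "('g, 'e) lie_data \<Rightarrow> 'g set \<Rightarrow> 'g set topology" where
  "coset_space G K = quotient_top (space_of G) (\<lambda>g. g <#\<^bsub>G\<^esub> K)"

text \<open>The library's notion of simple connectedness is restricted to subsets of topological type
  classes; this is the same notion for abstract topologies.\<close>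

definition simply_connected_space :: "'p topology \<Rightarrow> bool" where
  "simply_connected_space X \<longleftrightarrow>
     (\<forall>p q. continuous_map (top_of_set {0..1::real}) X p \<and> p 1 = p 0 \<and>
            continuous_map (top_of_set {0..1::real}) X q \<and> q 1 = q 0 \<longrightarrow>
        homotopic_with (\<lambda>r. r 1 = r 0) (top_of_set {0..1::real}) X p q)"

definition effective_action :: "('g, 'e) lie_data \<Rightarrow> 'g set \<Rightarrow> bool" where
  "effective_action G K \<longleftrightarrow>
     (\<forall>g\<in>carrier G. (\<forall>C\<in>lcosets\<^bsub>G\<^esub> K. g <#\<^bsub>G\<^esub> C = C) \<longrightarrow> g = \<one>\<^bsub>G\<^esub>)"

text \<open>Symmetric coset: some involutive automorphism \<open>\<sigma>\<close> of \<open>G\<close> satisfies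
  \<open>Fix(\<sigma>)\<^sub>0 \<subseteq> K \<subseteq> Fix(\<sigma>)\<close>. It is of Type I if \<open>G\<close> is moreover compact and simple.\<close>

definition symmetric_coset :: "('g, 'e::euclidean_space) lie_data \<Rightarrow> 'g set \<Rightarrow> bool" where
  "symmetric_coset G K \<longleftrightarrow>
     (\<exists>\<sigma>. \<sigma> \<in> iso G G \<and>
        smooth_map (space_of G) (atlas_of G) (space_of G) (atlas_of G) \<sigma> \<and>
        (\<forall>g\<in>carrier G. \<sigma> (\<sigma> g) = g) \<and> (\<exists>g\<in>carrier G. \<sigma> g \<noteq> g) \<and>
        K \<subseteq> {g \<in> carrier G. \<sigma> g = g} \<and>
        connected_component_of_set
          (subtopology (space_of G) {g \<in> carrier G. \<sigma> g = g}) \<one>\<^bsub>G\<^esub> \<subseteq> K)"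

definition type_I_symmetric_coset :: "('g, 'e::euclidean_space) lie_data \<Rightarrow> 'g set \<Rightarrow> bool" where
  "type_I_symmetric_coset G K \<longleftrightarrow>
     compact_space (space_of G) \<and> simple_lie_group G \<and> symmetric_coset G K"

text \<open>The Killing-orthogonal complement \<open>\<mm>\<close> of \<open>\<kk>\<close>, identified with \<open>T\<^sub>o(G/K)\<close>, and the two
  projections belonging to the reductive decomposition \<open>\<gg> = \<kk> \<oplus> \<mm>\<close>.\<close>

definition red_compl :: "('g, 'e::euclidean_space) lie_data \<Rightarrow> 'g set \<Rightarrow> 'e set" where
  "red_compl G K = {w. \<forall>v\<in>lie_subalg G K. killing G v w = 0}"

definition proj_m :: "('g, 'e::euclidean_space) lie_data \<Rightarrow> 'g set \<Rightarrow> 'e \<Rightarrow> 'e" where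
  "proj_m G K Z = (THE W. W \<in> red_compl G K \<and> Z - W \<in> lie_subalg G K)"

definition proj_k :: "('g, 'e::euclidean_space) lie_data \<Rightarrow> 'g set \<Rightarrow> 'e \<Rightarrow> 'e" where
  "proj_k G K Z = (THE W. W \<in> lie_subalg G K \<and> Z - W \<in> red_compl G K)"

definition isotropy_irreducible :: "('g, 'e::euclidean_space) lie_data \<Rightarrow> 'g set \<Rightarrow> bool" where
  "isotropy_irreducible G K \<longleftrightarrow>
     red_compl G K \<noteq> {0} \<and>
     (\<forall>V. subspace V \<and> V \<subseteq> red_compl G K \<and> (\<forall>k\<in>K. \<forall>v\<in>V. Ad G k v \<in> V) \<longrightarrow>
        V = {0} \<or> V = red_compl G K)"

text \<open>The standard metric at the base point \<open>o\<close>.\<close>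

definition gB :: "('g, 'e::euclidean_space) lie_data \<Rightarrow> 'e \<Rightarrow> 'e \<Rightarrow> real" where
  "gB G X Y = - killing G X Y"


section \<open>Invariant connections on \<open>(G/K, g\<^sub>B)\<close>\<close>

text \<open>Invariant tensors are represented by their values at the base point \<open>o\<close>; in particular a connection is
  represented by its Nomizu map \<open>\<Lambda>\<close>, of which only the values on \<open>\<mm>\<close> matter.\<close>

definition is_nomizu_map ::
    "('g, 'e::euclidean_space) lie_data \<Rightarrow> 'g set \<Rightarrow> ('e \<Rightarrow> 'e \<Rightarrow> 'e) \<Rightarrow> bool" where
  "is_nomizu_map G K \<Lambda> \<longleftrightarrow>
     (\<forall>X\<in>red_compl G K. \<forall>Y\<in>red_compl G K. \<Lambda> X Y \<in> red_compl G K) \<and>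
     (\<forall>X\<in>red_compl G K. \<forall>Y\<in>red_compl G K. \<forall>Z\<in>red_compl G K. \<forall>a b.
        \<Lambda> (a *\<^sub>R X + b *\<^sub>R Y) Z = a *\<^sub>R \<Lambda> X Z + b *\<^sub>R \<Lambda> Y Z \<and>
        \<Lambda> Z (a *\<^sub>R X + b *\<^sub>R Y) = a *\<^sub>R \<Lambda> Z X + b *\<^sub>R \<Lambda> Z Y) \<and>
     (\<forall>k\<in>K. \<forall>X\<in>red_compl G K. \<forall>Y\<in>red_compl G K. Ad G k (\<Lambda> X Y) = \<Lambda> (Ad G k X) (Ad G k Y))"

definition torsion ::
    "('g, 'e::euclidean_space) lie_data \<Rightarrow> 'g set \<Rightarrow> ('e \<Rightarrow> 'e \<Rightarrow> 'e) \<Rightarrow> 'e \<Rightarrow> 'e \<Rightarrow> 'e" where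
  "torsion G K \<Lambda> X Y = \<Lambda> X Y - \<Lambda> Y X - proj_m G K (lie_bracket G X Y)"

definition curvature ::
    "('g, 'e::euclidean_space) lie_data \<Rightarrow> 'g set \<Rightarrow> ('e \<Rightarrow> 'e \<Rightarrow> 'e) \<Rightarrow> 'e \<Rightarrow> 'e \<Rightarrow> 'e \<Rightarrow> 'e"
  where
  "curvature G K \<Lambda> X Y V =
     (\<Lambda> X (\<Lambda> Y V) - \<Lambda> Y (\<Lambda> X V)) - \<Lambda> (proj_m G K (lie_bracket G X Y)) V
       - lie_bracket G (proj_k G K (lie_bracket G X Y)) V"

definition metric_connection ::
    "('g, 'e::euclidean_space) lie_data \<Rightarrow> 'g set \<Rightarrow> ('e \<Rightarrow> 'e \<Rightarrow> 'e) \<Rightarrow> bool" where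
  "metric_connection G K \<Lambda> \<longleftrightarrow>
     (\<forall>X\<in>red_compl G K. \<forall>Y\<in>red_compl G K. \<forall>Z\<in>red_compl G K.
        gB G (\<Lambda> X Y) Z + gB G Y (\<Lambda> X Z) = 0)"

text \<open>\<open>g\<^sub>B(T(X,Y),Z)\<close> is a 3-form; skewness in \<open>X, Y\<close> is automatic for a torsion tensor.\<close>

definition skew_torsion ::
    "('g, 'e::euclidean_space) lie_data \<Rightarrow> 'g set \<Rightarrow> ('e \<Rightarrow> 'e \<Rightarrow> 'e) \<Rightarrow> bool" where
  "skew_torsion G K \<Lambda> \<longleftrightarrow>
     (\<forall>X\<in>red_compl G K. \<forall>Y\<in>red_compl G K. \<forall>Z\<in>red_compl G K.
        gB G (torsion G K \<Lambda> X Y) Z = - gB G (torsion G K \<Lambda> X Z) Y)"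

definition orthonormal_basis ::
    "('g, 'e::euclidean_space) lie_data \<Rightarrow> 'g set \<Rightarrow> 'e set \<Rightarrow> bool" where
  "orthonormal_basis G K E \<longleftrightarrow>
     finite E \<and> span E = red_compl G K \<and>
     (\<forall>e\<in>E. \<forall>e'\<in>E. gB G e e' = (if e = e' then 1 else 0))"

text \<open>The Ricci tensor and the scalar curvature do not depend on the chosen orthonormal basis.\<close>

definition some_onb :: "('g, 'e::euclidean_space) lie_data \<Rightarrow> 'g set \<Rightarrow> 'e set" where
  "some_onb G K = (SOME E. orthonormal_basis G K E)"

definition Ric ::
    "('g, 'e::euclidean_space) lie_data \<Rightarrow> 'g set \<Rightarrow> ('e \<Rightarrow> 'e \<Rightarrow> 'e) \<Rightarrow> 'e \<Rightarrow> 'e \<Rightarrow> real" where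
  "Ric G K \<Lambda> X Y = (\<Sum>e\<in>some_onb G K. gB G (curvature G K \<Lambda> X e e) Y)"

definition Ric_S ::
    "('g, 'e::euclidean_space) lie_data \<Rightarrow> 'g set \<Rightarrow> ('e \<Rightarrow> 'e \<Rightarrow> 'e) \<Rightarrow> 'e \<Rightarrow> 'e \<Rightarrow> real" where
  "Ric_S G K \<Lambda> X Y = (Ric G K \<Lambda> X Y + Ric G K \<Lambda> Y X) / 2"

definition Scal ::
    "('g, 'e::euclidean_space) lie_data \<Rightarrow> 'g set \<Rightarrow> ('e \<Rightarrow> 'e \<Rightarrow> 'e) \<Rightarrow> real" where
  "Scal G K \<Lambda> = (\<Sum>e\<in>some_onb G K. Ric G K \<Lambda> e e)"

text \<open>The first conjunct says that \<open>g\<^sub>B\<close> is Riemannian; \<open>dim \<mm> = dim G/K\<close>.\<close>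

definition nabla_einstein ::
    "('g, 'e::euclidean_space) lie_data \<Rightarrow> 'g set \<Rightarrow> ('e \<Rightarrow> 'e \<Rightarrow> 'e) \<Rightarrow> bool" where
  "nabla_einstein G K \<Lambda> \<longleftrightarrow>
     (\<forall>X\<in>red_compl G K. X \<noteq> 0 \<longrightarrow> gB G X X > 0) \<and>
     is_nomizu_map G K \<Lambda> \<and> metric_connection G K \<Lambda> \<and> skew_torsion G K \<Lambda> \<and>
     (\<forall>X\<in>red_compl G K. \<forall>Y\<in>red_compl G K.
        Ric_S G K \<Lambda> X Y = Scal G K \<Lambda> / real (dim (red_compl G K)) * gB G X Y)"

definition nomizu_alpha ::
    "('g, 'e::euclidean_space) lie_data \<Rightarrow> 'g set \<Rightarrow> real \<Rightarrow> 'e \<Rightarrow> 'e \<Rightarrow> 'e" where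
  "nomizu_alpha G K \<alpha> X Y = ((1 - \<alpha>) / 2) *\<^sub>R proj_m G K (lie_bracket G X Y)"


section \<open>Products and quotients\<close>

text \<open>The product of copies of \<open>H\<close> indexed by the finite type \<open>'q\<close>.\<close>

definition lie_power ::
    "('h, 'f::euclidean_space) lie_data \<Rightarrow> ('q::finite \<Rightarrow> 'h, 'f ^ 'q) lie_data" where
  "lie_power H =
     monoid.extend (product_group (UNIV :: 'q set) (\<lambda>_. H))
       (lie_data.fields
          (product_topology (\<lambda>_. space_of H) UNIV)
          {(\<Pi>\<^sub>E i\<in>UNIV. fst (c i), \<lambda>x. \<chi> i. snd (c i) (x i)) | c. \<forall>i. c i \<in> atlas_of H})"

definition diag :: "'h set \<Rightarrow> ('q \<Rightarrow> 'h) set" where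
  "diag S = (\<lambda>s. (\<lambda>_. s)) ` S"

definition group_centre :: "('h, 'm) monoid_scheme \<Rightarrow> 'h set" where
  "group_centre H = {z \<in> carrier H. \<forall>h\<in>carrier H. z \<otimes>\<^bsub>H\<^esub> h = h \<otimes>\<^bsub>H\<^esub> z}"

definition quotient_proj :: "('g, 'm) monoid_scheme \<Rightarrow> 'g set \<Rightarrow> 'g \<Rightarrow> 'g set" where
  "quotient_proj G N x = N #>\<^bsub>G\<^esub> x"

text \<open>The quotient by a normal subgroup \<open>N\<close>. The smooth structure is the right one only for
  discrete \<open>N\<close>: the charts are those of \<open>G\<close>, restricted to open sets on which the projection is
  injective and pushed down.\<close>

definition lie_quotient ::
    "('g, 'e) lie_data \<Rightarrow> 'g set \<Rightarrow> ('g set, 'e) lie_data" where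
  "lie_quotient G N =
     monoid.extend (G Mod N)
       (lie_data.fields
          (quotient_top (space_of G) (quotient_proj G N))
          {(quotient_proj G N ` V, \<phi> \<circ> inv_into V (quotient_proj G N)) | U \<phi> V.
             (U, \<phi>) \<in> atlas_of G \<and> V \<subseteq> U \<and> openin (space_of G) V \<and>
             inj_on (quotient_proj G N) V})"

end

theory Submission
  imports Defs
begin

text \<open>
  Write \<open>\<gg> = \<kk> \<oplus> \<mm>\<close> for the Killing-orthogonal decomposition, \<open>g\<close> for the negative of the Killing form and
  \<open>\<pi>\<close> for the projection onto \<open>\<kk>\<close>. As soon as \<open>g\<close> is positive definite, the Ricci tensor of \<open>\<nabla>\<^sup>\<alpha>\<close> is a
  combination of only two invariant forms on \<open>\<mm>\<close>: the metric \<open>g\<close> and the Casimir form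
  \<open>C(X, Y) = tr (\<pi> \<circ> ad X \<circ> ad Y)\<close>. Indeed, for an orthonormal basis \<open>e\<close> of \<open>\<mm>\<close>, invariance of the
  Killing form turns \<open>\<Sum> g([X, e]\<^sub>\<kk>, [Y, e])\<close> into \<open>- C(X, Y)\<close> and \<open>\<Sum> g([X, e], [Y, e])\<close> into
  \<open>g(X, Y) + C(X, Y)\<close>, and with \<open>c = (1 - \<alpha>) / 2\<close> the definition of the curvature gives
  \<open>Ric = c (1 - c) (g + 2 C) - C\<close> (\<open>Ric_nomizu_alpha\<close>). Hence \<open>G/K\<close> is \<open>\<nabla>\<^sup>\<alpha>\<close>-Einstein for every \<open>\<alpha>\<close>
  once \<open>C\<close> is a multiple of \<open>g\<close> (\<open>nabla_einstein_if_casimir_scalar\<close>).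

  Two arguments show that \<open>C\<close> is a multiple of \<open>g\<close>. If \<open>K\<close> acts irreducibly on \<open>\<mm>\<close>, this is Schur's
  lemma for symmetric forms (\<open>casimir_scalar_if_irreducible\<close>). For the quotient of the power of \<open>H\<close>,
  whose isotropy representation is a sum of \<open>q - 1\<close> copies of the adjoint representation, \<open>\<pi>\<close> is the average
  over the \<open>q\<close> components, and the trace of \<open>\<pi> \<circ> ad X \<circ> ad Y\<close> is \<open>1 / q\<close> times the sum of the
  Killing forms of the components, so \<open>C = - g / q\<close> (\<open>nabla_einstein_G'\<close>).

  What has to be supplied is the Lie theory behind these computations. In the unit chart the bracket is
  the skew part of the mixed second derivative of the group law. Symmetry of second derivatives makes
  it natural under local homomorphisms (\<open>bracket_of_local_hom\<close>), so \<open>Ad\<close> acts by automorphisms; since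
  the derivative of \<open>Ad\<close> is \<open>ad\<close> (\<open>Ad_derivative\<close>), the Jacobi identity follows. Negativity of the
  Killing form needs an inner product for which every \<open>ad X\<close> is skew. By compactness \<open>Ad\<close> takes values
  in a bounded group of linear maps, and such a group preserves the unique minimiser of an
  invariant, strictly convex functional on a convex set of inner products (\<open>invariant_inner_product\<close>);
  this replaces averaging over the Haar measure. The Killing form can then only degenerate on the
  centre, an ideal, which is zero by simplicity. The Lie algebra of \<open>K\<close>, defined by velocities of curves
  in \<open>K\<close>, is a subalgebra because products and conjugates of curves are curves.

  For the second part the same naturality transports everything along a chart: translation to a
  point of the centre identifies a neighbourhood of the unit of the power of \<open>H\<close> with one of the
  unit of the quotient, and its derivative \<open>L\<close> carries the componentwise bracket, the
  componentwise adjoint action and the diagonal to the bracket, the adjoint action and the isotropy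
  algebra of the quotient (\<open>bracket_L\<close>, \<open>Ad_L\<close>, \<open>lie_subalg_eq\<close>). The quotient has charts because the
  centre is discrete: central elements act trivially by \<open>Ad\<close>, whose derivative at the unit is injective
  (\<open>centre_discrete\<close>).
\<close>

section \<open>Smoothness near a point\<close>

lemma linear_basis_expansion:
  assumes "linear L"
  shows "L v = (\<Sum>b\<in>Basis. (v \<bullet> b) *\<^sub>R L b)"
proof -
  have "L (\<Sum>b\<in>Basis. (v \<bullet> b) *\<^sub>R b) = (\<Sum>b\<in>Basis. (v \<bullet> b) *\<^sub>R L b)"
    by (simp add: linear_sum[OF assms] linear_cmul[OF assms] del: euclidean_representation)
  then show ?thesis by (simp only: euclidean_representation)
qed

lemma Ck_on_cong:
  assumes S: "open S" and "\<And>x. x \<in> S \<Longrightarrow> f x = g x" and "Ck_on k S f"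
  shows "Ck_on k S g"
  using assms(2,3)
proof (induction k arbitrary: f g)
  case 0
  then show ?case using continuous_on_cong by (metis Ck_on.simps(1))
next
  case (Suc k)
  have fd: "f differentiable at x" if "x \<in> S" for x
    using Suc.prems(2) S that by (simp add: differentiable_on_eq_differentiable_at)
  have eq: "frechet_derivative f (at x) = frechet_derivative g (at x)" if "x \<in> S" for x
    using frechet_derivative_transform_within_open[OF fd[OF that] S that] Suc.prems(1) by blast
  have "g differentiable at x" if "x \<in> S" for x
    using fd[OF that] Suc.prems(1) S that
    by (meson differentiable_def has_derivative_transform_within_open)
  then have "g differentiable_on S"
    using S by (simp add: differentiable_on_eq_differentiable_at)
  moreover have "Ck_on k S (\<lambda>x. frechet_derivative g (at x) v)" for v
    using Suc.IH[of "\<lambda>x. frechet_derivative f (at x) v"] eq Suc.prems(2) by auto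
  ultimately show ?case by simp
qed

lemma Ck_on_SucD:
  "open S \<Longrightarrow> Ck_on (Suc k) S f \<Longrightarrow> Ck_on k S f"
proof (induction k arbitrary: f)
  case 0
  then show ?case by (simp add: differentiable_imp_continuous_on)
next
  case (Suc k)
  then show ?case by (metis Ck_on.simps(2))
qed

lemma Ck_on_Suc_intro:
  assumes "open S" and "\<And>x. x \<in> S \<Longrightarrow> (f has_derivative f' x) (at x)"
    and "\<And>v. Ck_on k S (\<lambda>x. f' x v)"
  shows "Ck_on (Suc k) S f"
proof -
  have "f differentiable_on S"
    using assms(1,2) by (auto simp: differentiable_on_eq_differentiable_at differentiable_def)
  moreover have "Ck_on k S (\<lambda>x. frechet_derivative f (at x) v)" for v
    by (rule Ck_on_cong[OF assms(1) _ assms(3)])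
      (simp add: frechet_derivative_at[OF assms(2), symmetric])
  ultimately show ?thesis by simp
qed

lemma Ck_on_SucE:
  assumes "open S" and "Ck_on (Suc k) S f" and "x \<in> S"
  shows "(f has_derivative frechet_derivative f (at x)) (at x)"
  using assms by (simp add: differentiable_on_eq_differentiable_at frechet_derivative_works)

lemma Ck_on_open_subset:
  "open S \<Longrightarrow> open T \<Longrightarrow> T \<subseteq> S \<Longrightarrow> Ck_on k S f
      \<Longrightarrow> Ck_on k T f"
proof (induction k arbitrary: f)
  case 0
  then show ?case using continuous_on_subset by auto
next
  case (Suc k)
  then show ?case by (auto intro: differentiable_on_subset)
qed

lemma Ck_on_const: "open S \<Longrightarrow> Ck_on k S (\<lambda>x. c)"
proof (induction k arbitrary: c)
  case (Suc k)
  then show ?case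
    by (intro Ck_on_Suc_intro[where f' = "\<lambda>_ _. 0"]) auto
qed simp

lemma Ck_on_linear:
  assumes "open S" and "bounded_linear L"
  shows "Ck_on k S L"
proof (cases k)
  case 0
  then show ?thesis using linear_continuous_on[OF assms(2)] by simp
next
  case (Suc j)
  show ?thesis
    unfolding Suc
    by (rule Ck_on_Suc_intro[OF assms(1) bounded_linear_imp_has_derivative[OF assms(2)]
        Ck_on_const[OF assms(1)]])
qed

lemma Ck_on_add:
  "open S \<Longrightarrow> Ck_on k S f \<Longrightarrow> Ck_on k S g \<Longrightarrow> Ck_on k S (\<lambda>x. f x + g x)"
proof (induction k arbitrary: f g)
  case 0
  then show ?case by (simp add: continuous_on_add)
next
  case (Suc k)
  show ?case
  proof (rule Ck_on_Suc_intro[where f' = "\<lambda>x v. frechet_derivative f (at x) v + frechet_derivative g (at x) v"])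
    show "((\<lambda>x. f x + g x) has_derivative
        (\<lambda>v. frechet_derivative f (at x) v + frechet_derivative g (at x) v)) (at x)" if "x \<in> S" for x
      using Ck_on_SucE[OF Suc.prems(1) Suc.prems(2) that] Ck_on_SucE[OF Suc.prems(1) Suc.prems(3) that]
      by (rule has_derivative_add)
  qed (use Suc in auto)
qed

lemma Ck_on_scaleR:
  "open S \<Longrightarrow> Ck_on k S a \<Longrightarrow> Ck_on k S f
      \<Longrightarrow> Ck_on k S (\<lambda>x. a x *\<^sub>R f x)"
proof (induction k arbitrary: a f)
  case 0
  then show ?case by (simp add: continuous_on_scaleR)
next
  case (Suc k)
  show ?case
  proof (rule Ck_on_Suc_intro[where f' = "\<lambda>x v. a x *\<^sub>R frechet_derivative f (at x) v
      + frechet_derivative a (at x) v *\<^sub>R f x"])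
    show "((\<lambda>x. a x *\<^sub>R f x) has_derivative
        (\<lambda>v. a x *\<^sub>R frechet_derivative f (at x) v + frechet_derivative a (at x) v *\<^sub>R f x)) (at x)" if "x \<in> S" for x
      using Ck_on_SucE[OF Suc.prems(1) Suc.prems(2) that] Ck_on_SucE[OF Suc.prems(1) Suc.prems(3) that]
      by (rule has_derivative_scaleR)
    show "Ck_on k S (\<lambda>x. a x *\<^sub>R frechet_derivative f (at x) v
        + frechet_derivative a (at x) v *\<^sub>R f x)" for v
      using Suc.prems Ck_on_SucD[OF Suc.prems(1) Suc.prems(2)] Ck_on_SucD[OF Suc.prems(1) Suc.prems(3)]
      by (intro Ck_on_add Suc.IH) auto
  qed (use Suc in auto)
qed

lemma Ck_on_sum:
  assumes "open S" and "\<And>i. i \<in> I \<Longrightarrow> Ck_on k S (f i)"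
  shows "Ck_on k S (\<lambda>x. \<Sum>i\<in>I. f i x)"
  using assms(2)
proof (induction I rule: infinite_finite_induct)
  case (infinite I)
  then show ?case using Ck_on_const[OF assms(1), of k 0] by simp
next
  case empty
  then show ?case using Ck_on_const[OF assms(1), of k 0] by simp
next
  case (insert i I)
  have "Ck_on k S (\<lambda>x. f i x + (\<Sum>i\<in>I. f i x))"
    using insert by (intro Ck_on_add[OF assms(1)]) auto
  then show ?case using insert by simp
qed

text \<open>The chain rule expresses a directional derivative of \<open>g \<circ> f\<close> as a sum, over a basis, of products of
  components of \<open>Df\<close> with partial derivatives of \<open>g\<close> along \<open>f\<close>. Each factor is of one order less, which is why
  the induction has to let \<open>g\<close> vary.\<close>

lemma Ck_on_compose:
  "open S \<Longrightarrow> open T \<Longrightarrow> f ` S \<subseteq> T \<Longrightarrow> Ck_on k S f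
      \<Longrightarrow> Ck_on k T g \<Longrightarrow> Ck_on k S (\<lambda>x. g (f x))"
proof (induction k arbitrary: g)
  case 0
  then show ?case by (auto intro: continuous_on_compose2)
next
  case (Suc k)
  note opn = Suc.prems(1,2)
  have g: "(g has_derivative frechet_derivative g (at y)) (at y)" if "y \<in> T" for y
    using Ck_on_SucE[OF opn(2) Suc.prems(5) that] .
  have f: "(f has_derivative frechet_derivative f (at x)) (at x)" if "x \<in> S" for x
    using Ck_on_SucE[OF opn(1) Suc.prems(4) that] .
  show ?case
  proof (rule Ck_on_Suc_intro[OF opn(1)])
    show "((\<lambda>x. g (f x)) has_derivative (\<lambda>v. frechet_derivative g (at (f x)) (frechet_derivative
        f (at x) v))) (at x)"
      if "x \<in> S" for x
      using has_derivative_compose[OF f[OF that] g] that Suc.prems(3) by blast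
    fix v
    have eq: "(\<Sum>b\<in>Basis. (frechet_derivative f (at x) v \<bullet> b) *\<^sub>R frechet_derivative g (at (f x)) b)
        = frechet_derivative g (at (f x)) (frechet_derivative f (at x) v)" if "x \<in> S" for x
    proof -
      have "linear (frechet_derivative g (at (f x)))"
        using g[of "f x"] that Suc.prems(3) has_derivative_linear by blast
      then show ?thesis
        by (rule linear_basis_expansion[symmetric])
    qed
    have "Ck_on k S (\<lambda>x. \<Sum>b\<in>Basis. (frechet_derivative f (at x) v \<bullet> b) *\<^sub>R
        frechet_derivative g (at (f x)) b)"
    proof (intro Ck_on_sum opn(1) Ck_on_scaleR)
      fix b :: 'b assume "b \<in> Basis"
      show "Ck_on k S (\<lambda>x. frechet_derivative g (at (f x)) b)"
        using Suc.prems Ck_on_SucD[OF opn(1) Suc.prems(4)] by (intro Suc.IH) auto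
    next
      fix b :: 'b assume "b \<in> Basis"
      define h where "h = (\<lambda>x. frechet_derivative f (at x) v)"
      have "Ck_on k S h" using Suc.prems(4) by (simp add: h_def)
      then have "Ck_on k S (\<lambda>x. h x \<bullet> b)"
      proof (induction k arbitrary: h)
        case 0
        then show ?case by (auto intro: continuous_on_inner continuous_on_const)
      next
        case (Suc k)
        show ?case
          by (rule Ck_on_Suc_intro[OF opn(1) has_derivative_inner_left[OF Ck_on_SucE[OF opn(1) Suc.prems]]])
            (use Suc in auto)
      qed
      then show "Ck_on k S (\<lambda>x. frechet_derivative f (at x) v \<bullet> b)" by (simp add: h_def)
    qed
    then show "Ck_on k S (\<lambda>x. frechet_derivative g (at (f x)) (frechet_derivative f (at x) v))"
      by (rule Ck_on_cong[OF opn(1), rotated]) (rule eq)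
  qed
qed

text \<open>The germ version of smoothness: all constructions with charts below are only defined near a
  point, and stating them at the point avoids carrying domains along.\<close>

definition smooth_at :: "('a::euclidean_space \<Rightarrow> 'b::euclidean_space) \<Rightarrow> 'a \<Rightarrow> bool" where
  "smooth_at f x \<longleftrightarrow> (\<exists>S. open S \<and> x \<in> S \<and> smooth_on S f)"

lemma smooth_atI: "open S \<Longrightarrow> smooth_on S f \<Longrightarrow> x \<in> S \<Longrightarrow> smooth_at f x"
  by (auto simp: smooth_at_def)

lemma smooth_on_subset: "open S \<Longrightarrow> open T \<Longrightarrow> T \<subseteq> S
    \<Longrightarrow> smooth_on S f \<Longrightarrow> smooth_on T f"
  unfolding smooth_on_def using Ck_on_open_subset by blast

lemma smooth_at_cong:
  assumes "smooth_at f x" and "\<forall>\<^sub>F y in nhds x. f y = g y"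
  shows "smooth_at g x"
proof -
  obtain S T where "open S" "x \<in> S" "smooth_on S f" "open T" "x \<in> T" "\<And>y. y \<in> T \<Longrightarrow> f y = g y"
    using assms by (auto simp: smooth_at_def eventually_nhds)
  then have "open (S \<inter> T)" "x \<in> S \<inter> T" "smooth_on (S \<inter> T) f" "\<And>y. y
      \<in> S \<inter> T \<Longrightarrow> f y = g y"
    by (auto intro: smooth_on_subset)
  then have "smooth_on (S \<inter> T) g"
    unfolding smooth_on_def by (metis Ck_on_cong)
  then show ?thesis
    using \<open>open (S \<inter> T)\<close> \<open>x \<in> S \<inter> T\<close> by (auto simp: smooth_at_def)
qed

lemma smooth_at_eventually: "smooth_at f x \<Longrightarrow> \<forall>\<^sub>F y in nhds x. smooth_at f y"
  unfolding smooth_at_def eventually_nhds by blast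

lemma smooth_at_has_derivative:
  assumes "smooth_at f x" shows "(f has_derivative frechet_derivative f (at x)) (at x)"
  using assms Ck_on_SucE unfolding smooth_at_def smooth_on_def by blast

lemma smooth_at_isCont: "smooth_at f x \<Longrightarrow> isCont f x"
  using smooth_at_has_derivative has_derivative_continuous by blast

lemma smooth_at_linear: "bounded_linear L \<Longrightarrow> smooth_at L x"
  unfolding smooth_at_def smooth_on_def using Ck_on_linear by blast

lemma smooth_at_const: "smooth_at (\<lambda>x. c) x"
  unfolding smooth_at_def smooth_on_def using Ck_on_const by blast

lemma smooth_at_directional: "smooth_at f x \<Longrightarrow> smooth_at (\<lambda>y. frechet_derivative f (at y) v) x"
  unfolding smooth_at_def smooth_on_def using Ck_on.simps(2) by blast

lemma smooth_at_compose:
  assumes "smooth_at f x" and "smooth_at g (f x)"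
  shows "smooth_at (\<lambda>y. g (f y)) x"
proof -
  obtain S where S: "open S" "x \<in> S" "smooth_on S f" using assms by (auto simp: smooth_at_def)
  obtain T where T: "open T" "f x \<in> T" "smooth_on T g" using assms by (auto simp: smooth_at_def)
  have "continuous_on S f" using S(3) Ck_on.simps(1) unfolding smooth_on_def by blast
  then have o: "open (S \<inter> f -` T)" using S(1) T(1) by (rule continuous_open_preimage)
  have "Ck_on k (S \<inter> f -` T) (\<lambda>y. g (f y))" for k
  proof (rule Ck_on_compose[OF o T(1)])
    show "Ck_on k (S \<inter> f -` T) f"
      using S(3) Ck_on_open_subset[OF S(1) o] unfolding smooth_on_def by blast
    show "Ck_on k T g" using T(3) unfolding smooth_on_def by blast
  qed auto
  then show ?thesis using o S T unfolding smooth_at_def smooth_on_def by blast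
qed

lemma smooth_at_sum:
  assumes "finite I" and "\<And>i. i \<in> I \<Longrightarrow> smooth_at (f i) x"
  shows "smooth_at (\<lambda>y. \<Sum>i\<in>I. f i y) x"
proof -
  have "\<forall>i\<in>I. \<exists>S. open S \<and> x \<in> S \<and> smooth_on S (f i)"
    using assms by (auto simp: smooth_at_def)
  then obtain S where S: "\<And>i. i \<in> I \<Longrightarrow> open (S i) \<and> x \<in> S i \<and> smooth_on (S i) (f i)"
    by metis
  have o: "open (\<Inter>i\<in>I. S i)" using S assms(1) by auto
  then have "Ck_on k (\<Inter>i\<in>I. S i) (\<lambda>y. \<Sum>i\<in>I. f i y)" for k
    using S by (intro Ck_on_sum) (auto simp: smooth_on_def intro: Ck_on_open_subset[OF _ o])
  then show ?thesis using o S unfolding smooth_at_def smooth_on_def by blast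
qed

lemma smooth_at_add:
  assumes "smooth_at f x" "smooth_at g x" shows "smooth_at (\<lambda>y. f y + g y) x"
proof -
  have "smooth_at (\<lambda>y. \<Sum>i\<in>{True, False}. (if i then f else g) y) x"
    by (rule smooth_at_sum) (use assms in auto)
  then show ?thesis by simp
qed

lemma smooth_at_Pair:
  assumes "smooth_at f x" "smooth_at g x" shows "smooth_at (\<lambda>y. (f y, g y)) x"
proof -
  have "smooth_at (\<lambda>y. (\<lambda>a. (a, 0)) (f y) + (\<lambda>b. (0, b)) (g y)) x"
    by (intro smooth_at_add smooth_at_compose[OF assms(1)] smooth_at_compose[OF assms(2)]
       smooth_at_linear bounded_linear_Pair bounded_linear_ident bounded_linear_zero)
  then show ?thesis by simp
qed

lemma smooth_at_vec:
  fixes f :: "'c::finite \<Rightarrow> 'a::euclidean_space \<Rightarrow> 'b::euclidean_space"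
  assumes "\<And>i. smooth_at (f i) x" shows "smooth_at (\<lambda>y. (\<chi> i. f i y) :: 'b::euclidean_space ^ 'c) x"
proof -
  have "linear (axis i :: 'b \<Rightarrow> 'b ^ 'c)" for i
    by (rule linearI) (auto simp: axis_def vec_eq_iff)
  then have "smooth_at (axis i :: 'b \<Rightarrow> 'b ^ 'c) z" for i z
    by (intro smooth_at_linear) (simp add: linear_conv_bounded_linear)
  then have "smooth_at (\<lambda>y. \<Sum>i\<in>UNIV. (axis i :: 'b \<Rightarrow> 'b ^ 'c) (f i y)) x"
    by (intro smooth_at_sum smooth_at_compose[OF assms]) auto
  moreover have "(\<Sum>i\<in>UNIV. axis i (f i y)) = (\<chi> i. f i y)" for y
    by (simp add: vec_eq_iff axis_def if_distrib cong: if_cong)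
  ultimately show ?thesis by simp
qed

lemma smooth_at_fst: "smooth_at fst x" and smooth_at_snd: "smooth_at snd x"
  by (auto intro: smooth_at_linear bounded_linear_fst bounded_linear_snd)

lemma smooth_at_ident: "smooth_at (\<lambda>x. x) x"
  by (rule smooth_at_linear) (rule bounded_linear_ident)

text \<open>Restricting a smooth function of two variables to a slice; in the last clause this computes
  partial derivatives from the total one.\<close>

lemma smooth_at_slice:
  assumes "smooth_at (\<lambda>(x, y). f x y) (a, b)"
  shows "smooth_at (f a) b"
    and "frechet_derivative (f a) (at b) v = frechet_derivative (\<lambda>(x, y). f x y) (at (a, b)) (0, v)"
proof -
  have p: "smooth_at (\<lambda>y. (a, y)) b" by (intro smooth_at_Pair smooth_at_const smooth_at_ident)
  show "smooth_at (f a) b" using smooth_at_compose[OF p] assms by fastforce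
  have "((\<lambda>y. (a, y)) has_derivative (\<lambda>v. (0, v))) (at b)"
    by (auto intro!: derivative_eq_intros)
  from has_derivative_compose[OF this smooth_at_has_derivative[OF assms]]
  show "frechet_derivative (f a) (at b) v = frechet_derivative (\<lambda>(x, y). f x y) (at (a, b)) (0, v)"
    by (simp add: frechet_derivative_at[symmetric])
qed

lemma eventually_nhds_slice:
  assumes "\<forall>\<^sub>F p in nhds (a, b). P p"
  shows "\<forall>\<^sub>F x in nhds a. P (x, b)"
proof -
  have "filterlim (\<lambda>x. (x, b)) (nhds (a, b)) (nhds a)"
    by (intro tendsto_Pair tendsto_const filterlim_ident)
  then show ?thesis using assms by (auto simp: filterlim_iff)
qed

lemma smooth_at_partial_derivative:
  assumes "smooth_at (\<lambda>(x, y). f x y) (a, b)"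
  shows "smooth_at (\<lambda>x. frechet_derivative (f x) (at b) v) a"
proof (rule smooth_at_cong)
  have "smooth_at (\<lambda>p. frechet_derivative (\<lambda>(x, y). f x y) (at p) (0, v)) (a, b)"
    using assms by (rule smooth_at_directional)
  moreover have "smooth_at (\<lambda>x. (x, b)) a" by (intro smooth_at_Pair smooth_at_const smooth_at_ident)
  ultimately show "smooth_at (\<lambda>x. frechet_derivative (\<lambda>(x, y). f x y) (at (x, b)) (0, v)) a"
    using smooth_at_compose[where g = "\<lambda>p. frechet_derivative (\<lambda>(x, y). f x y) (at p) (0, v)"] by blast
  have "\<forall>\<^sub>F x in nhds a. smooth_at (\<lambda>(x, y). f x y) (x, b)"
    using eventually_nhds_slice[OF smooth_at_eventually[OF assms]] .
  then show "\<forall>\<^sub>F x in nhds a. frechet_derivative (\<lambda>(x, y). f x y) (at (x, b)) (0, v)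
      = frechet_derivative (f x) (at b) v"
    by eventually_elim (simp add: smooth_at_slice)
qed

lemma smooth_at_linear_frechet: "smooth_at f x \<Longrightarrow> linear (frechet_derivative f (at x))"
  using smooth_at_has_derivative has_derivative_linear by blast

lemma has_derivative_cong_nhds:
  assumes "\<forall>\<^sub>F y in nhds x. f y = g y"
  shows "(f has_derivative D) (at x) \<longleftrightarrow> (g has_derivative D) (at x)"
proof -
  have "(q has_derivative D) (at x)"
    if "(p has_derivative D) (at x)" "\<forall>\<^sub>F y in nhds x. p y = q y" for p q
  proof (rule has_derivative_transform_eventually[OF that(1)])
    show "\<forall>\<^sub>F y in at x. p y = q y"
      using that(2) by (simp add: eventually_at_filter eventually_mono)
  qed (use that(2) eventually_nhds_x_imp_x in auto)
  moreover have "\<forall>\<^sub>F y in nhds x. g y = f y" using assms by eventually_elim simp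
  ultimately show ?thesis using assms by blast
qed

lemma frechet_derivative_cong_nhds:
  assumes "\<forall>\<^sub>F y in nhds x. f y = g y"
  shows "frechet_derivative f (at x) = frechet_derivative g (at x)"
  unfolding frechet_derivative_def using has_derivative_cong_nhds[OF assms] by simp

text \<open>Product rule for \<open>Df(x)\<close> applied to a vector \<open>h(x)\<close> that moves with \<open>x\<close>. This is where second derivatives of a
  change of coordinates enter the computation of brackets.\<close>

lemma has_derivative_frechet_apply:
  assumes f: "smooth_at f a" and h: "(h has_derivative h') (at a)"
  shows "((\<lambda>x. frechet_derivative f (at x) (h x)) has_derivative
     (\<lambda>w. frechet_derivative (\<lambda>x. frechet_derivative f (at x) (h a)) (at a) w
        + frechet_derivative f (at a) (h' w))) (at a)"
proof -
  let ?D = "\<lambda>x. frechet_derivative f (at x)"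
  have exp: "?D x v = (\<Sum>b\<in>Basis. (v \<bullet> b) *\<^sub>R ?D x b)" if "smooth_at f x" for x v
    using smooth_at_linear_frechet[OF that] by (rule linear_basis_expansion)
  have d: "((\<lambda>x. ?D x v) has_derivative frechet_derivative (\<lambda>x. ?D x v) (at a)) (at a)" for v
    by (rule smooth_at_has_derivative[OF smooth_at_directional[OF f]])
  have ev: "\<forall>\<^sub>F x in nhds a. (\<Sum>b\<in>Basis. (k x \<bullet> b) *\<^sub>R ?D x b) = ?D x (k x)" for k
    using smooth_at_eventually[OF f] by (rule eventually_mono) (rule exp[symmetric])
  have "((\<lambda>x. \<Sum>b\<in>Basis. (h a \<bullet> b) *\<^sub>R ?D x b) has_derivative
    (\<lambda>w. \<Sum>b\<in>Basis. (h a \<bullet> b) *\<^sub>R frechet_derivative (\<lambda>x. ?D x b) (at a) w)) (at a)"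
    by (rule has_derivative_sum) (rule has_derivative_scaleR_right[OF d])
  then have "((\<lambda>x. ?D x (h a)) has_derivative
    (\<lambda>w. \<Sum>b\<in>Basis. (h a \<bullet> b) *\<^sub>R frechet_derivative (\<lambda>x. ?D x b) (at a) w)) (at a)"
    using has_derivative_cong_nhds[OF ev[of "\<lambda>_. h a"]] by blast
  then have 1: "frechet_derivative (\<lambda>x. ?D x (h a)) (at a) =
      (\<lambda>w. \<Sum>b\<in>Basis. (h a \<bullet> b) *\<^sub>R frechet_derivative (\<lambda>x. ?D x b) (at a) w)"
    by (rule frechet_derivative_at[symmetric])
  have "((\<lambda>x. \<Sum>b\<in>Basis. (h x \<bullet> b) *\<^sub>R ?D x b) has_derivative
     (\<lambda>w. \<Sum>b\<in>Basis. (h a \<bullet> b) *\<^sub>R frechet_derivative (\<lambda>x. ?D x b) (at a) w + (h' w \<bullet> b) *\<^sub>R ?D a b)) (at a)"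
    by (rule has_derivative_sum) (rule has_derivative_scaleR[OF has_derivative_inner_left[OF h] d])
  moreover have "(\<Sum>b\<in>Basis. (h a \<bullet> b) *\<^sub>R frechet_derivative (\<lambda>x. ?D x b) (at a)
      w + (h' w \<bullet> b) *\<^sub>R ?D a b)
     = frechet_derivative (\<lambda>x. ?D x (h a)) (at a) w + ?D a (h' w)" for w
    unfolding 1 sum.distrib using exp[OF f, of "h' w"] by simp
  ultimately have "((\<lambda>x. \<Sum>b\<in>Basis. (h x \<bullet> b) *\<^sub>R ?D x b) has_derivative
     (\<lambda>w. frechet_derivative (\<lambda>x. ?D x (h a)) (at a) w + ?D a (h' w))) (at a)"
    by simp
  then show ?thesis using has_derivative_cong_nhds[OF ev] by blast
qed

text \<open>Two applications of the mean value theorem to the second difference of \<open>F\<close>. The left-hand side is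
  symmetric in the two variables, which forces the mixed partial derivatives to agree.\<close>

lemma second_difference_mean_value:
  fixes F :: "real \<Rightarrow> real \<Rightarrow> real"
  assumes h: "0 < h"
    and 1: "\<And>s t. \<bar>s\<bar> \<le> h \<Longrightarrow> \<bar>t\<bar> \<le> h
        \<Longrightarrow> ((\<lambda>s. F s t) has_real_derivative Fs s t) (at s)"
    and 2: "\<And>s t. \<bar>s\<bar> \<le> h \<Longrightarrow> \<bar>t\<bar> \<le> h \<Longrightarrow> (Fs s
        has_real_derivative Fst s t) (at t)"
  shows "\<exists>s t. \<bar>s\<bar> \<le> h \<and> \<bar>t\<bar> \<le> h \<and> F h h - F h 0 - F 0 h + F 0 0
      = h\<^sup>2 * Fst s t"
proof -
  have d: "((\<lambda>s. F s h - F s 0) has_real_derivative Fs s h - Fs s 0) (at s)" if "0 \<le> s" "s \<le> h" for s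
    using DERIV_diff[OF 1[of s h] 1[of s 0]] that h by simp
  obtain s where s: "0 < s" "s < h" "(F h h - F h 0) - (F 0 h - F 0 0) = (h - 0) * (Fs s h - Fs s 0)"
    using MVT2[OF h d] by blast
  obtain t where t: "0 < t" "t < h" "Fs s h - Fs s 0 = (h - 0) * Fst s t"
    using MVT2[OF h, of "Fs s" "Fst s"] 2[of s] s by auto
  show ?thesis
    using s t by (intro exI[of _ s] exI[of _ t]) (auto simp: power2_eq_square algebra_simps)
qed

lemma frechet_derivative_symmetric:
  fixes f :: "'a::euclidean_space \<Rightarrow> 'b::euclidean_space"
  assumes f: "smooth_at f a"
  shows "frechet_derivative (\<lambda>x. frechet_derivative f (at x) v) (at a) w
       = frechet_derivative (\<lambda>x. frechet_derivative f (at x) w) (at a) v"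
proof (rule euclidean_eqI)
  fix b :: 'b assume "b \<in> Basis"
  let ?D2 = "\<lambda>v w x. frechet_derivative (\<lambda>x. frechet_derivative f (at x) v) (at x) w"
  have line: "((\<lambda>s. g (p + s *\<^sub>R u) \<bullet> b)
      has_real_derivative (frechet_derivative g (at (p + s *\<^sub>R u)) u \<bullet> b)) (at s)"
    if "smooth_at g (p + s *\<^sub>R u)" for g :: "'a \<Rightarrow> 'b" and p u s
  proof -
    let ?Dg = "frechet_derivative g (at (p + s *\<^sub>R u))"
    have "((\<lambda>s. p + s *\<^sub>R u) has_derivative (\<lambda>h. h *\<^sub>R u)) (at s)"
      by (auto intro!: derivative_eq_intros)
    from has_derivative_inner_left[OF has_derivative_compose[OF this smooth_at_has_derivative[OF that]]]
    have "((\<lambda>s. g (p + s *\<^sub>R u) \<bullet> b)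
        has_derivative (\<lambda>h. ?Dg (h *\<^sub>R u) \<bullet> b)) (at s)" .
    moreover have "?Dg (h *\<^sub>R u) \<bullet> b = (?Dg u \<bullet> b) * h" for h
      using linear_cmul[OF smooth_at_linear_frechet[OF that]] by simp
    ultimately show ?thesis by (simp add: has_field_derivative_def)
  qed
  obtain S where S: "open S" "a \<in> S" "\<And>x. x \<in> S \<Longrightarrow> smooth_at f x"
    using smooth_at_eventually[OF f] by (auto simp: eventually_nhds)
  have key: "\<exists>x y. dist x a < e \<and> dist y a < e \<and> ?D2 v w x \<bullet> b
      = ?D2 w v y \<bullet> b" if "0 < e" for e
  proof -
    obtain r where r: "0 < r" "ball a r \<subseteq> S" using S openE by blast
    \<comment> \<open>the parallelogram spanned by \<open>h v\<close> and \<open>h w\<close> has to stay within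
        distance \<open>min r e\<close> of \<open>a\<close>\<close>
    define h where "h = min r e / (2 * (norm v + norm w + 1))"
    have np: "0 < norm v + norm w + 1" by (simp add: add_nonneg_pos)
    have h: "0 < h" using r that np by (simp add: h_def)
    have near: "dist (a + s *\<^sub>R v + t *\<^sub>R w) a < min r e"
        if "\<bar>s\<bar> \<le> h" "\<bar>t\<bar> \<le> h" for s t
    proof -
      have "dist (a + s *\<^sub>R v + t *\<^sub>R w) a \<le> \<bar>s\<bar> * norm v + \<bar>t\<bar> * norm w"
        using norm_triangle_ineq[of "s *\<^sub>R v" "t *\<^sub>R w"] by (simp add: dist_norm)
      also have "\<dots> \<le> h * norm v + h * norm w"
        using that by (intro add_mono mult_right_mono) auto
      also have "\<dots> < 2 * (h * (norm v + norm w + 1))"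
      proof -
        have "0 \<le> h * norm v" "0 \<le> h * norm w" using h by auto
        moreover have "p + q < 2 * (p + q + h)" if "0 \<le> p" "0 \<le> q" for p q
          using that h by auto
        ultimately have "h * norm v + h * norm w < 2 * (h * norm v + h * norm w + h)" by blast
        then show ?thesis by (simp only: distrib_left mult_1_right)
      qed
      also have "\<dots> = min r e" using np by (simp add: h_def field_simps)
      finally show ?thesis .
    qed
    have sm: "smooth_at f (a + s *\<^sub>R v + t *\<^sub>R w)" if "\<bar>s\<bar> \<le> h" "\<bar>t\<bar> \<le> h" for s t
      using near[OF that] r S(3) by (metis dist_commute mem_ball min_less_iff_conj subsetD)
    define F where "F = (\<lambda>s t. f (a + s *\<^sub>R v + t *\<^sub>R w) \<bullet> b)"
    have "\<exists>s t. \<bar>s\<bar> \<le> h \<and> \<bar>t\<bar> \<le> h \<and> F h h - F h 0 - F 0 h + F 0 0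
        = h\<^sup>2 * (?D2 v w (a + s *\<^sub>R v + t *\<^sub>R w) \<bullet> b)"
    proof (rule second_difference_mean_value[where Fs = "\<lambda>s t. frechet_derivative f (at (a
        + s *\<^sub>R v + t *\<^sub>R w)) v \<bullet> b", OF h])
      fix s t :: real assume st: "\<bar>s\<bar> \<le> h" "\<bar>t\<bar> \<le> h"
      show "((\<lambda>s. F s t) has_real_derivative frechet_derivative f (at (a + s *\<^sub>R v
          + t *\<^sub>R w)) v \<bullet> b) (at s)"
        using line[of f "a + t *\<^sub>R w" s v] sm[OF st] by (simp add: F_def add_ac)
      show "((\<lambda>t. frechet_derivative f (at (a + s *\<^sub>R v + t *\<^sub>R w)) v \<bullet> b) has_real_derivative
          ?D2 v w (a + s *\<^sub>R v + t *\<^sub>R w) \<bullet> b) (at t)"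
        using line[OF smooth_at_directional[OF sm[OF st]]] .
    qed
    then obtain s t where st: "\<bar>s\<bar> \<le> h" "\<bar>t\<bar> \<le> h"
      "F h h - F h 0 - F 0 h + F 0 0 = h\<^sup>2 * (?D2 v w (a + s *\<^sub>R v + t *\<^sub>R w) \<bullet> b)"
      by blast
    have "\<exists>t s. \<bar>t\<bar> \<le> h \<and> \<bar>s\<bar> \<le> h \<and> F h h - F 0 h - F h 0 + F 0 0
        = h\<^sup>2 * (?D2 w v (a + s *\<^sub>R v + t *\<^sub>R w) \<bullet> b)"
    proof (rule second_difference_mean_value[where F = "\<lambda>t s. F s t" and Fs = "\<lambda>t s.
        frechet_derivative f (at (a + s *\<^sub>R v + t *\<^sub>R w)) w \<bullet> b", OF h])
      fix t s :: real assume st: "\<bar>t\<bar> \<le> h" "\<bar>s\<bar> \<le> h"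
      show "((\<lambda>t. F s t) has_real_derivative frechet_derivative f (at (a + s *\<^sub>R v
          + t *\<^sub>R w)) w \<bullet> b) (at t)"
        using line[OF sm[OF st(2,1)]] by (simp add: F_def)
      show "((\<lambda>s. frechet_derivative f (at (a + s *\<^sub>R v + t *\<^sub>R w)) w \<bullet> b) has_real_derivative
          ?D2 w v (a + s *\<^sub>R v + t *\<^sub>R w) \<bullet> b) (at s)"
        using line[of "\<lambda>x. frechet_derivative f (at x) w" "a + t *\<^sub>R w" s v]
          smooth_at_directional[OF sm[OF st(2,1)]] by (simp add: add_ac)
    qed
    then obtain s' t' where st': "\<bar>s'\<bar> \<le> h" "\<bar>t'\<bar> \<le> h"
      "F h h - F 0 h - F h 0 + F 0 0 = h\<^sup>2 * (?D2 w v (a + s' *\<^sub>R v + t' *\<^sub>R w) \<bullet> b)"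
      by blast
    have "?D2 v w (a + s *\<^sub>R v + t *\<^sub>R w) \<bullet> b
        = ?D2 w v (a + s' *\<^sub>R v + t' *\<^sub>R w) \<bullet> b"
      using st(3) st'(3) h by (simp add: algebra_simps)
    then show ?thesis using near[OF st(1,2)] near[OF st'(1,2)] by (meson min_less_iff_conj)
  qed
  have cont: "isCont (\<lambda>x. ?D2 v w x \<bullet> b) a" for v w
    by (intro continuous_intros smooth_at_isCont smooth_at_directional f)
  show "?D2 v w a \<bullet> b = ?D2 w v a \<bullet> b"
  proof (rule ccontr)
    assume ne: "?D2 v w a \<bullet> b \<noteq> ?D2 w v a \<bullet> b"
    define \<epsilon> where "\<epsilon> = \<bar>?D2 v w a \<bullet> b - ?D2 w v a \<bullet> b\<bar> / 2"
    have "0 < \<epsilon>" using ne by (simp add: \<epsilon>_def)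
    then obtain d1 d2 where d: "0 < d1" "\<And>x. dist x a < d1
        \<Longrightarrow> dist (?D2 v w x \<bullet> b) (?D2 v w a \<bullet> b) < \<epsilon>"
      "0 < d2" "\<And>x. dist x a < d2 \<Longrightarrow> dist (?D2 w v x \<bullet> b) (?D2 w v a \<bullet> b) < \<epsilon>"
      using cont[of v w] cont[of w v] unfolding continuous_at_eps_delta by metis
    obtain x y where xy: "dist x a < min d1 d2" "dist y a < min d1 d2" "?D2 v w x \<bullet> b = ?D2 w v y \<bullet> b"
      using key[of "min d1 d2"] d by auto
    have "dist (?D2 v w x \<bullet> b) (?D2 v w a \<bullet> b) < \<epsilon>" "dist (?D2 v w x \<bullet> b) (?D2
        w v a \<bullet> b) < \<epsilon>"
      using d(2)[of x] d(4)[of y] xy by auto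
    moreover have "\<not> (\<bar>p - q\<bar> < \<bar>q - r\<bar> / 2
        \<and> \<bar>p - r\<bar> < \<bar>q - r\<bar> / 2)" for p q r :: real
      by (smt (verit) field_sum_of_halves)
    ultimately show False unfolding dist_real_def \<epsilon>_def by blast
  qed
qed

section \<open>Traces and orthonormal bases\<close>

lemma lin_trace_compose:
  fixes P :: "'f::euclidean_space \<Rightarrow> 'e::euclidean_space" and Q :: "'e \<Rightarrow> 'f"
  assumes "linear P"
  shows "lin_trace (\<lambda>x. P (Q x)) = (\<Sum>b\<in>Basis. \<Sum>c\<in>Basis. (Q b \<bullet> c) * (P c \<bullet> b))"
  unfolding lin_trace_def
  by (subst linear_basis_expansion[OF assms]) (simp add: inner_sum_left)

lemma lin_trace_commute:
  fixes A :: "'f::euclidean_space \<Rightarrow> 'e::euclidean_space" and B :: "'e \<Rightarrow> 'f"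
  assumes A: "linear A" and B: "linear B"
  shows "lin_trace (\<lambda>x. A (B x)) = lin_trace (\<lambda>x. B (A x))"
  unfolding lin_trace_compose[OF A] lin_trace_compose[OF B]
  by (subst sum.swap) (simp add: mult.commute)

lemma lin_trace_diff: "lin_trace (\<lambda>x. f x - g x) = lin_trace f - lin_trace g"
  by (simp add: lin_trace_def inner_diff_left sum_subtractf)

lemma lin_trace_add: "lin_trace (\<lambda>x. f x + g x) = lin_trace f + lin_trace g"
  by (simp add: lin_trace_def inner_add_left sum.distrib)

lemma lin_trace_scaleR: "lin_trace (\<lambda>x. r *\<^sub>R f x) = r * lin_trace f"
  by (simp add: lin_trace_def sum_distrib_left)

lemma lin_trace_conjugate:
  assumes "linear A" "linear T" "linear T'" and "\<And>x. T' (T x) = x"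
  shows "lin_trace (\<lambda>x. T (A (T' x))) = lin_trace A"
proof -
  have "linear (\<lambda>x. A (T' x))" using linear_compose[OF assms(3,1)] by (simp add: o_def)
  from lin_trace_commute[OF assms(2) this] show ?thesis using assms(4) by simp
qed

definition orthonormal_wrt :: "('a::real_vector \<Rightarrow> 'a \<Rightarrow> real) \<Rightarrow> 'a set
    \<Rightarrow> bool" where
  "orthonormal_wrt Q E \<longleftrightarrow> (\<forall>e\<in>E. \<forall>e'\<in>E. Q e e' = (if e = e' then 1 else 0))"

lemma bilinear_linear: assumes "bilinear h" shows "linear (h x)" "linear (\<lambda>x. h x y)"
  using assms by (auto simp: bilinear_def)

lemma orthonormal_coeff:
  assumes Q: "bilinear Q" and E: "finite E" "orthonormal_wrt Q E" and e: "e \<in> E"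
  shows "Q (\<Sum>f\<in>E. r f *\<^sub>R f) e = r e"
proof -
  have "Q (\<Sum>f\<in>E. r f *\<^sub>R f) e = (\<Sum>f\<in>E. r f * Q f e)"
    by (simp add: linear_sum[OF bilinear_linear(2)[OF Q]] linear_cmul[OF bilinear_linear(2)[OF Q]])
  also have "\<dots> = (\<Sum>f\<in>E. if f = e then r f else 0)"
    using E(2) e by (intro sum.cong) (auto simp: orthonormal_wrt_def)
  also have "\<dots> = r e" using E(1) e by simp
  finally show ?thesis .
qed

lemma orthonormal_expansion:
  assumes Q: "bilinear Q" and E: "finite E" "orthonormal_wrt Q E" and x: "x \<in> span E"
  shows "x = (\<Sum>e\<in>E. Q x e *\<^sub>R e)"
proof -
  obtain r where r: "x = (\<Sum>e\<in>E. r e *\<^sub>R e)" using x span_finite[OF E(1)] by auto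
  then have "Q x e = r e" if "e \<in> E" for e using orthonormal_coeff[OF Q E that] by simp
  then show ?thesis using r by simp
qed

lemma orthonormal_independent:
  assumes Q: "bilinear Q" and E: "finite E" "orthonormal_wrt Q E"
  shows "independent E"
proof -
  have "r e = 0" if "(\<Sum>e\<in>E. r e *\<^sub>R e) = 0" "e \<in> E" for r e
    using orthonormal_coeff[OF Q E that(2), of r] that linear_0[OF bilinear_linear(2)[OF Q]] by simp
  then show ?thesis by (rule independent_if_scalars_zero[OF E(1)])
qed

text \<open>An orthonormal subset of maximal size spans \<open>S\<close>: otherwise the Gram-Schmidt step would produce one
  more vector, while independence bounds the size by the dimension.\<close>

lemma orthonormal_basis_wrt_exists:
  fixes S :: "'e::euclidean_space set"
  assumes Q: "bilinear Q" and sym: "\<And>x y. Q x y = Q y x" and S: "subspace S"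
    and pos: "\<And>x. x \<in> S \<Longrightarrow> x \<noteq> 0 \<Longrightarrow> 0 < Q x x"
  shows "\<exists>E. finite E \<and> span E = S \<and> orthonormal_wrt Q E"
proof -
  define P where "P = (\<lambda>E. finite E \<and> E \<subseteq> S \<and> orthonormal_wrt Q E)"
  have bound: "card E \<le> DIM('e)" if "P E" for E
    using independent_bound[OF orthonormal_independent[OF Q]] that by (auto simp: P_def)
  have "P {}" by (simp add: P_def orthonormal_wrt_def)
  then have "\<exists>E. P E \<and> (\<forall>F. P F \<longrightarrow> card F \<le> card E)"
    by (rule ex_has_greatest_nat[where b = "Suc DIM('e)"]) (use bound in \<open>simp add: less_Suc_eq_le\<close>)
  then obtain E where E: "P E" "\<And>F. P F \<Longrightarrow> card F \<le> card E" by blast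
  have fin: "finite E" "E \<subseteq> S" "orthonormal_wrt Q E" using E(1) by (auto simp: P_def)
  have "S \<subseteq> span E"
  proof (rule ccontr)
    assume "\<not> S \<subseteq> span E"
    then obtain x where x: "x \<in> S" "x \<notin> span E" by blast
    define y where "y = x - (\<Sum>e\<in>E. Q x e *\<^sub>R e)"
    have sE: "(\<Sum>e\<in>E. Q x e *\<^sub>R e) \<in> span E" by (intro span_sum span_scale span_base)
    have "span E \<subseteq> S" using fin(2) S by (simp add: span_minimal)
    then have yS: "y \<in> S" using x sE S by (auto simp: y_def intro: subspace_diff)
    have ne: "y \<notin> span E"
    proof
      assume "y \<in> span E"
      then have "y + (\<Sum>e\<in>E. Q x e *\<^sub>R e) \<in> span E" using sE by (rule span_add)
      then show False using x by (simp add: y_def)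
    qed
    then have "y \<noteq> 0" using span_zero by metis
    then have p: "0 < Q y y" using pos yS by blast
    have ye: "Q y e = 0" if "e \<in> E" for e
      using orthonormal_coeff[OF Q fin(1,3) that, of "Q x"] linear_diff[OF bilinear_linear(2)[OF Q, of e]]
      by (simp add: y_def)
    define z where "z = (1 / sqrt (Q y y)) *\<^sub>R y"
    have ze: "Q z e = 0" if "e \<in> E" for e
      using ye[OF that] linear_cmul[OF bilinear_linear(2)[OF Q, of e]] by (simp add: z_def)
    have zz: "Q z z = 1"
      using p linear_cmul[OF bilinear_linear(2)[OF Q]] linear_cmul[OF bilinear_linear(1)[OF Q]]
      by (simp add: z_def)
    have "z \<notin> E" using ze zz by force
    have "P (insert z E)"
      using fin ze zz yS sym \<open>z \<notin> E\<close> S unfolding P_def orthonormal_wrt_def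
      by (auto simp: z_def subspace_scale)
    from E(2)[OF this] show False using \<open>z \<notin> E\<close> fin(1) by simp
  qed
  moreover have "span E \<subseteq> S" using fin(2) S by (simp add: span_minimal)
  ultimately show ?thesis using fin by blast
qed

text \<open>The map \<open>p\<close> is the orthogonal projection onto the span of \<open>E\<close>. Precomposition with it restricts the trace of
  \<open>F\<close> to that span, where it can be computed in the basis \<open>E\<close>.\<close>

lemma lin_trace_orthonormal:
  fixes F :: "'e::euclidean_space \<Rightarrow> 'e"
  assumes Q: "bilinear Q" and F: "linear F" and p: "\<And>x. p x = (\<Sum>e\<in>E. Q x e *\<^sub>R e)"
  shows "lin_trace (\<lambda>x. F (p x)) = (\<Sum>e\<in>E. Q (F e) e)"
proof -
  have "Q (F e) e = (\<Sum>b\<in>Basis. Q b e * (F e \<bullet> b))" for e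
  proof -
    have "linear (\<lambda>x. Q x e)" using Q by (rule bilinear_linear)
    from linear_basis_expansion[OF this, of "F e"] show ?thesis by (simp add: mult.commute)
  qed
  then have "(\<Sum>e\<in>E. Q (F e) e) = (\<Sum>b\<in>Basis. \<Sum>e\<in>E. Q b e * (F e \<bullet> b))"
    using sum.swap by simp
  also have "\<dots> = lin_trace (\<lambda>x. F (p x))"
    unfolding lin_trace_def p by (simp add: linear_sum[OF F] linear_cmul[OF F] inner_sum_left)
  finally show ?thesis by simp
qed

section \<open>Inner products invariant under a bounded group\<close>

text \<open>An operator \<open>T\<close> stands for the form \<open>T v \<bullet> w\<close>. On the convex set \<open>\<C>\<close> of forms that are bounded below along all
  of \<open>\<A>\<close>, minimise the supremum over \<open>A \<in> \<A>\<close> of the squared Hilbert-Schmidt norm \<open>N A T\<close> of the form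
  transformed by \<open>A\<close>. The functional and \<open>\<C>\<close> are invariant under the group, and the
  parallelogram identity makes the minimiser unique, hence invariant.\<close>

lemma invariant_inner_product:
  fixes \<A> :: "('e::euclidean_space \<Rightarrow> 'e) set"
  assumes lin: "\<And>A. A \<in> \<A> \<Longrightarrow> linear A"
    and one: "(\<lambda>x. x) \<in> \<A>"
    and comp: "\<And>A B. A \<in> \<A> \<Longrightarrow> B \<in> \<A> \<Longrightarrow> (\<lambda>x. A (B x)) \<in> \<A>"
    and inv: "\<And>A. A \<in> \<A> \<Longrightarrow> \<exists>B\<in>\<A>. \<forall>x. A (B x) = x \<and> B (A x) = x"
    and bd: "\<And>A x. A \<in> \<A> \<Longrightarrow> norm (A x) \<le> C * norm x"
  shows "\<exists>Q. bilinear Q \<and> (\<forall>x y. Q x y = Q y x) \<and> (\<forall>x. x \<noteq> 0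
      \<longrightarrow> 0 < Q x x) \<and>
      (\<forall>A\<in>\<A>. \<forall>x y. Q (A x) (A y) = (Q x y :: real))"
proof -
  define I where "I = (Basis :: 'e set) \<times> (Basis :: 'e set)"
  have finI: "finite I" by (simp add: I_def)
  define N where "N = (\<lambda>(A :: 'e \<Rightarrow> 'e) (T :: 'e \<Rightarrow>\<^sub>L 'e). \<Sum>(b,
      c)\<in>I. (T (A b) \<bullet> A c)\<^sup>2)"
  define \<C> where "\<C> = {T :: 'e \<Rightarrow>\<^sub>L 'e. (\<forall>v w. T v \<bullet> w = v \<bullet> T w) \<and>
     (\<forall>A\<in>\<A>. \<forall>v. (norm v)\<^sup>2 \<le> T (A v) \<bullet> A v)}"
  define R where "R = {r. \<exists>T\<in>\<C>. \<forall>A\<in>\<A>. N A T \<le> r}"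
  have N0: "0 \<le> N A T" for A T unfolding N_def by (intro sum_nonneg) auto
  have C0: "0 \<le> C"
  proof -
    obtain b :: 'e where "b \<in> Basis" using nonempty_Basis by blast
    then show ?thesis using bd[OF one, of b] by simp
  qed
  have R0: "0 \<le> r" if "r \<in> R" for r
    using that N0 one order_trans unfolding R_def by blast
  have Rne: "R \<noteq> {}"
  proof -
    \<comment> \<open>a multiple of the standard inner product lies in \<open>\<C>\<close>, since inverses are
        bounded by the same constant\<close>
    define T where "T = C\<^sup>2 *\<^sub>R (id_blinfun :: 'e \<Rightarrow>\<^sub>L 'e)"
    have Ta: "T v = C\<^sup>2 *\<^sub>R v" for v by (simp add: T_def scaleR_blinfun.rep_eq)
    have "(norm v)\<^sup>2 \<le> T (A v) \<bullet> A v" if "A \<in> \<A>" for A v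
    proof -
      obtain B where B: "B \<in> \<A>" "\<And>x. B (A x) = x" using inv[OF \<open>A \<in> \<A>\<close>] by blast
      have "norm v \<le> C * norm (A v)" using bd[OF B(1), of "A v"] B(2) by simp
      then have "(norm v)\<^sup>2 \<le> (C * norm (A v))\<^sup>2" by (rule power_mono) simp
      then show ?thesis by (simp add: Ta power_mult_distrib power2_norm_eq_inner)
    qed
    then have TC: "T \<in> \<C>" by (simp add: \<C>_def Ta)
    have "N A T \<le> (\<Sum>(b, c)\<in>I. (C\<^sup>2 * (C * C))\<^sup>2)" if A: "A \<in> \<A>" for A
      unfolding N_def
    proof (rule sum_mono, safe)
      fix b c assume "(b, c) \<in> I"
      then have "norm (A b) \<le> C" "norm (A c) \<le> C" using bd[OF A, of b] bd[OF A, of c] by (auto simp: I_def)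
      then have "\<bar>A b \<bullet> A c\<bar> \<le> C * C"
        by (meson Cauchy_Schwarz_ineq2 C0 mult_mono norm_ge_zero order_trans)
      then have "\<bar>T (A b) \<bullet> A c\<bar> \<le> C\<^sup>2 * (C * C)"
        by (simp add: Ta abs_mult mult_left_mono)
      then show "(T (A b) \<bullet> A c)\<^sup>2 \<le> (C\<^sup>2 * (C * C))\<^sup>2"
        using power_mono[of "\<bar>T (A b) \<bullet> A c\<bar>" _ 2] by simp
    qed
    then show ?thesis using TC unfolding R_def by blast
  qed
  define m where "m = Inf R"
  have bdd: "bdd_below R" using R0 by (rule bdd_belowI)
  have m_le: "m \<le> r" if "r \<in> R" for r unfolding m_def by (rule cInf_lower[OF that bdd])
  have "\<exists>T\<in>\<C>. \<forall>A\<in>\<A>. N A T \<le> m + 1 / real (Suc n)" for n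
  proof -
    have "m < m + 1 / real (Suc n)" by simp
    then obtain r where "r \<in> R" "r < m + 1 / real (Suc n)"
      using cInf_less_iff[OF Rne bdd] unfolding m_def by blast
    then show ?thesis unfolding R_def by force
  qed
  then obtain T where T: "\<And>n. T n \<in> \<C>" "\<And>n A. A \<in> \<A> \<Longrightarrow> N A (T n)
      \<le> m + 1 / real (Suc n)"
    by metis
  \<comment> \<open>\<open>N\<close> at the identity is the squared Hilbert-Schmidt norm, so minimising
      sequences are bounded\<close>
  have Tb: "norm (T n) \<le> real DIM('e) * sqrt (m + 1)" for n
  proof (rule norm_blinfun_bound)
    have m0: "0 \<le> m" unfolding m_def using Rne R0 by (rule cInf_greatest)
    then show "0 \<le> real DIM('e) * sqrt (m + 1)" by simp
    fix x
    have Nn: "N (\<lambda>x. x) (T n) \<le> m + 1" using T(2)[OF one, of n] by (simp add: order_trans[OF _ add_left_mono])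
    have Tnb: "norm (T n b) \<le> sqrt (m + 1)" if "b \<in> Basis" for b
    proof -
      have "(norm (T n b))\<^sup>2 = (\<Sum>c\<in>Basis. (T n b \<bullet> c)\<^sup>2)"
        by (subst power2_norm_eq_inner, subst euclidean_inner) (simp add: power2_eq_square)
      also have "\<dots> \<le> (\<Sum>b\<in>Basis. \<Sum>c\<in>Basis. (T n b \<bullet> c)\<^sup>2)"
        by (rule member_le_sum[OF that,
            where f = "\<lambda>b. \<Sum>c\<in>Basis. (T n b \<bullet> c)\<^sup>2"]) (auto intro: sum_nonneg)
      also have "\<dots> = N (\<lambda>x. x) (T n)" by (simp add: N_def I_def sum.cartesian_product)
      finally show ?thesis using Nn by (intro real_le_rsqrt) simp
    qed
    have "norm (T n x) = norm (\<Sum>b\<in>Basis. (x \<bullet> b) *\<^sub>R T n b)"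
      using linear_basis_expansion[of "T n" x] bounded_linear.linear[OF blinfun.bounded_linear_right] by metis
    also have "\<dots> \<le> (\<Sum>b\<in>Basis. norm ((x \<bullet> b) *\<^sub>R T n b))" by (rule norm_sum)
    also have "\<dots> \<le> (\<Sum>b\<in>(Basis :: 'e set). norm x * sqrt (m + 1))"
      by (intro sum_mono) (auto intro!: mult_mono Tnb Basis_le_norm)
    finally show "norm (T n x) \<le> real DIM('e) * sqrt (m + 1) * norm x" by (simp add: mult_ac)
  qed
  then have "bounded (range T)" by (auto simp: bounded_iff)
  then obtain T0 and s :: "nat \<Rightarrow> nat" where s: "strict_mono s" "(T \<circ> s) \<longlonglongrightarrow> T0"
    using bounded_imp_convergent_subsequence by blast
  have lim: "(\<lambda>k. T (s k) v \<bullet> w) \<longlonglongrightarrow> T0 v \<bullet> w" for v w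
    using s(2) by (intro tendsto_intros) (simp add: o_def)
  have T0C: "T0 \<in> \<C>"
  proof -
    have "T0 v \<bullet> w = v \<bullet> T0 w" for v w
    proof (rule LIMSEQ_unique[OF lim])
      have "(\<lambda>k. T (s k) w \<bullet> v) \<longlonglongrightarrow> T0 w \<bullet> v" by (rule lim)
      moreover have "T (s k) w \<bullet> v = T (s k) v \<bullet> w" for k using T(1)[of "s k"]
          by (simp add: \<C>_def inner_commute)
      ultimately show "(\<lambda>k. T (s k) v \<bullet> w) \<longlonglongrightarrow> v \<bullet> T0 w"
          by (simp add: inner_commute)
    qed
    moreover have "(norm v)\<^sup>2 \<le> T0 (A v) \<bullet> A v" if "A \<in> \<A>" for A v
    proof (rule LIMSEQ_le_const[OF lim])
      have "(norm v)\<^sup>2 \<le> T n (A v) \<bullet> A v" for n using T(1)[of n] that unfolding \<C>_def by blast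
      then show "\<exists>N. \<forall>n\<ge>N. (norm v)\<^sup>2 \<le> T (s n) (A v) \<bullet> A v" by blast
    qed
    ultimately show ?thesis by (simp add: \<C>_def)
  qed
  have T0N: "N A T0 \<le> m" if A: "A \<in> \<A>" for A
  proof (rule LIMSEQ_le)
    show "(\<lambda>k. N A (T (s k))) \<longlonglongrightarrow> N A T0"
      unfolding N_def case_prod_unfold by (intro tendsto_sum tendsto_power lim)
    have "(\<lambda>n. m + 1 / real (Suc n)) \<longlonglongrightarrow> m + 0"
      by (intro tendsto_add tendsto_const) (rule LIMSEQ_Suc[OF lim_1_over_n])
    then show "(\<lambda>k. m + 1 / real (Suc (s k))) \<longlonglongrightarrow> m"
      using LIMSEQ_subseq_LIMSEQ[OF _ s(1)] by (fastforce simp: o_def)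
    show "\<exists>N0. \<forall>n\<ge>N0. N A (T (s n)) \<le> m + 1 / real (Suc (s n))" using T(2)[OF A] by blast
  qed
  have invar: "T0 (B v) \<bullet> B w = T0 v \<bullet> w" if B: "B \<in> \<A>" for B v w
  proof (rule ccontr)
    assume ne: "T0 (B v) \<bullet> B w \<noteq> T0 v \<bullet> w"
    define T' where "T' = Blinfun (\<lambda>v. adjoint B (T0 (B v)))"
    have lB: "linear B" by (rule lin[OF B])
    have "bounded_linear (\<lambda>v. adjoint B (T0 (B v)))"
      by (rule bounded_linear_compose[OF adjoint_linear[OF lB, unfolded linear_conv_bounded_linear]
            bounded_linear_compose[OF blinfun.bounded_linear_right lB[unfolded linear_conv_bounded_linear]]])
    then have T': "T' x \<bullet> y = T0 (B x) \<bullet> B y" for x y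
      using adjoint_works[OF lB, of y "T0 (B x)"]
      by (simp add: T'_def bounded_linear_Blinfun_apply inner_commute)
    have T'C: "T' \<in> \<C>"
    proof -
      have "T' x \<bullet> y = x \<bullet> T' y" for x y
        using T0C by (simp add: T' inner_commute[of x] \<C>_def) (metis inner_commute)
      moreover have "(norm x)\<^sup>2 \<le> T' (A x) \<bullet> A x" if "A \<in> \<A>" for A x
        using T0C comp[OF B that] by (auto simp: T' \<C>_def)
      ultimately show ?thesis by (simp add: \<C>_def)
    qed
    have T'N: "N A T' \<le> m" if "A \<in> \<A>" for A
      using T0N[OF comp[OF B that]] by (simp add: N_def T')
    define D where "D = T' - T0"
    define S where "S = (1 / 2) *\<^sub>R (T0 + T')"
    have Sa: "S x \<bullet> y = (T0 x \<bullet> y + T' x \<bullet> y) / 2" for x y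
      by (simp add: S_def scaleR_blinfun.rep_eq plus_blinfun.rep_eq inner_add_left)
    have Da: "D x \<bullet> y = T' x \<bullet> y - T0 x \<bullet> y" for x y
      by (simp add: D_def minus_blinfun.rep_eq inner_diff_left)
    have SC: "S \<in> \<C>"
    proof -
      have "S x \<bullet> y = x \<bullet> S y" for x y
        using T0C T'C by (simp add: Sa inner_commute[of x] \<C>_def)
      moreover have "(norm x)\<^sup>2 \<le> S (A x) \<bullet> A x" if "A \<in> \<A>" for A x
      proof -
        have "(norm x)\<^sup>2 \<le> T0 (A x) \<bullet> A x" "(norm x)\<^sup>2 \<le> T' (A x) \<bullet> A x"
          using T0C T'C that by (auto simp: \<C>_def)
        then show ?thesis unfolding Sa by argo
      qed
      ultimately show ?thesis by (simp add: \<C>_def)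
    qed
    \<comment> \<open>if the transformed minimiser differed from \<open>T0\<close>, their midpoint would be
        better by at least \<open>\<delta> / 4\<close> uniformly in \<open>A\<close>\<close>
    define \<delta> where "\<delta> = (D v \<bullet> w)\<^sup>2 / ((C * norm v)\<^sup>2 * (C * norm w)\<^sup>2 + 1)"
    have den: "0 < (C * norm v)\<^sup>2 * (C * norm w)\<^sup>2 + 1" by (simp add: add_nonneg_pos)
    have "0 < \<delta>" using ne den by (simp add: \<delta>_def Da T')
    have DN: "\<delta> \<le> N A D" if A: "A \<in> \<A>" for A
    proof -
      obtain A' where A': "A' \<in> \<A>" "\<And>x. A (A' x) = x" using inv[OF A] by blast
      define p where "p = A' v"
      define q where "q = A' w"
      have lA: "linear A" by (rule lin[OF A])
      have "D v \<bullet> w = D (A p) \<bullet> A q" by (simp add: p_def q_def A')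
      also have "\<dots> = (\<Sum>b\<in>Basis. \<Sum>c\<in>Basis. ((p \<bullet> b) * (q \<bullet> c)) * (D (A b)
          \<bullet> A c))"
      proof -
        have "linear (\<lambda>p. D (A p))"
          by (rule bounded_linear.linear[OF bounded_linear_compose[OF blinfun.bounded_linear_right
                lA[unfolded linear_conv_bounded_linear]]])
        have "D (A p) \<bullet> A q = (\<Sum>b\<in>Basis. (p \<bullet> b) * (D (A b) \<bullet> A q))"
          by (subst linear_basis_expansion[OF \<open>linear (\<lambda>p. D (A p))\<close>, of p]) (simp add: inner_sum_left)
        also have "\<dots> = (\<Sum>b\<in>Basis. \<Sum>c\<in>Basis. ((p \<bullet> b) * (q \<bullet> c)) * (D (A
            b) \<bullet> A c))"
          by (subst linear_basis_expansion[OF lA, of q]) (simp add: inner_sum_right sum_distrib_left mult_ac)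
        finally show ?thesis .
      qed
      also have "\<dots> = (\<Sum>P\<in>I. ((p \<bullet> fst P) * (q \<bullet> snd P)) * (D (A (fst P))
          \<bullet> A (snd P)))"
        by (simp add: I_def sum.cartesian_product case_prod_unfold)
      finally have "(D v \<bullet> w)\<^sup>2
          \<le> (\<Sum>P\<in>I. ((p \<bullet> fst P) * (q \<bullet> snd P))\<^sup>2) * (\<Sum>P\<in>I. (D (A (fst P)) \<bullet> A (snd P))\<^sup>2)"
        using Cauchy_Schwarz_ineq_sum[of "\<lambda>P. (p \<bullet> fst P) * (q \<bullet> snd P)" "\<lambda>P. D
            (A (fst P)) \<bullet> A (snd P)" I] by simp
      also have "(\<Sum>P\<in>I. (D (A (fst P)) \<bullet> A (snd P))\<^sup>2) = N A D"
        by (simp add: N_def case_prod_unfold)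
      also have "(\<Sum>P\<in>I. ((p \<bullet> fst P) * (q \<bullet> snd P))\<^sup>2) = (norm p)\<^sup>2 * (norm q)\<^sup>2"
      proof -
        have "(norm z)\<^sup>2 = (\<Sum>b\<in>Basis. (z \<bullet> b)\<^sup>2)" for z :: 'e
          by (subst power2_norm_eq_inner, subst euclidean_inner) (simp add: power2_eq_square)
        then show ?thesis
          by (simp add: I_def sum_product power_mult_distrib sum.cartesian_product case_prod_unfold)
      qed
      also have "(norm p)\<^sup>2 * (norm q)\<^sup>2 * N A D \<le> ((C * norm v)\<^sup>2 * (C * norm w)\<^sup>2) * N A D"
        using bd[OF A'(1), of v] bd[OF A'(1), of w]
        by (intro mult_right_mono mult_mono power_mono N0) (auto simp: p_def q_def)
      also have "\<dots> \<le> ((C * norm v)\<^sup>2 * (C * norm w)\<^sup>2 + 1) * N A D"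
        using N0 by (intro mult_right_mono) auto
      finally show ?thesis using den by (simp add: \<delta>_def divide_le_eq mult.commute)
    qed
    have "N A S \<le> m - \<delta> / 4" if A: "A \<in> \<A>" for A
    proof -
      have "N A S = (\<Sum>P\<in>I. (T0 (A (fst P)) \<bullet> A (snd P))\<^sup>2 / 2
          + (T' (A (fst P)) \<bullet> A (snd P))\<^sup>2 / 2
          - (D (A (fst P)) \<bullet> A (snd P))\<^sup>2 / 4)"
        unfolding N_def case_prod_unfold
        by (intro sum.cong refl) (simp add: Sa Da power2_eq_square field_simps)
      also have "\<dots> = N A T0 / 2 + N A T' / 2 - N A D / 4"
        by (simp add: N_def case_prod_unfold sum.distrib sum_subtractf sum_divide_distrib)
      finally show ?thesis using T0N[OF A] T'N[OF A] DN[OF A] by argo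
    qed
    then have "m - \<delta> / 4 \<in> R" using SC unfolding R_def by blast
    from m_le[OF this] show False using \<open>0 < \<delta>\<close> by simp
  qed
  define Q where "Q = (\<lambda>x y. T0 x \<bullet> y)"
  have "bilinear Q"
    unfolding bilinear_def Q_def
    by (intro conjI allI linearI) (simp_all add: inner_add_right inner_add_left blinfun.add_right blinfun.scaleR_right)
  moreover have "Q x y = Q y x" for x y using T0C by (simp add: Q_def \<C>_def inner_commute)
  moreover have "0 < Q x x" if "x \<noteq> 0" for x
  proof -
    have "(norm x)\<^sup>2 \<le> Q x x" using T0C one by (auto simp: Q_def \<C>_def)
    moreover have "0 < (norm x)\<^sup>2" using that by simp
    ultimately show ?thesis by linarith
  qed
  ultimately show ?thesis using invar unfolding Q_def by blast
qed

section \<open>Local group laws and their brackets\<close>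

lemma eventually_nhds_prodD:
  assumes "\<forall>\<^sub>F p in nhds (a, b). P p"
  shows "\<forall>\<^sub>F x in nhds a. \<forall>\<^sub>F y in nhds b. P (x, y)"
proof -
  obtain Pf Pg where P: "eventually Pf (nhds a)" "eventually Pg (nhds b)"
    "\<And>x y. Pf x \<Longrightarrow> Pg y \<Longrightarrow> P (x, y)"
    using assms unfolding nhds_prod eventually_prod_filter by blast
  show ?thesis
    using P(1)
  proof (rule eventually_mono)
    fix x assume "Pf x"
    then show "\<forall>\<^sub>F y in nhds b. P (x, y)"
      using P(3) by (intro eventually_mono[OF P(2)]) blast
  qed
qed

lemma eventually_isCont:
  assumes "isCont f a" and "\<forall>\<^sub>F y in nhds (f a). P y"
  shows "\<forall>\<^sub>F x in nhds a. P (f x)"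
proof -
  have "filterlim f (nhds (f a)) (nhds a)"
    using assms(1) unfolding isCont_def tendsto_at_iff_tendsto_nhds .
  then show ?thesis using assms(2) by (auto simp: filterlim_iff)
qed

text \<open>Coordinate versions, for an arbitrary local group law \<open>m\<close> with unit \<open>a\<close>, of the left-invariant
  vector fields and of their commutator at the unit. The generality is used for powers and
  quotients of a Lie group.\<close>

definition left_field :: "('a::euclidean_space \<Rightarrow> 'a \<Rightarrow> 'a) \<Rightarrow> 'a \<Rightarrow>
    'a \<Rightarrow> 'a \<Rightarrow> 'a" where
  "left_field m a v x = frechet_derivative (m x) (at a) v"

definition bracket_of :: "('a::euclidean_space \<Rightarrow> 'a \<Rightarrow> 'a) \<Rightarrow> 'a \<Rightarrow>
    'a \<Rightarrow> 'a \<Rightarrow> 'a" where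
  "bracket_of m a v w =
     frechet_derivative (left_field m a w) (at a) v - frechet_derivative (left_field m a v) (at a) w"

lemma smooth_at_left_field:
  "smooth_at (\<lambda>(x, y). m x y) (b, a) \<Longrightarrow> smooth_at (left_field m a v) b"
  unfolding left_field_def[abs_def] by (rule smooth_at_partial_derivative)

lemma left_field_unit:
  assumes "\<forall>\<^sub>F y in nhds a. m a y = y"
  shows "left_field m a v a = v"
  using frechet_derivative_cong_nhds[OF assms] by (simp add: left_field_def)

lemma frechet_derivative_linear_combination:
  assumes "smooth_at f x" and "smooth_at g x"
  shows "frechet_derivative (\<lambda>y. r *\<^sub>R f y + s *\<^sub>R g y) (at x) v
     = r *\<^sub>R frechet_derivative f (at x) v + s *\<^sub>R frechet_derivative g (at x) v"
proof -
  have "((\<lambda>y. r *\<^sub>R f y + s *\<^sub>R g y) has_derivative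
      (\<lambda>v. r *\<^sub>R frechet_derivative f (at x) v + s *\<^sub>R frechet_derivative g (at x) v)) (at x)"
    by (intro has_derivative_add has_derivative_scaleR_right smooth_at_has_derivative assms)
  from frechet_derivative_at[OF this] show ?thesis by metis
qed

lemma bilinear_if_linear_combinations:
  assumes "\<And>x y z r s. f (r *\<^sub>R x + s *\<^sub>R y) z = r *\<^sub>R f x z + s *\<^sub>R f y z"
    and "\<And>x y z r s. f z (r *\<^sub>R x + s *\<^sub>R y) = r *\<^sub>R f z x + s *\<^sub>R f z y"
  shows "bilinear f"
  unfolding bilinear_def
proof (intro conjI allI linearI)
  show "f x (y + z) = f x y + f x z" for x y z using assms(2)[of x 1 y 1 z] by simp
  show "f (y + z) x = f y x + f z x" for x y z using assms(1)[of 1 y 1 z x] by simp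
  show "f x (r *\<^sub>R y) = r *\<^sub>R f x y" for x y r using assms(2)[of x r y 0 y] by simp
  show "f (r *\<^sub>R y) x = r *\<^sub>R f y x" for x y r using assms(1)[of r y 0 y x] by simp
qed

lemma bilinear_bracket_of:
  assumes m: "smooth_at (\<lambda>(x, y). m x y) (a, a)"
  shows "bilinear (bracket_of m a)"
proof -
  note sm = smooth_at_left_field[OF m]
  define B where "B = (\<lambda>v w. frechet_derivative (left_field m a w) (at a) v)"
  have l: "B (r *\<^sub>R x + s *\<^sub>R y) z = r *\<^sub>R B x z + s *\<^sub>R B y z" for x y z r s
    unfolding B_def using smooth_at_linear_frechet[OF sm] by (simp add: linear_add linear_cmul)
  have "\<forall>\<^sub>F p in nhds a. smooth_at (m p) a"
    using eventually_nhds_slice[OF smooth_at_eventually[OF m]] by (rule eventually_mono) (rule smooth_at_slice)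
  then have ev: "\<forall>\<^sub>F p in nhds a. left_field m a (r *\<^sub>R x + s *\<^sub>R y) p
      = r *\<^sub>R left_field m a x p + s *\<^sub>R left_field m a y p" for x y r s
  proof (rule eventually_mono)
    fix p assume "smooth_at (m p) a"
    from smooth_at_linear_frechet[OF this]
    show "left_field m a (r *\<^sub>R x + s *\<^sub>R y) p = r *\<^sub>R left_field m a x p + s *\<^sub>R left_field m a y p"
      by (simp add: left_field_def linear_add linear_cmul)
  qed
  have r: "B z (r *\<^sub>R x + s *\<^sub>R y) = r *\<^sub>R B z x + s *\<^sub>R B z y" for x y z r s
    unfolding B_def frechet_derivative_cong_nhds[OF ev]
    by (rule frechet_derivative_linear_combination[OF sm sm])
  have eq: "bracket_of m a = (\<lambda>v w. B v w - B w v)"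
    by (simp add: bracket_of_def B_def fun_eq_iff)
  show ?thesis
    unfolding eq by (rule bilinear_if_linear_combinations) (simp_all add: l r algebra_simps)
qed

text \<open>Differentiating \<open>\<Phi> (m x y) = m' (\<Phi> x) (\<Phi> y)\<close> in \<open>y\<close> shows that \<open>\<Phi>\<close> relates the left-invariant fields.
  Differentiating once more in \<open>x\<close> produces the second derivative of \<open>\<Phi>\<close> as an error term, and this is
  symmetric, so it cancels in the commutator.\<close>

lemma bracket_of_local_hom:
  fixes m :: "'a::euclidean_space \<Rightarrow> 'a \<Rightarrow> 'a" and quot_mult :: "'b::euclidean_space
      \<Rightarrow> 'b \<Rightarrow> 'b"
  assumes m: "smooth_at (\<lambda>(x, y). m x y) (a, a)"
    and ra: "\<forall>\<^sub>F x in nhds a. m x a = x" and la: "\<forall>\<^sub>F y in nhds a. m a y = y"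
    and quot_mult: "smooth_at (\<lambda>(x, y). quot_mult x y) (\<Phi> a, \<Phi> a)"
    and \<Phi>: "smooth_at \<Phi> a"
    and hom: "\<forall>\<^sub>F p in nhds (a, a). \<Phi> (m (fst p) (snd p)) = quot_mult (\<Phi> (fst p)) (\<Phi> (snd p))"
  shows "bracket_of quot_mult (\<Phi> a) (frechet_derivative \<Phi> (at a) v) (frechet_derivative \<Phi> (at a) w)
       = frechet_derivative \<Phi> (at a) (bracket_of m a v w)"
proof -
  define D where "D = (\<lambda>x. frechet_derivative \<Phi> (at x))"
  have smx: "\<forall>\<^sub>F x in nhds a. smooth_at (m x) a"
    using eventually_nhds_slice[OF smooth_at_eventually[OF m]] by (rule eventually_mono) (rule smooth_at_slice)
  have "\<forall>\<^sub>F y in nhds (\<Phi> a). smooth_at (quot_mult y) (\<Phi> a)"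
    using eventually_nhds_slice[OF smooth_at_eventually[OF quot_mult]] by (rule eventually_mono) (rule smooth_at_slice)
  from eventually_isCont[OF smooth_at_isCont[OF \<Phi>] this]
  have smx': "\<forall>\<^sub>F x in nhds a. smooth_at (quot_mult (\<Phi> x)) (\<Phi> a)" .
  have step: "\<forall>\<^sub>F x in nhds a. D x (left_field m a v x)
      = left_field quot_mult (\<Phi> a) (D a v) (\<Phi> x)" for v
    using eventually_nhds_prodD[OF hom] smx smx' ra smooth_at_eventually[OF \<Phi>]
  proof eventually_elim
    case (elim x)
    have 1: "smooth_at \<Phi> (m x a)" using elim by simp
    have "((\<lambda>y. \<Phi> (m x y)) has_derivative (\<lambda>v. D (m x a) (frechet_derivative (m x) (at a) v))) (at a)"
      unfolding D_def by (rule has_derivative_compose[OF smooth_at_has_derivative smooth_at_has_derivative]) (fact elim 1)+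
    moreover have "((\<lambda>y. quot_mult (\<Phi> x) (\<Phi> y)) has_derivative
        (\<lambda>v. frechet_derivative (quot_mult (\<Phi> x)) (at (\<Phi> a)) (D a v))) (at a)"
      unfolding D_def by (rule has_derivative_compose[OF smooth_at_has_derivative smooth_at_has_derivative]) (fact elim \<Phi>)+
    moreover have "\<forall>\<^sub>F y in nhds a. \<Phi> (m x y) = quot_mult (\<Phi> x) (\<Phi> y)" using elim(1) by simp
    ultimately have "(\<lambda>v. D (m x a) (frechet_derivative (m x) (at a) v)) =
        (\<lambda>v. frechet_derivative (quot_mult (\<Phi> x)) (at (\<Phi> a)) (D a v))"
      using has_derivative_cong_nhds has_derivative_unique by metis
    then show ?case using elim by (simp add: left_field_def fun_eq_iff)
  qed
  define B where "B = (\<lambda>v w. frechet_derivative (left_field m a w) (at a) v)"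
  define B' where "B' = (\<lambda>v w. frechet_derivative (left_field quot_mult (\<Phi> a) w) (at (\<Phi> a)) v)"
  have key: "B' (D a w) (D a v) = frechet_derivative (\<lambda>x. D x v) (at a) w + D a (B w v)" for v w
  proof -
    have "((\<lambda>x. D x (left_field m a v x)) has_derivative
        (\<lambda>w. frechet_derivative (\<lambda>x. D x v) (at a) w + D a (B w v))) (at a)"
      using has_derivative_frechet_apply[OF \<Phi> smooth_at_has_derivative[OF smooth_at_left_field[OF m]], of v]
      unfolding D_def B_def left_field_unit[where m = m, OF la] .
    moreover have "((\<lambda>x. left_field quot_mult (\<Phi> a) (D a v) (\<Phi> x)) has_derivative
        (\<lambda>w. B' (D a w) (D a v))) (at a)"
      unfolding D_def B'_def
      by (rule has_derivative_compose[OF smooth_at_has_derivative[OF \<Phi>]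
          smooth_at_has_derivative[OF smooth_at_left_field[OF quot_mult]]])
    ultimately have "(\<lambda>w. frechet_derivative (\<lambda>x. D x v) (at a) w + D a (B w v))
        = (\<lambda>w. B' (D a w) (D a v))"
      using has_derivative_cong_nhds[OF step] has_derivative_unique by metis
    then show ?thesis by (simp add: fun_eq_iff)
  qed
  have "B' (D a v) (D a w) - B' (D a w) (D a v) = D a (B v w) - D a (B w v)"
    unfolding key using frechet_derivative_symmetric[OF \<Phi>, of v w] by (simp add: D_def)
  also have "\<dots> = D a (B v w - B w v)"
    using linear_diff[OF smooth_at_linear_frechet[OF \<Phi>]] by (simp add: D_def)
  finally show ?thesis by (simp add: bracket_of_def B_def B'_def D_def)
qed

text \<open>Here \<open>c x y\<close> is conjugation of \<open>y\<close> by \<open>x\<close>, characterised by \<open>m (c x y) x = m x y\<close>. Differentiating this relation in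
  \<open>y\<close> and then in \<open>x\<close> expresses the derivative of the adjoint action as the difference of the two mixed
  derivatives of \<open>m\<close>, without inverting a matrix of derivatives.\<close>

lemma conjugation_derivative:
  fixes m c :: "'a::euclidean_space \<Rightarrow> 'a \<Rightarrow> 'a"
  assumes m: "smooth_at (\<lambda>(x, y). m x y) (a, a)"
    and ra: "\<forall>\<^sub>F x in nhds a. m x a = x" and la: "\<forall>\<^sub>F y in nhds a. m a y = y"
    and c: "smooth_at (\<lambda>(x, y). c x y) (a, a)"
    and ca: "\<forall>\<^sub>F x in nhds a. c x a = a" and cl: "\<forall>\<^sub>F y in nhds a. c a y = y"
    and conj: "\<forall>\<^sub>F p in nhds (a, a). m (c (fst p) (snd p)) (fst p) = m (fst p) (snd p)"
  shows "((\<lambda>x. frechet_derivative (c x) (at a) v) has_derivative (\<lambda>w. bracket_of m a w v)) (at a)"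
proof -
  define M where "M = (\<lambda>(x, y). m x y)"
  define A where "A = left_field c a v"
  define B where "B = (\<lambda>v w. frechet_derivative (left_field m a w) (at a) v)"
  have M: "smooth_at M (a, a)" using m by (simp add: M_def)
  have A: "smooth_at A a" unfolding A_def by (rule smooth_at_left_field[OF c])
  have Aa: "A a = v" unfolding A_def by (rule left_field_unit[where m = c, OF cl])
  have D0: "frechet_derivative M (at (x, a)) (0, w) = left_field m a w x" if "smooth_at M (x, a)" for x w
    using smooth_at_slice(2)[of m x a w] that by (simp add: M_def left_field_def)
  have R: "((\<lambda>z. m z x) has_derivative (\<lambda>u. frechet_derivative M (at (z, x)) (u, 0))) (at z)"
    if "smooth_at M (z, x)" for z x
  proof -
    have "((\<lambda>z. (z, x)) has_derivative (\<lambda>u. (u, 0))) (at z)"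
      by (auto intro!: derivative_eq_intros)
    from has_derivative_compose[OF this smooth_at_has_derivative[OF that]]
    show ?thesis by (simp add: M_def)
  qed
  have "\<forall>\<^sub>F x in nhds a. smooth_at M (a, x)"
  proof -
    have "isCont (\<lambda>x. (a, x)) a" by (intro continuous_intros)
    from eventually_isCont[OF this smooth_at_eventually[OF M]] show ?thesis .
  qed
  moreover have "\<forall>\<^sub>F x in nhds a. smooth_at (c x) a"
    using eventually_nhds_slice[OF smooth_at_eventually[OF c]] by (rule eventually_mono) (rule smooth_at_slice)
  moreover have "\<forall>\<^sub>F x in nhds a. smooth_at (m x) a"
    using eventually_nhds_slice[OF smooth_at_eventually[OF m]] by (rule eventually_mono) (rule smooth_at_slice)
  ultimately have step: "\<forall>\<^sub>F x in nhds a. frechet_derivative M (at (a, x)) (A x, 0) = left_field m a v x"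
    using eventually_nhds_prodD[OF conj] ca
  proof eventually_elim
    case (elim x)
    have 1: "((\<lambda>z. m z x) has_derivative (\<lambda>u. frechet_derivative M (at (c x a, x)) (u, 0))) (at (c x a))"
      using R[OF elim(1)] elim(5) by simp
    have "((\<lambda>y. m (c x y) x) has_derivative
        (\<lambda>v. frechet_derivative M (at (c x a, x)) (frechet_derivative (c x) (at a) v, 0))) (at a)"
      by (rule has_derivative_compose[OF smooth_at_has_derivative[OF elim(2)] 1])
    moreover have "(m x has_derivative frechet_derivative (m x) (at a)) (at a)"
      by (rule smooth_at_has_derivative[OF elim(3)])
    moreover have "\<forall>\<^sub>F y in nhds a. m (c x y) x = m x y" using elim(4) by simp
    ultimately have "(\<lambda>v. frechet_derivative M (at (c x a, x)) (frechet_derivative (c x) (at a) v, 0))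
        = frechet_derivative (m x) (at a)"
      using has_derivative_cong_nhds[of "\<lambda>y. m (c x y) x" "m x" a] has_derivative_unique by blast
    then show ?case using elim(5) by (simp add: left_field_def A_def fun_eq_iff)
  qed
  have "(snd has_derivative snd) (at (a, a))" by (auto intro!: derivative_eq_intros)
  moreover have "(A has_derivative frechet_derivative A (at a)) (at (snd (a, a)))"
    using smooth_at_has_derivative[OF A] by simp
  ultimately have "((\<lambda>P. A (snd P)) has_derivative (\<lambda>P. frechet_derivative A (at a) (snd P))) (at (a, a))"
    by (rule has_derivative_compose)
  then have "((\<lambda>P. (A (snd P), 0 :: 'a))
      has_derivative (\<lambda>P. (frechet_derivative A (at a) (snd P), 0))) (at (a, a))"
    by (rule has_derivative_Pair) (rule has_derivative_const)
  from has_derivative_frechet_apply[OF M this]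
  have 2: "((\<lambda>P. frechet_derivative M (at P) (A (snd P), 0)) has_derivative
      (\<lambda>W. frechet_derivative (\<lambda>P. frechet_derivative M (at P) (v, 0)) (at (a, a)) W
        + frechet_derivative M (at (a, a)) (frechet_derivative A (at a) (snd W), 0))) (at (a, a))"
    by (simp add: Aa)
  have pa: "((\<lambda>x. (a, x)) has_derivative (\<lambda>w. (0, w))) (at a)"
    by (auto intro!: derivative_eq_intros)
  have 3: "frechet_derivative M (at (a, a)) (u, 0) = u" for u
  proof -
    have "((\<lambda>x. x) has_derivative (\<lambda>u. frechet_derivative M (at (a, a)) (u, 0))) (at a)"
      using R[OF M] has_derivative_cong_nhds[OF ra] by blast
    then show ?thesis
      using has_derivative_unique[OF _ has_derivative_ident] by metis
  qed
  have 4: "frechet_derivative (\<lambda>P. frechet_derivative M (at P) (v, 0)) (at (a, a)) (0, w) = B v w" for w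
  proof -
    have "frechet_derivative (\<lambda>P. frechet_derivative M (at P) (v, 0)) (at (a, a)) (0, w)
        = frechet_derivative (\<lambda>P. frechet_derivative M (at P) (0, w)) (at (a, a)) (v, 0)"
      by (rule frechet_derivative_symmetric[OF M])
    also have "\<dots> = B v w"
    proof -
      have "((\<lambda>x. (x, a)) has_derivative (\<lambda>u. (u, 0))) (at a)"
        by (auto intro!: derivative_eq_intros)
      from has_derivative_compose[OF this smooth_at_has_derivative[OF smooth_at_directional[OF M, of "(0, w)"]]]
      have "((\<lambda>x. frechet_derivative M (at (x, a)) (0, w)) has_derivative
          (\<lambda>u. frechet_derivative (\<lambda>P. frechet_derivative M (at P) (0, w)) (at (a, a)) (u, 0))) (at a)" .
      moreover have "\<forall>\<^sub>F x in nhds a. frechet_derivative M (at (x, a)) (0, w) = left_field m a w x"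
        using eventually_nhds_slice[OF smooth_at_eventually[OF M]] by (rule eventually_mono) (rule D0)
      ultimately have "(left_field m a w has_derivative
          (\<lambda>u. frechet_derivative (\<lambda>P. frechet_derivative M (at P) (0, w)) (at (a, a)) (u, 0))) (at a)"
        by (subst (asm) has_derivative_cong_nhds)
      from frechet_derivative_at[OF this] show ?thesis by (simp add: B_def fun_eq_iff)
    qed
    finally show ?thesis .
  qed
  have "((\<lambda>x. frechet_derivative M (at (a, x)) (A x, 0)) has_derivative
      (\<lambda>w. B v w + frechet_derivative A (at a) w)) (at a)"
    using has_derivative_compose[OF pa 2] by (simp add: 3 4)
  moreover have "(left_field m a v has_derivative (\<lambda>w. B w v)) (at a)"
    unfolding B_def by (rule smooth_at_has_derivative[OF smooth_at_left_field[OF m]])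
  ultimately have "(\<lambda>w. B v w + frechet_derivative A (at a) w) = (\<lambda>w. B w v)"
    using has_derivative_cong_nhds[OF step] has_derivative_unique by blast
  then have "frechet_derivative A (at a) = (\<lambda>w. bracket_of m a w v)"
    by (simp add: fun_eq_iff bracket_of_def B_def algebra_simps)
  then show ?thesis
    using smooth_at_has_derivative[OF A] by (simp add: A_def left_field_def[abs_def])
qed

section \<open>Charts of a Lie group\<close>

locale lie_grp =
  fixes G :: "('g, 'e::euclidean_space) lie_data" (structure)
  assumes lie: "lie_group G"

sublocale lie_grp \<subseteq> group G
  using lie by (simp add: lie_group_def)

context lie_grp
begin

abbreviation X where "X \<equiv> space_of G"

lemma topspace_X: "topspace X = carrier G"
  using lie by (simp add: lie_group_def)

lemma continuous_mult: "continuous_map (prod_topology X X) X (\<lambda>(x, y). x \<otimes> y)"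
  using lie by (simp add: lie_group_def smooth_map_def)

lemma continuous_inv: "continuous_map X X (\<lambda>x. inv x)"
  using lie by (simp add: lie_group_def smooth_map_def)

lemma continuous_left: "g \<in> carrier G \<Longrightarrow> continuous_map X X (\<lambda>x. g \<otimes> x)"
  using continuous_map_compose[OF continuous_map_paired[THEN iffD2] continuous_mult, of X "\<lambda>_. g" "\<lambda>x. x"]
  by (simp add: topspace_X o_def)

lemma continuous_right: "g \<in> carrier G \<Longrightarrow> continuous_map X X (\<lambda>x. x \<otimes> g)"
  using continuous_map_compose[OF continuous_map_paired[THEN iffD2] continuous_mult, of X "\<lambda>x. x" "\<lambda>_. g"]
  by (simp add: topspace_X o_def)

lemma chart_exists: "p \<in> carrier G \<Longrightarrow> \<exists>U \<phi>. (U, \<phi>) \<in> atlas_of G \<and> p \<in> U"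
proof -
  assume p: "p \<in> carrier G"
  have "(\<Union>(U, \<phi>)\<in>atlas_of G. U) = carrier G"
    using lie by (simp add: lie_group_def smooth_manifold_def)
  then show ?thesis using p by blast
qed

lemma chartD:
  assumes "(U, \<phi>) \<in> atlas_of G"
  shows "openin X U" "open (\<phi> ` U)" "homeomorphic_map (subtopology X U) (top_of_set (\<phi> ` U)) \<phi>"
    "U \<subseteq> carrier G" "inj_on \<phi> U"
proof -
  show 1: "openin X U" and "open (\<phi> ` U)"
    and h: "homeomorphic_map (subtopology X U) (top_of_set (\<phi> ` U)) \<phi>"
    using lie assms by (auto simp: lie_group_def smooth_manifold_def)
  show u: "U \<subseteq> carrier G" using openin_subset[OF 1] topspace_X by simp
  show "inj_on \<phi> U"
    using h u by (simp add: homeomorphic_map_def topspace_X Int_absorb1 homeomorphic_imp_injective_map)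
qed

lemma chart_image_open:
  assumes c: "(U, \<phi>) \<in> atlas_of G" and W: "openin X W"
  shows "open (\<phi> ` (U \<inter> W))"
proof -
  have "openin (subtopology X U) (U \<inter> W)"
    using W by (simp add: openin_subtopology_Int2)
  then have "openin (top_of_set (\<phi> ` U)) (\<phi> ` (U \<inter> W))"
    using homeomorphic_imp_open_map[OF chartD(3)[OF c]] by (simp add: open_map_def)
  then show ?thesis using chartD(2)[OF c] openin_open_trans by blast
qed

text \<open>The working form of the homeomorphism property: near the image of \<open>p\<close> the parametrisation is defined,
  inverts the chart, and stays in any given neighbourhood of \<open>p\<close>.\<close>

lemma eventually_chart:
  assumes c: "(U, \<phi>) \<in> atlas_of G" and W: "openin X W" and p: "p \<in> U" "p \<in> W"
  shows "\<forall>\<^sub>F x in nhds (\<phi> p). x \<in> \<phi> ` U \<and> inv_into U \<phi> x \<in> U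
      \<and> inv_into U \<phi> x \<in> W \<and> \<phi> (inv_into U \<phi> x) = x"
proof -
  have "\<forall>\<^sub>F x in nhds (\<phi> p). x \<in> \<phi> ` (U \<inter> W)"
    using chart_image_open[OF c W] p by (intro eventually_nhds_in_open) auto
  then show ?thesis
  proof (rule eventually_mono)
    fix x assume "x \<in> \<phi> ` (U \<inter> W)"
    then obtain u where "u \<in> U" "u \<in> W" "x = \<phi> u" by blast
    then show "x \<in> \<phi> ` U \<and> inv_into U \<phi> x \<in> U \<and> inv_into U \<phi> x \<in> W
        \<and> \<phi> (inv_into U \<phi> x) = x"
      using inv_into_f_f[OF chartD(5)[OF c]] by auto
  qed
qed

lemma eventually_chart_pair:
  assumes c1: "(U1, \<phi>1) \<in> atlas_of G" and c2: "(U2, \<phi>2) \<in> atlas_of G"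
    and W: "openin (prod_topology X X) W" and comp_par: "p \<in> U1" "q \<in> U2" "(p, q) \<in> W"
  shows "\<forall>\<^sub>F P in nhds (\<phi>1 p, \<phi>2 q). fst P \<in> \<phi>1 ` U1 \<and> snd P \<in> \<phi>2 ` U2 \<and>
     (inv_into U1 \<phi>1 (fst P), inv_into U2 \<phi>2 (snd P)) \<in> W"
proof -
  obtain A B where AB: "openin X A" "openin X B" "p \<in> A" "q \<in> B" "A \<times> B \<subseteq> W"
    using W[unfolded openin_prod_topology_alt, rule_format, OF comp_par(3)] by (elim exE conjE)
  have "\<forall>\<^sub>F P in nhds (\<phi>1 p) \<times>\<^sub>F nhds (\<phi>2 q). fst P \<in> \<phi>1 ` U1
      \<and> inv_into U1 \<phi>1 (fst P) \<in> A \<and>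
     snd P \<in> \<phi>2 ` U2 \<and> inv_into U2 \<phi>2 (snd P) \<in> B"
    by (rule eventually_mono[OF eventually_prodI[OF eventually_chart[OF c1 AB(1) comp_par(1) AB(3)]
        eventually_chart[OF c2 AB(2) comp_par(2) AB(4)]]]) blast
  then show ?thesis
    unfolding nhds_prod by (rule eventually_mono) (intro conjI subsetD[OF AB(5)] SigmaI; simp)
qed

lemma eventually_mult:
  assumes c1: "(U1, \<phi>1) \<in> atlas_of G" and c2: "(U2, \<phi>2) \<in> atlas_of G"
    and W: "openin X W" and comp_par: "p \<in> U1" "q \<in> U2" "p \<otimes> q \<in> W"
  shows "\<forall>\<^sub>F P in nhds (\<phi>1 p, \<phi>2 q). fst P \<in> \<phi>1 ` U1 \<and> snd P \<in> \<phi>2 ` U2 \<and>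
     inv_into U1 \<phi>1 (fst P) \<otimes> inv_into U2 \<phi>2 (snd P) \<in> W"
proof -
  have 1: "openin (prod_topology X X) {P
      \<in> topspace (prod_topology X X). (case P of (x, y) \<Rightarrow> x \<otimes> y) \<in> W}"
    by (rule openin_continuous_map_preimage[OF continuous_mult W])
  have 2: "(p, q) \<in> {P \<in> topspace (prod_topology X X). (case P of (x, y) \<Rightarrow> x \<otimes> y) \<in> W}"
    using comp_par chartD(4)[OF c1] chartD(4)[OF c2] by (auto simp: topspace_X)
  show ?thesis
    using eventually_chart_pair[OF c1 c2 1 comp_par(1,2) 2] by (rule eventually_mono) auto
qed

text \<open>The definition speaks of the parametrisation of the product chart on the set where the product
  falls into the domain of the target chart; this set is open by continuity of the multiplication.\<close>

lemma mult_smooth_at: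
  assumes c1: "(U1, \<phi>1) \<in> atlas_of G" and c2: "(U2, \<phi>2) \<in> atlas_of G" and c3: "(V, \<psi>)
      \<in> atlas_of G"
    and comp_par: "p \<in> U1" "q \<in> U2" "p \<otimes> q \<in> V"
  shows "smooth_at (\<lambda>(x, y). \<psi> (inv_into U1 \<phi>1 x \<otimes> inv_into U2 \<phi>2 y)) (\<phi>1 p, \<phi>2 q)"
proof -
  define S where "S = map_prod \<phi>1 \<phi>2 ` (U1 \<times> U2 \<inter> (\<lambda>(x, y). x \<otimes> y) -` V)"
  have inv_eq: "inv_into (U1 \<times> U2) (map_prod \<phi>1 \<phi>2) (x, y) = (inv_into U1 \<phi>1 x, inv_into U2 \<phi>2 y)"
    if "x \<in> \<phi>1 ` U1" "y \<in> \<phi>2 ` U2" for x y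
  proof -
    have "inj_on (map_prod \<phi>1 \<phi>2) (U1 \<times> U2)"
      using chartD(5)[OF c1] chartD(5)[OF c2] by (rule map_prod_inj_on)
    from inv_into_f_f[OF this, of "(inv_into U1 \<phi>1 x, inv_into U2 \<phi>2 y)"]
    show ?thesis using that by (simp add: f_inv_into_f inv_into_into)
  qed
  have "(U1 \<times> U2, map_prod \<phi>1 \<phi>2) \<in> prod_atlas (atlas_of G) (atlas_of G)"
    using c1 c2 by (auto simp: prod_atlas_def)
  moreover have "smooth_map (prod_topology X X) (prod_atlas (atlas_of G) (atlas_of G)) X (atlas_of G)
      (\<lambda>(x, y). x \<otimes> y)"
    using lie by (simp add: lie_group_def)
  ultimately have "smooth_on S (\<psi> \<circ> (\<lambda>(x, y). x \<otimes> y) \<circ> inv_into (U1 \<times>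
      U2) (map_prod \<phi>1 \<phi>2))"
    using c3 unfolding smooth_map_def S_def by fast
  moreover have "open S"
  proof (subst open_subopen, intro ballI)
    fix z assume "z \<in> S"
    then obtain u v where z: "z = (\<phi>1 u, \<phi>2 v)" "u \<in> U1" "v \<in> U2" "u \<otimes> v \<in> V"
      by (auto simp: S_def)
    have "\<forall>\<^sub>F P in nhds z. P \<in> S"
      using eventually_mult[OF c1 c2 chartD(1)[OF c3] z(2-4)] unfolding z(1)
    proof (rule eventually_mono)
      fix P assume P: "fst P \<in> \<phi>1 ` U1 \<and> snd P \<in> \<phi>2 ` U2
          \<and> inv_into U1 \<phi>1 (fst P) \<otimes> inv_into U2 \<phi>2 (snd P) \<in> V"
      then have "P = map_prod \<phi>1 \<phi>2 (inv_into U1 \<phi>1 (fst P), inv_into U2 \<phi>2 (snd P))"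
        by (simp add: f_inv_into_f)
      moreover have "(inv_into U1 \<phi>1 (fst P), inv_into U2 \<phi>2 (snd P))
          \<in> U1 \<times> U2 \<inter> (\<lambda>(x, y). x \<otimes> y) -` V"
        using P by (simp add: inv_into_into)
      ultimately show "P \<in> S" unfolding S_def by (rule image_eqI)
    qed
    then show "\<exists>T. open T \<and> z \<in> T \<and> T \<subseteq> S" unfolding eventually_nhds by blast
  qed
  moreover have "(\<phi>1 p, \<phi>2 q) \<in> S" using comp_par by (force simp: S_def)
  ultimately have "smooth_at (\<psi> \<circ> (\<lambda>(x, y). x \<otimes> y) \<circ> inv_into (U1 \<times> U2)
      (map_prod \<phi>1 \<phi>2)) (\<phi>1 p, \<phi>2 q)"
    by (intro smooth_atI)
  then show ?thesis
  proof (rule smooth_at_cong)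
    show "\<forall>\<^sub>F P in nhds (\<phi>1 p, \<phi>2 q). (\<psi> \<circ> (\<lambda>(x, y). x \<otimes> y)
        \<circ> inv_into (U1 \<times> U2) (map_prod \<phi>1 \<phi>2)) P
        = (case P of (x, y) \<Rightarrow> \<psi> (inv_into U1 \<phi>1 x \<otimes> inv_into U2 \<phi>2 y))"
      using eventually_mult[OF c1 c2 chartD(1)[OF c3] comp_par]
      by (rule eventually_mono) (auto simp: inv_eq)
  qed
qed

lemma inv_smooth_at:
  assumes c1: "(U, \<phi>) \<in> atlas_of G" and c3: "(V, \<psi>) \<in> atlas_of G"
    and p: "p \<in> U" "inv p \<in> V"
  shows "smooth_at (\<lambda>x. \<psi> (inv (inv_into U \<phi> x))) (\<phi> p)"
proof (rule smooth_atI)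
  define W where "W = {x \<in> topspace X. inv x \<in> V}"
  have "openin X W"
    unfolding W_def by (rule openin_continuous_map_preimage[OF continuous_inv chartD(1)[OF c3]])
  then have "open (\<phi> ` (U \<inter> W))" by (rule chart_image_open[OF c1])
  moreover have "U \<inter> W = U \<inter> (\<lambda>x. inv x) -` V"
    using chartD(4)[OF c1] by (auto simp: W_def topspace_X)
  ultimately show "open (\<phi> ` (U \<inter> (\<lambda>x. inv x) -` V))" by simp
  have "smooth_on (\<phi> ` (U \<inter> (\<lambda>x. inv x) -` V)) (\<psi> \<circ> (\<lambda>x. inv x) \<circ>
      inv_into U \<phi>)"
    using lie c1 c3 unfolding lie_group_def smooth_map_def by fast
  then show "smooth_on (\<phi> ` (U \<inter> (\<lambda>x. inv x) -` V)) (\<lambda>x. \<psi> (inv (inv_into U \<phi> x)))"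
    by (simp add: o_def)
  show "\<phi> p \<in> \<phi> ` (U \<inter> (\<lambda>x. inv x) -` V)" using p by auto
qed

lemma left_mult_smooth_at:
  assumes c2: "(U, \<phi>) \<in> atlas_of G" and c3: "(V, \<psi>) \<in> atlas_of G"
    and g: "g \<in> carrier G" and q: "q \<in> U" "g \<otimes> q \<in> V"
  shows "smooth_at (\<lambda>y. \<psi> (g \<otimes> inv_into U \<phi> y)) (\<phi> q)"
proof -
  obtain U1 \<phi>1 where c1: "(U1, \<phi>1) \<in> atlas_of G" "g \<in> U1" using chart_exists[OF g] by blast
  from smooth_at_slice(1)[OF mult_smooth_at[OF c1(1) c2 c3 c1(2) q]]
  show ?thesis using inv_into_f_f[OF chartD(5)[OF c1(1)] c1(2)] by simp
qed

lemma right_mult_smooth_at: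
  assumes c2: "(U, \<phi>) \<in> atlas_of G" and c3: "(V, \<psi>) \<in> atlas_of G"
    and g: "g \<in> carrier G" and q: "q \<in> U" "q \<otimes> g \<in> V"
  shows "smooth_at (\<lambda>y. \<psi> (inv_into U \<phi> y \<otimes> g)) (\<phi> q)"
proof -
  obtain U1 \<phi>1 where c1: "(U1, \<phi>1) \<in> atlas_of G" "g \<in> U1" using chart_exists[OF g] by blast
  have p: "smooth_at (\<lambda>y. (y, \<phi>1 g)) (\<phi> q)" by (intro smooth_at_Pair smooth_at_const smooth_at_ident)
  from smooth_at_compose[OF p mult_smooth_at[OF c2 c1(1) c3 q(1) c1(2) q(2)]]
  show ?thesis using inv_into_f_f[OF chartD(5)[OF c1(1)] c1(2)] by simp
qed

definition "unit_dom = fst (unit_chart G)"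

lemma unit_chart: "(unit_dom, crd G) \<in> atlas_of G" "\<one> \<in> unit_dom"
proof -
  have "\<exists>c. c \<in> atlas_of G \<and> \<one> \<in> fst c" using chart_exists[OF one_closed] by force
  then have "unit_chart G \<in> atlas_of G \<and> \<one> \<in> fst (unit_chart G)"
    unfolding unit_chart_def by (rule someI_ex)
  then show "(unit_dom, crd G) \<in> atlas_of G" "\<one> \<in> unit_dom" by (simp_all add: unit_dom_def crd_def)
qed

lemma par_eq: "par G = inv_into unit_dom (crd G)"
  by (simp add: par_def unit_dom_def)

lemma par_crd: "g \<in> unit_dom \<Longrightarrow> par G (crd G g) = g"
  unfolding par_eq by (rule inv_into_f_f[OF chartD(5)[OF unit_chart(1)]])

lemma par_unit: "par G (unit_crd G) = \<one>"
  by (rule par_crd[OF unit_chart(2)])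

lemma eventually_par:
  assumes "openin X W" "\<one> \<in> W"
  shows "\<forall>\<^sub>F x in nhds (unit_crd G). par G x \<in> unit_dom \<and> par G x \<in> W
      \<and> par G x \<in> carrier G \<and> crd G (par G x) = x"
  using eventually_chart[OF unit_chart(1) assms(1) unit_chart(2) assms(2)]
  unfolding par_eq[symmetric] by (rule eventually_mono) (use chartD(4)[OF unit_chart(1)] in blast)

lemma eventually_par_carrier:
  "\<forall>\<^sub>F x in nhds (unit_crd G). par G x \<in> unit_dom \<and> par G x \<in> carrier G
      \<and> crd G (par G x) = x"
  using eventually_par[OF chartD(1)[OF unit_chart(1)] unit_chart(2)] by (rule eventually_mono) blast

lemma eventually_par_par:
  assumes "openin X W" "\<one> \<in> W"
  shows "\<forall>\<^sub>F P in nhds (unit_crd G, unit_crd G). par G (fst P) \<in> W \<and> par G (snd P) \<in> W \<and>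
    par G (fst P) \<in> carrier G \<and> par G (snd P) \<in> carrier G \<and> par G (fst P) \<otimes> par G (snd P) \<in> W"
proof -
  have 1: "openin (prod_topology X X) (W \<times> W)" using assms(1) by (simp add: openin_prod_Times_iff)
  have 2: "(\<one>, \<one>) \<in> W \<times> W" "\<one> \<otimes> \<one> \<in> W" using assms(2) by simp_all
  have 3: "W \<subseteq> carrier G" using openin_subset[OF assms(1)] topspace_X by simp
  show ?thesis
    using eventually_chart_pair[OF unit_chart(1) unit_chart(1) 1 unit_chart(2) unit_chart(2) 2(1)]
      eventually_mult[OF unit_chart(1) unit_chart(1) assms(1) unit_chart(2) unit_chart(2) 2(2)]
    unfolding par_eq[symmetric]
    by eventually_elim (use 3 in \<open>simp add: subset_iff\<close>)
qed

text \<open>The group law read in the unit chart; it is meaningful near the point \<open>(unit_crd G, unit_crd G)\<close>.\<close>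

definition crd_mult :: "'e \<Rightarrow> 'e \<Rightarrow> 'e" where
  "crd_mult x y = crd G (par G x \<otimes> par G y)"

lemma crd_mult_smooth: "smooth_at (\<lambda>(x, y). crd_mult x y) (unit_crd G, unit_crd G)"
  unfolding crd_mult_def[abs_def] par_eq
  by (rule mult_smooth_at[OF unit_chart(1) unit_chart(1) unit_chart(1) unit_chart(2) unit_chart(2)])
    (simp add: unit_chart(2))

lemma crd_mult_right_unit: "\<forall>\<^sub>F x in nhds (unit_crd G). crd_mult x (unit_crd G) = x"
  using eventually_par_carrier by (rule eventually_mono) (simp add: crd_mult_def par_unit)

lemma crd_mult_left_unit: "\<forall>\<^sub>F x in nhds (unit_crd G). crd_mult (unit_crd G) x = x"
  using eventually_par_carrier by (rule eventually_mono) (simp add: crd_mult_def par_unit)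

lemma lie_bracket_eq: "lie_bracket G = bracket_of crd_mult (unit_crd G)"
  by (simp add: lie_bracket_def[abs_def] bracket_of_def[abs_def] left_inv_field_def[abs_def]
      left_field_def[abs_def] crd_mult_def[abs_def])

lemma bilinear_lie_bracket: "bilinear (lie_bracket G)"
  unfolding lie_bracket_eq by (rule bilinear_bracket_of[OF crd_mult_smooth])

lemma lie_bracket_skew: "lie_bracket G v w = - lie_bracket G w v"
  by (simp add: lie_bracket_def)

section \<open>The adjoint representation\<close>

definition conj_map :: "'g \<Rightarrow> 'e \<Rightarrow> 'e" where
  "conj_map g y = crd G (g \<otimes> par G y \<otimes> inv g)"

lemma Ad_eq: "Ad G g = frechet_derivative (conj_map g) (at (unit_crd G))"
  by (simp add: Ad_def[abs_def] conj_map_def[abs_def])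

lemma conj_map_unit: "g \<in> carrier G \<Longrightarrow> conj_map g (unit_crd G) = unit_crd G"
  by (simp add: conj_map_def par_unit)

lemma eventually_conj:
  assumes g: "g \<in> carrier G" and W: "openin X W" "\<one> \<in> W"
  shows "\<forall>\<^sub>F y in nhds (unit_crd G). par G y \<in> carrier G \<and> par G y \<in> unit_dom
      \<and> g \<otimes> par G y \<otimes> inv g \<in> W"
proof -
  have "continuous_map X X (\<lambda>x. g \<otimes> x \<otimes> inv g)"
    using continuous_map_compose[OF continuous_left[OF g] continuous_right[OF inv_closed[OF g]]]
    by (simp add: o_def)
  then have o: "openin X {x \<in> topspace X. g \<otimes> x \<otimes> inv g \<in> W}"
    using W(1) by (rule openin_continuous_map_preimage)
  have "\<one> \<in> {x \<in> topspace X. g \<otimes> x \<otimes> inv g \<in> W}"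
    using g W by (simp add: topspace_X)
  from eventually_par[OF o this] show ?thesis
    by (rule eventually_mono) simp
qed

text \<open>The conjugating element may lie outside the unit chart, so conjugation is factored into a left and
  a right translation through a chart around it.\<close>

lemma conj_map_smooth:
  assumes g: "g \<in> carrier G"
  shows "smooth_at (conj_map g) (unit_crd G)"
proof -
  obtain V \<psi> where c: "(V, \<psi>) \<in> atlas_of G" "g \<in> V" using chart_exists[OF g] by blast
  have 1: "smooth_at (\<lambda>y. \<psi> (g \<otimes> par G y)) (unit_crd G)"
    unfolding par_eq using left_mult_smooth_at[OF unit_chart(1) c(1) g unit_chart(2)] c(2) g by simp
  have 2: "smooth_at (\<lambda>z. crd G (inv_into V \<psi> z \<otimes> inv g)) (\<psi> (g \<otimes> par G (unit_crd G)))"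
    using right_mult_smooth_at[OF c(1) unit_chart(1) inv_closed[OF g] c(2)] g unit_chart(2)
    by (simp add: par_unit)
  from smooth_at_compose[OF 1 2]
  show ?thesis
  proof (rule smooth_at_cong)
    have o: "openin X {x \<in> topspace X. g \<otimes> x \<in> V}"
      by (rule openin_continuous_map_preimage[OF continuous_left[OF g] chartD(1)[OF c(1)]])
    have "\<one> \<in> {x \<in> topspace X. g \<otimes> x \<in> V}" using g c by (simp add: topspace_X)
    from eventually_par[OF o this]
    have "\<forall>\<^sub>F y in nhds (unit_crd G). g \<otimes> par G y \<in> V"
      by (rule eventually_mono) simp
    then show "\<forall>\<^sub>F y in nhds (unit_crd G). crd G (inv_into V \<psi> (\<psi> (g \<otimes> par G y))
        \<otimes> inv g) = conj_map g y"
      by (rule eventually_mono) (simp add: conj_map_def inv_into_f_f[OF chartD(5)[OF c(1)]])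
  qed
qed

lemma linear_Ad: "g \<in> carrier G \<Longrightarrow> linear (Ad G g)"
  unfolding Ad_eq by (rule smooth_at_linear_frechet[OF conj_map_smooth])

lemma Ad_one: "Ad G \<one> v = v"
proof -
  have "\<forall>\<^sub>F y in nhds (unit_crd G). conj_map \<one> y = y"
    using eventually_par_carrier by (rule eventually_mono) (simp add: conj_map_def)
  from frechet_derivative_cong_nhds[OF this] show ?thesis by (simp add: Ad_eq)
qed

lemma Ad_mult:
  assumes g: "g \<in> carrier G" and h: "h \<in> carrier G"
  shows "Ad G (g \<otimes> h) v = Ad G g (Ad G h v)"
proof -
  have "((\<lambda>y. conj_map g (conj_map h y)) has_derivative (\<lambda>v. Ad G g (Ad G h v))) (at (unit_crd G))"
    unfolding Ad_eq
    by (rule has_derivative_compose[OF smooth_at_has_derivative[OF conj_map_smooth[OF h]]])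
      (simp add: conj_map_unit[OF h] smooth_at_has_derivative[OF conj_map_smooth[OF g]])
  moreover have "\<forall>\<^sub>F y in nhds (unit_crd G). conj_map g (conj_map h y) = conj_map (g \<otimes> h) y"
    using eventually_conj[OF h chartD(1)[OF unit_chart(1)] unit_chart(2)]
  proof (rule eventually_mono)
    fix y assume y: "par G y \<in> carrier G \<and> par G y \<in> unit_dom
        \<and> h \<otimes> par G y \<otimes> inv h \<in> unit_dom"
    then have "conj_map g (conj_map h y) = crd G (g \<otimes> (h \<otimes> par G y \<otimes> inv h) \<otimes> inv g)"
      by (simp add: conj_map_def par_crd)
    also have "\<dots> = conj_map (g \<otimes> h) y"
      using y g h by (simp add: conj_map_def m_assoc inv_mult_group)
    finally show "conj_map g (conj_map h y) = conj_map (g \<otimes> h) y" .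
  qed
  ultimately have "(conj_map (g \<otimes> h) has_derivative (\<lambda>v. Ad G g (Ad G h v))) (at (unit_crd G))"
    by (subst (asm) has_derivative_cong_nhds)
  from frechet_derivative_at[OF this] show ?thesis by (metis Ad_eq)
qed

lemma Ad_inv:
  assumes g: "g \<in> carrier G"
  shows "Ad G g (Ad G (inv g) v) = v" "Ad G (inv g) (Ad G g v) = v"
  using Ad_mult[OF g inv_closed[OF g], of v] Ad_mult[OF inv_closed[OF g] g, of v] g
  by (simp_all add: Ad_one)

text \<open>Conjugation is a local homomorphism of the group law in the unit chart.\<close>

lemma Ad_bracket:
  assumes g: "g \<in> carrier G"
  shows "lie_bracket G (Ad G g v) (Ad G g w) = Ad G g (lie_bracket G v w)"
proof -
  let ?a = "unit_crd G"
  let ?W = "{x \<in> topspace X. g \<otimes> x \<otimes> inv g \<in> unit_dom} \<inter> unit_dom"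
  have "continuous_map X X (\<lambda>x. g \<otimes> x \<otimes> inv g)"
    using continuous_map_compose[OF continuous_left[OF g] continuous_right[OF inv_closed[OF g]]]
    by (simp add: o_def)
  then have o: "openin X ?W"
    using chartD(1)[OF unit_chart(1)] by (intro openin_Int openin_continuous_map_preimage)
  have one: "\<one> \<in> ?W" using g unit_chart(2) by (simp add: topspace_X)
  have hom: "g \<otimes> p \<otimes> inv g \<otimes> (g \<otimes> q \<otimes> inv g)
      = g \<otimes> (p \<otimes> q) \<otimes> inv g"
    if "p \<in> carrier G" "q \<in> carrier G" for p q
    using that g by (metis (no_types, lifting) inv_closed inv_solve_left m_assoc m_closed)
  have "\<forall>\<^sub>F P in nhds (?a, ?a). conj_map g (crd_mult (fst P) (snd P))
      = crd_mult (conj_map g (fst P)) (conj_map g (snd P))"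
    using eventually_par_par[OF o one] by (rule eventually_mono) (simp add: conj_map_def crd_mult_def par_crd hom)
  moreover have "smooth_at (\<lambda>(x, y). crd_mult x y) (conj_map g ?a, conj_map g ?a)"
    using crd_mult_smooth by (simp add: conj_map_unit[OF g])
  ultimately have "bracket_of crd_mult (conj_map g ?a) (Ad G g v) (Ad G g w) = Ad G g (bracket_of crd_mult ?a v w)"
    unfolding Ad_eq
    by (intro bracket_of_local_hom crd_mult_smooth crd_mult_right_unit crd_mult_left_unit conj_map_smooth g)
  then show ?thesis by (simp add: lie_bracket_eq conj_map_unit[OF g])
qed

text \<open>The derivative of \<open>Ad\<close> at the unit is \<open>ad\<close>: conjugation in the unit chart satisfies the
  characterising relation of \<open>conjugation_derivative\<close>.\<close>

lemma Ad_derivative: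
  "((\<lambda>x. Ad G (par G x) v) has_derivative (\<lambda>w. lie_bracket G w v)) (at (unit_crd G))"
proof -
  let ?a = "unit_crd G"
  define c where "c = (\<lambda>x y. conj_map (par G x) y)"
  define j where "j = (\<lambda>x. crd G (inv (par G x)))"
  have j: "smooth_at j ?a"
    unfolding j_def par_eq by (rule inv_smooth_at[OF unit_chart(1) unit_chart(1) unit_chart(2)]) (simp add: unit_chart(2))
  have ja: "j ?a = ?a" by (simp add: j_def par_unit)
  have "openin X {x \<in> topspace X. inv x \<in> unit_dom}" (is "openin X ?I")
    by (rule openin_continuous_map_preimage[OF continuous_inv chartD(1)[OF unit_chart(1)]])
  then have oI: "openin X (?I \<inter> unit_dom)" using chartD(1)[OF unit_chart(1)] by blast
  have oneI: "\<one> \<in> ?I \<inter> unit_dom" using unit_chart(2) by (simp add: topspace_X)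
  note ev = eventually_par_par[OF oI oneI]
  have "smooth_at (\<lambda>P. crd_mult (fst P) (snd P)) (?a, ?a)" using crd_mult_smooth by (simp add: case_prod_unfold)
  moreover have "smooth_at (\<lambda>P. j (fst P)) (?a, ?a)"
    by (rule smooth_at_compose[OF smooth_at_fst]) (simp add: j)
  ultimately have "smooth_at (\<lambda>P. (crd_mult (fst P) (snd P), j (fst P))) (?a, ?a)"
    by (rule smooth_at_Pair)
  moreover have "smooth_at (\<lambda>(x, y). crd_mult x y) (crd_mult (fst (?a, ?a)) (snd (?a, ?a)), j (fst (?a, ?a)))"
    using crd_mult_smooth by (simp add: ja crd_mult_def par_unit)
  ultimately have "smooth_at (\<lambda>P. (\<lambda>(x, y). crd_mult x y) (crd_mult (fst P) (snd P), j (fst P))) (?a, ?a)"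
    by (rule smooth_at_compose)
  then have sc: "smooth_at (\<lambda>(x, y). c x y) (?a, ?a)"
  proof (rule smooth_at_cong)
    show "\<forall>\<^sub>F P in nhds (?a, ?a). (\<lambda>(x, y). crd_mult x y) (crd_mult (fst P) (snd P), j
        (fst P)) = (\<lambda>(x, y). c x y) P"
      using ev by (rule eventually_mono) (auto simp: crd_mult_def j_def c_def conj_map_def par_crd)
  qed
  have "((\<lambda>x. frechet_derivative (c x) (at ?a) v) has_derivative (\<lambda>w. bracket_of crd_mult ?a w v)) (at ?a)"
  proof (rule conjugation_derivative[OF crd_mult_smooth crd_mult_right_unit crd_mult_left_unit sc])
    show "\<forall>\<^sub>F x in nhds ?a. c x ?a = ?a"
      using eventually_par_carrier by (rule eventually_mono) (simp add: c_def conj_map_unit)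
    show "\<forall>\<^sub>F y in nhds ?a. c ?a y = y"
      using eventually_par_carrier by (rule eventually_mono) (simp add: c_def conj_map_def par_unit)
    have "\<forall>\<^sub>F P in nhds (?a, ?a). par G (fst P) \<otimes> par G (snd P) \<otimes> inv (par G (fst
        P)) \<in> unit_dom"
    proof -
      have "isCont (\<lambda>P. crd_mult (fst P) (snd P)) (?a, ?a)" "isCont (\<lambda>P. j (fst P)) (?a, ?a)"
        by (intro smooth_at_isCont; fact)+
      then have "isCont (\<lambda>P. (crd_mult (fst P) (snd P), j (fst P))) (?a, ?a)"
        by (intro continuous_intros)
      moreover have "\<forall>\<^sub>F P in nhds ((\<lambda>P. (crd_mult (fst P) (snd P), j (fst P))) (?a, ?a)).
          par G (fst P) \<otimes> par G (snd P) \<in> unit_dom"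
        using eventually_par_par[OF chartD(1)[OF unit_chart(1)] unit_chart(2)]
        by (simp add: ja crd_mult_def par_unit) (erule eventually_mono, simp)
      ultimately have "\<forall>\<^sub>F P in nhds (?a, ?a). par G (crd_mult (fst P) (snd P)) \<otimes> par G (j
          (fst P)) \<in> unit_dom"
        using eventually_isCont[where f = "\<lambda>P. (crd_mult (fst P) (snd P), j (fst P))"] by fastforce
      then show ?thesis
        using ev by eventually_elim (auto simp: crd_mult_def j_def par_crd)
    qed
    then show "\<forall>\<^sub>F P in nhds (?a, ?a). crd_mult (c (fst P) (snd P)) (fst P) = crd_mult (fst P) (snd P)"
      using ev by eventually_elim (simp add: crd_mult_def c_def conj_map_def par_crd m_assoc)
  qed
  then show ?thesis by (simp add: c_def Ad_eq lie_bracket_eq)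
qed

text \<open>Differentiate \<open>[Ad p y, Ad p z] = Ad p [y, z]\<close> at the unit in the direction \<open>x\<close>.\<close>

lemma jacobi:
  "lie_bracket G x (lie_bracket G y z) = lie_bracket G (lie_bracket G x y) z + lie_bracket G y (lie_bracket G x z)"
proof -
  have bb: "bounded_bilinear (lie_bracket G)" using bilinear_lie_bracket by (simp add: bilinear_conv_bounded_bilinear)
  have "((\<lambda>p. lie_bracket G (Ad G (par G p) y) (Ad G (par G p) z)) has_derivative
     (\<lambda>w. lie_bracket G (Ad G (par G (unit_crd G)) y) (lie_bracket G w z)
        + lie_bracket G (lie_bracket G w y) (Ad G (par G (unit_crd G)) z))) (at (unit_crd G))"
    by (rule bounded_bilinear.FDERIV[OF bb Ad_derivative Ad_derivative])
  then have "((\<lambda>p. lie_bracket G (Ad G (par G p) y) (Ad G (par G p) z)) has_derivative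
     (\<lambda>w. lie_bracket G y (lie_bracket G w z) + lie_bracket G (lie_bracket G w y) z)) (at (unit_crd G))"
    by (simp add: par_unit Ad_one)
  moreover have "\<forall>\<^sub>F p in nhds (unit_crd G). lie_bracket G (Ad G (par G p) y) (Ad G (par G p) z)
      = Ad G (par G p) (lie_bracket G y z)"
    using eventually_par_carrier by (rule eventually_mono) (simp add: Ad_bracket)
  ultimately have "((\<lambda>p. Ad G (par G p) (lie_bracket G y z)) has_derivative
     (\<lambda>w. lie_bracket G y (lie_bracket G w z) + lie_bracket G (lie_bracket G w y) z)) (at (unit_crd G))"
    by (subst (asm) has_derivative_cong_nhds)
  from has_derivative_unique[OF this Ad_derivative] show ?thesis by (metis add.commute)
qed

end

section \<open>Velocities of curves and bounds on linear maps\<close>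

lemma has_vector_derivative_cong_nhds:
  assumes "\<forall>\<^sub>F y in nhds x. f y = h y"
  shows "(f has_vector_derivative D) (at x) \<longleftrightarrow> (h has_vector_derivative D) (at x)"
  unfolding has_vector_derivative_def by (rule has_derivative_cong_nhds[OF assms])

lemma has_vector_derivative_chain:
  assumes "(c has_vector_derivative v) (at t)" and "(F has_derivative F') (at (c t))"
  shows "((\<lambda>s. F (c s)) has_vector_derivative F' v) (at t)"
proof -
  have "((\<lambda>s. F (c s)) has_derivative (\<lambda>h. F' (h *\<^sub>R v))) (at t)"
    using has_derivative_compose[OF assms(1)[unfolded has_vector_derivative_def] assms(2)] .
  then show ?thesis
    unfolding has_vector_derivative_def
    using linear_cmul[OF has_derivative_linear[OF assms(2)]] by simp
qed

text \<open>The component of the curve orthogonal to \<open>S\<close> vanishes near \<open>t\<close>, so its derivative does.\<close>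

lemma velocity_in_subspace:
  fixes f :: "real \<Rightarrow> 'a::euclidean_space"
  assumes S: "subspace S" and f: "\<forall>\<^sub>F s in nhds t. f s \<in> S" and d: "(f has_vector_derivative d) (at t)"
  shows "d \<in> S"
proof -
  obtain y z where yz: "y \<in> span S" "\<And>w. w \<in> span S \<Longrightarrow> orthogonal z w" "d = y + z"
    using orthogonal_subspace_decomp_exists[of S d] by blast
  have "((\<lambda>t. f t \<bullet> z) has_derivative (\<lambda>h. (h *\<^sub>R d) \<bullet> z)) (at t)"
    by (rule has_derivative_inner_left[OF d[unfolded has_vector_derivative_def]])
  moreover have "\<forall>\<^sub>F s in nhds t. f s \<bullet> z = 0"
    using f
  proof (rule eventually_mono)
    fix s assume "f s \<in> S"
    from yz(2)[OF span_base[OF this]] show "f s \<bullet> z = 0" by (simp add: orthogonal_def inner_commute)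
  qed
  ultimately have "((\<lambda>t. 0) has_derivative (\<lambda>h. (h *\<^sub>R d) \<bullet> z)) (at t)"
    by (subst (asm) has_derivative_cong_nhds)
  from has_derivative_unique[OF this has_derivative_const] have "(1 *\<^sub>R d) \<bullet> z = 0" by (rule fun_cong)
  moreover have "y \<bullet> z = 0" using yz(2)[OF yz(1)] by (simp add: orthogonal_def inner_commute)
  ultimately have "z = 0" using yz(3) by (simp add: inner_add_left)
  then show ?thesis using yz span_eq_iff[THEN iffD2, OF S] by simp
qed

lemma linear_bound_from_basis:
  fixes L :: "'e::euclidean_space \<Rightarrow> 'a::real_normed_vector"
  assumes L: "linear L" and b: "\<And>b. b \<in> Basis \<Longrightarrow> norm (L b) \<le> B"
  shows "norm (L x) \<le> (real DIM('e) * B) * norm x"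
proof -
  have "norm (L x) = norm (\<Sum>b\<in>Basis. (x \<bullet> b) *\<^sub>R L b)"
      by (simp add: linear_basis_expansion[OF L, symmetric])
  also have "\<dots> \<le> (\<Sum>b\<in>(Basis :: 'e set). norm x * B)"
  proof (rule sum_norm_le)
    fix c :: 'e assume "c \<in> Basis"
    then show "norm ((x \<bullet> c) *\<^sub>R L c) \<le> norm x * B"
      using b[of c] by (simp add: Basis_le_norm mult_mono)
  qed
  finally show ?thesis by (simp add: mult_ac)
qed

section \<open>Compact groups and the Killing form\<close>

context lie_grp
begin

lemma eventually_crd:
  assumes T: "open T" and a: "unit_crd G \<in> T"
  shows "\<exists>W. openin X W \<and> \<one> \<in> W \<and> W \<subseteq> unit_dom \<and> crd G ` W \<subseteq> T"
proof -
  have "continuous_map (subtopology X unit_dom) (top_of_set (crd G ` unit_dom)) (crd G)"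
    using chartD(3)[OF unit_chart(1)] homeomorphic_imp_continuous_map by blast
  moreover have "openin (top_of_set (crd G ` unit_dom)) (crd G ` unit_dom \<inter> T)"
    using T by (simp add: openin_open_Int)
  ultimately have "openin (subtopology X unit_dom) {x \<in> topspace (subtopology X unit_dom). crd G x
      \<in> crd G ` unit_dom \<inter> T}"
    by (rule openin_continuous_map_preimage)
  moreover have "{x \<in> topspace (subtopology X unit_dom). crd G x \<in> crd G ` unit_dom \<inter> T}
      = {x \<in> unit_dom. crd G x \<in> T}"
    using chartD(4)[OF unit_chart(1)] by (auto simp: topspace_X)
  ultimately have "openin X {x \<in> unit_dom. crd G x \<in> T}"
    using openin_trans_full[OF _ chartD(1)[OF unit_chart(1)]] by simp
  then show ?thesis using a unit_chart(2) by (intro exI[of _ "{x \<in> unit_dom. crd G x \<in> T}"]) auto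
qed

text \<open>\<open>Ad\<close> is continuous at the unit, hence bounded on a neighbourhood \<open>W\<close> of it; finitely many translates of \<open>W\<close>
  cover the group and \<open>Ad\<close> is multiplicative.\<close>

lemma Ad_bounded:
  assumes "compact_space X"
  shows "\<exists>C. \<forall>g\<in>carrier G. \<forall>x. norm (Ad G g x) \<le> C * norm x"
proof -
  have "\<forall>\<^sub>F x in nhds (unit_crd G). norm (Ad G (par G x) b) \<le> norm b + 1" for b
  proof -
    have "isCont (\<lambda>x. norm (Ad G (par G x) b)) (unit_crd G)"
      by (intro continuous_norm has_derivative_continuous[OF Ad_derivative])
    moreover have "\<forall>\<^sub>F r in nhds (norm (Ad G (par G (unit_crd G)) b)). r \<in> {..<norm b + 1}"
      by (rule eventually_nhds_in_open) (simp_all add: par_unit Ad_one)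
    ultimately have "\<forall>\<^sub>F x in nhds (unit_crd G). norm (Ad G (par G x) b) \<in> {..<norm b + 1}"
      by (rule eventually_isCont)
    then show ?thesis by (rule eventually_mono) simp
  qed
  then have "\<forall>\<^sub>F x in nhds (unit_crd G). \<forall>b\<in>(Basis :: 'e set). norm (Ad G (par G x) b)
      \<le> norm b + 1"
    by (intro eventually_ball_finite finite_Basis ballI)
  then obtain T where T: "open T" "unit_crd G \<in> T" "\<And>x b. x \<in> T \<Longrightarrow> b \<in> Basis
      \<Longrightarrow> norm (Ad G (par G x) b) \<le> norm b + 1"
    unfolding eventually_nhds by blast
  obtain W where W: "openin X W" "\<one> \<in> W" "W \<subseteq> unit_dom" "crd G ` W \<subseteq> T"
    using eventually_crd[OF T(1,2)] by blast
  define C0 where "C0 = real DIM('e) * 2"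
  have C0: "norm (Ad G g x) \<le> C0 * norm x" if "g \<in> W" for g x
    unfolding C0_def
  proof (rule linear_bound_from_basis)
    show "linear (Ad G g)" using that W(1) openin_subset topspace_X by (intro linear_Ad) blast
    fix b :: 'e assume b: "b \<in> Basis"
    have "crd G g \<in> T" "par G (crd G g) = g" using that W par_crd by auto
    then show "norm (Ad G g b) \<le> 2" using T(3)[OF _ b, of "crd G g"] b by simp
  qed
  define V where "V = (\<lambda>g. {x \<in> topspace X. inv g \<otimes> x \<in> W})"
  have V: "openin X (V g)" "g \<in> V g" if "g \<in> carrier G" for g
  proof -
    show "openin X (V g)"
      unfolding V_def by (rule openin_continuous_map_preimage[OF continuous_left[OF inv_closed[OF that]] W(1)])
    show "g \<in> V g" using that W(2) by (simp add: V_def topspace_X)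
  qed
  have "\<exists>\<F>. finite \<F> \<and> \<F> \<subseteq> V ` carrier G \<and> topspace X \<subseteq> \<Union>\<F>"
  proof (rule assms[unfolded compact_space_alt, rule_format], intro conjI ballI)
    show "openin X U" if "U \<in> V ` carrier G" for U using that V(1) by blast
    show "topspace X \<subseteq> \<Union>(V ` carrier G)" unfolding topspace_X using V(2) by blast
  qed
  then obtain F where F: "finite F" "F \<subseteq> carrier G" "carrier G \<subseteq> (\<Union>g\<in>F. V g)"
    unfolding topspace_X by (metis finite_subset_image)
  have "\<exists>B\<ge>0. \<forall>x. norm (Ad G g x) \<le> B * norm x" if "g \<in> F" for g
  proof -
    have "g \<in> carrier G" using that F(2) by blast
    from linear_bounded_pos[OF linear_Ad[OF this]]
    obtain B where "0 < B" "\<And>x. norm (Ad G g x) \<le> B * norm x" by blast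
    then show ?thesis by (intro exI[of _ B]) simp
  qed
  then obtain B where B: "\<And>g. g \<in> F \<Longrightarrow> 0 \<le> B g" "\<And>g x. g \<in> F
      \<Longrightarrow> norm (Ad G g x) \<le> B g * norm x"
    by metis
  have "norm (Ad G h x) \<le> ((\<Sum>g\<in>F. B g) * C0) * norm x" if h: "h \<in> carrier G" for h x
  proof -
    obtain g where g: "g \<in> F" "h \<in> V g" using F(3) h by blast
    have gc: "g \<in> carrier G" using g F(2) by blast
    have w: "inv g \<otimes> h \<in> W" using g(2) by (simp add: V_def)
    have "Ad G h x = Ad G g (Ad G (inv g \<otimes> h) x)"
      using Ad_mult[OF gc m_closed[OF inv_closed[OF gc] h]] gc h by (simp add: m_assoc[symmetric])
    then have "norm (Ad G h x) \<le> B g * norm (Ad G (inv g \<otimes> h) x)" using B(2)[OF g(1)] by simp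
    also have "\<dots> \<le> B g * (C0 * norm x)" using C0[OF w] B(1)[OF g(1)] by (rule mult_left_mono)
    also have "\<dots> \<le> (\<Sum>g\<in>F. B g) * (C0 * norm x)"
      using member_le_sum[OF g(1), of B] B(1) F(1) by (intro mult_right_mono) (auto simp: C0_def)
    finally show ?thesis by (simp add: mult_ac)
  qed
  then show ?thesis by blast
qed

text \<open>Differentiating the invariance of an \<open>Ad\<close>-invariant inner product at the unit makes every \<open>ad u\<close> skew.\<close>

lemma invariant_form:
  assumes "compact_space X"
  shows "\<exists>Q. bilinear Q \<and> (\<forall>x y. Q x y = Q y x) \<and> (\<forall>x. x \<noteq> 0
      \<longrightarrow> 0 < Q x x) \<and>
     (\<forall>u x y. Q (lie_bracket G u x) y = - (Q x (lie_bracket G u y) :: real))"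
proof -
  obtain C where C: "\<And>g x. g \<in> carrier G \<Longrightarrow> norm (Ad G g x) \<le> C * norm x"
    using Ad_bounded[OF assms] by blast
  have "\<exists>Q. bilinear Q \<and> (\<forall>x y. Q x y = Q y x) \<and> (\<forall>x. x \<noteq> 0
      \<longrightarrow> 0 < Q x x) \<and>
      (\<forall>A\<in>Ad G ` carrier G. \<forall>x y. Q (A x) (A y) = (Q x y :: real))"
  proof (rule invariant_inner_product)
    show "(\<lambda>x. x) \<in> Ad G ` carrier G"
      using Ad_one by (intro image_eqI[OF _ one_closed]) (simp add: fun_eq_iff)
    show "(\<lambda>x. A (B x)) \<in> Ad G ` carrier G" if AB: "A \<in> Ad G ` carrier G" "B \<in> Ad G ` carrier G" for A B
    proof -
      obtain g h where "g \<in> carrier G" "h \<in> carrier G" "A = Ad G g" "B = Ad G h" using AB by blast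
      then show ?thesis using Ad_mult[of g h] by (intro image_eqI[where x = "g \<otimes> h"]) (auto simp: fun_eq_iff)
    qed
    show "\<exists>B\<in>Ad G ` carrier G. \<forall>x. A (B x) = x \<and> B (A x) = x" if A: "A \<in> Ad G ` carrier G" for A
    proof -
      obtain g where "g \<in> carrier G" "A = Ad G g" using A by blast
      then show ?thesis using Ad_inv by (intro bexI[of _ "Ad G (inv g)"]) auto
    qed
  qed (use linear_Ad C in auto)
  then obtain Q where Q: "bilinear Q" "\<And>x y. Q x y = Q y x" "\<And>x. x \<noteq> 0 \<Longrightarrow> 0 < Q x x"
      "\<And>g x y. g \<in> carrier G \<Longrightarrow> Q (Ad G g x) (Ad G g y) = (Q x y :: real)"
    by blast
  have "Q (lie_bracket G u x) y = - Q x (lie_bracket G u y)" for u x y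
  proof -
    have "bounded_bilinear Q" using Q(1) by (simp add: bilinear_conv_bounded_bilinear)
    from bounded_bilinear.FDERIV[OF this Ad_derivative[of x] Ad_derivative[of y]]
    have "((\<lambda>p. Q (Ad G (par G p) x) (Ad G (par G p) y)) has_derivative
       (\<lambda>u. Q x (lie_bracket G u y) + Q (lie_bracket G u x) y)) (at (unit_crd G))"
      by (simp add: par_unit Ad_one)
    moreover have "\<forall>\<^sub>F p in nhds (unit_crd G). Q (Ad G (par G p) x) (Ad G (par G p) y) = Q x y"
      using eventually_par_carrier by (rule eventually_mono) (simp add: Q(4))
    ultimately have "((\<lambda>p. Q x y) has_derivative
       (\<lambda>u. Q x (lie_bracket G u y) + Q (lie_bracket G u x) y)) (at (unit_crd G))"
      by (subst (asm) has_derivative_cong_nhds)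
    from has_derivative_unique[OF this has_derivative_const]
    have "Q x (lie_bracket G u y) + Q (lie_bracket G u x) y = 0" by (rule fun_cong)
    then show ?thesis by simp
  qed
  then show ?thesis using Q(1-3) by blast
qed

text \<open>The centre of the Lie algebra is an ideal, and not everything since some bracket is nonzero.\<close>

lemma centre_trivial:
  assumes simple: "simple_lie_group G" and v: "\<And>x. lie_bracket G v x = 0"
  shows "v = 0"
proof -
  define I where "I = {u. \<forall>x. lie_bracket G u x = 0}"
  have l: "linear (\<lambda>u. lie_bracket G u x)" for x using bilinear_lie_bracket by (rule bilinear_linear)
  have "subspace I"
    unfolding subspace_def I_def using linear_add[OF l] linear_cmul[OF l] linear_0[OF l] by simp
  moreover have "\<forall>v. \<forall>w\<in>I. lie_bracket G v w \<in> I"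
  proof (intro allI ballI)
    fix v w assume "w \<in> I"
    then have "lie_bracket G v w = 0" using lie_bracket_skew[of v w] by (simp add: I_def)
    then show "lie_bracket G v w \<in> I" using linear_0[OF l] by (simp add: I_def)
  qed
  ultimately have "I = {0} \<or> I = UNIV" using simple unfolding simple_lie_group_def by blast
  moreover have "I \<noteq> UNIV" using simple unfolding simple_lie_group_def I_def by blast
  moreover have "v \<in> I" using v by (simp add: I_def)
  ultimately show ?thesis by blast
qed

text \<open>In a basis orthonormal for an invariant inner product \<open>Q\<close>, the trace of \<open>(ad v)\<^sup>2\<close> is
  \<open>- \<Sum> Q [v, e] [v, e]\<close>; it vanishes only if \<open>v\<close> is central.\<close>

lemma killing_negative:
  assumes simple: "simple_lie_group G" and cpt: "compact_space X" and v: "v \<noteq> 0"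
  shows "killing G v v < 0"
proof -
  obtain Q where Q: "bilinear Q" "\<And>x y. Q x y = Q y x" "\<And>x. x \<noteq> 0 \<Longrightarrow> (0 :: real) < Q x x"
    "\<And>u x y. Q (lie_bracket G u x) y = - Q x (lie_bracket G u y)"
    using invariant_form[OF cpt] by blast
  obtain E where E: "finite E" "span E = UNIV" "orthonormal_wrt Q E"
    using orthonormal_basis_wrt_exists[OF Q(1,2) subspace_UNIV Q(3)] by blast
  have l: "linear (lie_bracket G u)" for u using bilinear_lie_bracket by (rule bilinear_linear)
  have l2: "linear (\<lambda>u. lie_bracket G v (lie_bracket G v u))"
    using linear_compose[OF l l, of v v] by (simp add: o_def)
  have expand: "x = (\<Sum>e\<in>E. Q x e *\<^sub>R e)" for x
    by (rule orthonormal_expansion[OF Q(1) E(1,3)]) (simp add: E(2))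
  have "killing G v v = (\<Sum>e\<in>E. Q (lie_bracket G v (lie_bracket G v e)) e)"
    unfolding killing_def by (rule lin_trace_orthonormal[OF Q(1) l2 expand])
  also have "\<dots> = - (\<Sum>e\<in>E. Q (lie_bracket G v e) (lie_bracket G v e))"
    by (simp add: Q(4) sum_negf)
  finally have k: "killing G v v = - (\<Sum>e\<in>E. Q (lie_bracket G v e) (lie_bracket G v e))" .
  have nn: "0 \<le> Q x x" for x
    using Q(3)[of x] linear_0[OF bilinear_linear(1)[OF Q(1)], of x] by (cases "x = 0") auto
  show ?thesis
  proof (rule ccontr)
    assume "\<not> killing G v v < 0"
    then have "(\<Sum>e\<in>E. Q (lie_bracket G v e) (lie_bracket G v e)) = 0"
      using k sum_nonneg[of E "\<lambda>e. Q (lie_bracket G v e) (lie_bracket G v e)"] nn by force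
    then have z: "lie_bracket G v e = 0" if "e \<in> E" for e
      using that Q(3) nn E(1) by (auto simp: sum_nonneg_eq_0_iff) (metis less_irrefl)
    have "lie_bracket G v x = 0" for x
      by (subst expand[of x]) (simp add: linear_sum[OF l] linear_cmul[OF l] z)
    from centre_trivial[OF simple this] show False using v by simp
  qed
qed

section \<open>The Lie algebra of a subgroup\<close>

text \<open>To first order the group law is addition, which is why velocities of products of curves add.\<close>

lemma crd_mult_derivative:
  "((\<lambda>(x, y). crd_mult x y) has_derivative (\<lambda>(v, w). v + w)) (at (unit_crd G, unit_crd G))"
proof -
  let ?a = "unit_crd G"
  let ?D = "frechet_derivative (\<lambda>(x, y). crd_mult x y) (at (?a, ?a))"
  have D: "((\<lambda>(x, y). crd_mult x y) has_derivative ?D) (at (?a, ?a))"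
    by (rule smooth_at_has_derivative[OF crd_mult_smooth])
  have 1: "?D (v, 0) = v" for v
  proof -
    have "((\<lambda>x. (x, ?a)) has_derivative (\<lambda>v. (v, 0))) (at ?a)" by (auto intro!: derivative_eq_intros)
    from has_derivative_compose[OF this D]
    have "((\<lambda>x. crd_mult x ?a) has_derivative (\<lambda>v. ?D (v, 0))) (at ?a)" by simp
    then have "((\<lambda>x. x) has_derivative (\<lambda>v. ?D (v, 0))) (at ?a)"
      using has_derivative_cong_nhds[OF crd_mult_right_unit] by blast
    from has_derivative_unique[OF this has_derivative_ident] show ?thesis by (rule fun_cong)
  qed
  have 2: "?D (0, v) = v" for v
  proof -
    have "((\<lambda>x. (?a, x)) has_derivative (\<lambda>v. (0, v))) (at ?a)" by (auto intro!: derivative_eq_intros)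
    from has_derivative_compose[OF this D]
    have "((\<lambda>x. crd_mult ?a x) has_derivative (\<lambda>v. ?D (0, v))) (at ?a)" by simp
    then have "((\<lambda>x. x) has_derivative (\<lambda>v. ?D (0, v))) (at ?a)"
      using has_derivative_cong_nhds[OF crd_mult_left_unit] by blast
    from has_derivative_unique[OF this has_derivative_ident] show ?thesis by (rule fun_cong)
  qed
  have "?D (v, w) = v + w" for v w
    using linear_add[OF has_derivative_linear[OF D], of "(v, 0)" "(0, w)"] 1 2 by simp
  then have "?D = (\<lambda>(v, w). v + w)" by (simp add: fun_eq_iff)
  then show ?thesis using D by simp
qed

lemma curve_eventually:
  assumes c: "continuous_map euclideanreal X \<gamma>" and g0: "\<gamma> 0 = \<one>" and W: "openin X W" "\<one> \<in> W"
  shows "\<forall>\<^sub>F t in nhds 0. \<gamma> t \<in> W"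
proof -
  have "openin euclideanreal {t \<in> topspace euclideanreal. \<gamma> t \<in> W}"
    by (rule openin_continuous_map_preimage[OF c W(1)])
  then have "open {t. \<gamma> t \<in> W}" by simp
  then show ?thesis using g0 W(2) eventually_nhds_in_open[of "{t. \<gamma> t \<in> W}" 0] by simp
qed

context
  fixes K assumes K: "subgroup K G"
begin

lemma lie_subalgI:
  assumes "continuous_map euclideanreal X \<gamma>" "\<And>t. \<gamma> t \<in> K" "\<gamma> 0 = \<one>"
    and "((\<lambda>t. crd G (\<gamma> t)) has_vector_derivative v) (at 0)"
  shows "v \<in> lie_subalg G K"
  unfolding lie_subalg_def using assms by blast

lemma lie_subalgE:
  assumes "v \<in> lie_subalg G K"
  obtains \<gamma> where "continuous_map euclideanreal X \<gamma>" "\<And>t. \<gamma> t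
      \<in> K" "\<And>t. \<gamma> t \<in> carrier G" "\<gamma> 0 = \<one>"
    "((\<lambda>t. crd G (\<gamma> t)) has_vector_derivative v) (at 0)"
  using assms subgroup.mem_carrier[OF K] unfolding lie_subalg_def by blast

lemma lie_subalg_add:
  assumes v: "v \<in> lie_subalg G K" and w: "w \<in> lie_subalg G K" shows "v + w \<in> lie_subalg G K"
proof -
  obtain c where c: "continuous_map euclideanreal X c" "\<And>t. c t \<in> K" "\<And>t. c t \<in> carrier G" "c 0 = \<one>"
    "((\<lambda>t. crd G (c t)) has_vector_derivative v) (at 0)" using lie_subalgE[OF v] by blast
  obtain d where d: "continuous_map euclideanreal X d" "\<And>t. d t \<in> K" "\<And>t. d t \<in> carrier G" "d 0 = \<one>"
    "((\<lambda>t. crd G (d t)) has_vector_derivative w) (at 0)" using lie_subalgE[OF w] by blast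
  show ?thesis
  proof (rule lie_subalgI)
    show "continuous_map euclideanreal X (\<lambda>t. c t \<otimes> d t)"
      using continuous_map_compose[OF continuous_map_pairedI[OF c(1) d(1)] continuous_mult] by (simp add: o_def)
    show "c t \<otimes> d t \<in> K" for t using c(2) d(2) subgroup.m_closed[OF K] by blast
    show "c 0 \<otimes> d 0 = \<one>" using c d by simp
    have "((\<lambda>t. (crd G (c t), crd G (d t))) has_vector_derivative (v, w)) (at 0)"
      using has_derivative_Pair[OF c(5)[unfolded has_vector_derivative_def] d(5)[unfolded has_vector_derivative_def]]
      by (simp add: has_vector_derivative_def)
    moreover have "((\<lambda>(x, y). crd_mult x y) has_derivative (\<lambda>(v, w). v + w)) (at (crd G (c 0), crd G (d 0)))"
      using crd_mult_derivative c(4) d(4) by simp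
    ultimately have "((\<lambda>t. (\<lambda>(x, y). crd_mult x y) (crd G (c t), crd G (d t)))
        has_vector_derivative (\<lambda>(v, w). v + w) (v, w)) (at 0)"
      by (rule has_vector_derivative_chain)
    moreover have "\<forall>\<^sub>F t in nhds 0. (\<lambda>(x, y). crd_mult x y) (crd G (c t), crd G (d t))
        = crd G (c t \<otimes> d t)"
      using curve_eventually[OF c(1,4) chartD(1)[OF unit_chart(1)] unit_chart(2)]
        curve_eventually[OF d(1,4) chartD(1)[OF unit_chart(1)] unit_chart(2)]
      by eventually_elim (simp add: crd_mult_def par_crd)
    ultimately show "((\<lambda>t. crd G (c t \<otimes> d t)) has_vector_derivative v + w) (at 0)"
      by (subst (asm) has_vector_derivative_cong_nhds) simp_all
  qed
qed

lemma lie_subalg_scale: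
  assumes v: "v \<in> lie_subalg G K" shows "r *\<^sub>R v \<in> lie_subalg G K"
proof -
  obtain c where c: "continuous_map euclideanreal X c" "\<And>t. c t \<in> K" "\<And>t. c t \<in> carrier G" "c 0 = \<one>"
    "((\<lambda>t. crd G (c t)) has_vector_derivative v) (at 0)" using lie_subalgE[OF v] by blast
  show ?thesis
  proof (rule lie_subalgI)
    have "continuous_map euclideanreal euclideanreal (\<lambda>t. r * t)"
      by (simp add: continuous_intros)
    from continuous_map_compose[OF this c(1)] show "continuous_map euclideanreal X (\<lambda>t. c (r * t))"
      by (simp add: o_def)
    show "c (r * t) \<in> K" for t by (rule c)
    show "c (r * 0) = \<one>" using c by simp
    have "((\<lambda>t. r * t) has_derivative (\<lambda>h. r * h)) (at 0)" by (auto intro!: derivative_eq_intros)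
    from has_derivative_compose[OF this, of "\<lambda>t. crd G (c t)" "\<lambda>h. h *\<^sub>R v"]
    show "((\<lambda>t. crd G (c (r * t))) has_vector_derivative r *\<^sub>R v) (at 0)"
      using c(5) by (simp add: has_vector_derivative_def mult.commute)
  qed
qed

lemma subspace_lie_subalg: "subspace (lie_subalg G K)"
  unfolding subspace_def
proof (intro conjI ballI allI)
  show "0 \<in> lie_subalg G K"
    by (rule lie_subalgI[of "\<lambda>_. \<one>"]) (simp_all add: topspace_X subgroup.one_closed[OF K])
qed (use lie_subalg_add lie_subalg_scale in auto)

lemma lie_subalg_Ad:
  assumes k: "k \<in> K" and v: "v \<in> lie_subalg G K" shows "Ad G k v \<in> lie_subalg G K"
proof -
  obtain c where c: "continuous_map euclideanreal X c" "\<And>t. c t \<in> K" "\<And>t. c t \<in> carrier G" "c 0 = \<one>"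
    "((\<lambda>t. crd G (c t)) has_vector_derivative v) (at 0)" using lie_subalgE[OF v] by blast
  have kc: "k \<in> carrier G" using subgroup.mem_carrier[OF K k] .
  show ?thesis
  proof (rule lie_subalgI)
    have "continuous_map X X (\<lambda>x. k \<otimes> x \<otimes> inv k)"
      using continuous_map_compose[OF continuous_left[OF kc] continuous_right[OF inv_closed[OF kc]]]
      by (simp add: o_def)
    from continuous_map_compose[OF c(1) this]
    show "continuous_map euclideanreal X (\<lambda>t. k \<otimes> c t \<otimes> inv k)" by (simp add: o_def)
    show "k \<otimes> c t \<otimes> inv k \<in> K" for t
      using k c(2) subgroup.m_closed[OF K] subgroup.m_inv_closed[OF K] by blast
    show "k \<otimes> c 0 \<otimes> inv k = \<one>" using c(4) kc by simp
    have "(conj_map k has_derivative Ad G k) (at (crd G (c 0)))"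
      unfolding Ad_eq c(4) by (rule smooth_at_has_derivative[OF conj_map_smooth[OF kc]])
    from has_vector_derivative_chain[OF c(5) this]
    have "((\<lambda>t. conj_map k (crd G (c t))) has_vector_derivative Ad G k v) (at 0)" .
    moreover have "\<forall>\<^sub>F t in nhds 0. conj_map k (crd G (c t)) = crd G (k \<otimes> c t \<otimes> inv k)"
      using curve_eventually[OF c(1,4) chartD(1)[OF unit_chart(1)] unit_chart(2)]
      by (rule eventually_mono) (simp add: conj_map_def par_crd)
    ultimately show "((\<lambda>t. crd G (k \<otimes> c t \<otimes> inv k)) has_vector_derivative Ad G k v) (at 0)"
      by (subst (asm) has_vector_derivative_cong_nhds)
  qed
qed

text \<open>For a curve \<open>c\<close> with velocity \<open>v\<close> the curve \<open>Ad (c t) w\<close> stays in the Lie algebra of \<open>K\<close> and has velocity \<open>[v, w]\<close>.\<close>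

lemma lie_subalg_bracket:
  assumes v: "v \<in> lie_subalg G K" and w: "w \<in> lie_subalg G K" shows "lie_bracket G v w \<in> lie_subalg G K"
proof -
  obtain c where c: "continuous_map euclideanreal X c" "\<And>t. c t \<in> K" "\<And>t. c t \<in> carrier G" "c 0 = \<one>"
    "((\<lambda>t. crd G (c t)) has_vector_derivative v) (at 0)" using lie_subalgE[OF v] by blast
  have "((\<lambda>x. Ad G (par G x) w) has_derivative (\<lambda>u. lie_bracket G u w)) (at (crd G (c 0)))"
    unfolding c(4) by (rule Ad_derivative)
  from has_vector_derivative_chain[OF c(5) this]
  have "((\<lambda>t. Ad G (par G (crd G (c t))) w) has_vector_derivative lie_bracket G v w) (at 0)" .
  moreover have "\<forall>\<^sub>F t in nhds 0. Ad G (par G (crd G (c t))) w = Ad G (c t) w"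
    using curve_eventually[OF c(1,4) chartD(1)[OF unit_chart(1)] unit_chart(2)]
    by (rule eventually_mono) (simp add: par_crd)
  ultimately have "((\<lambda>t. Ad G (c t) w) has_vector_derivative lie_bracket G v w) (at 0)"
    by (subst (asm) has_vector_derivative_cong_nhds)
  from velocity_in_subspace[OF subspace_lie_subalg _ this]
  show ?thesis by (simp add: lie_subalg_Ad[OF c(2) w])
qed

end

end

section \<open>Reductive decompositions and the Ricci tensor\<close>

text \<open>The algebraic data on which invariant connections on \<open>G/K\<close> depend. Both parts of the theorem are
  instances; for the quotient these properties are obtained by transport along a chart and not from a
  Lie group structure on it.\<close>

locale reductive =
  fixes G :: "('g, 'e::euclidean_space) lie_data" and K :: "'g set"
  assumes bil: "bilinear (lie_bracket G)"
    and skew: "lie_bracket G x y = - lie_bracket G y x"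
    and jacobi: "lie_bracket G x (lie_bracket G y z)
       = lie_bracket G (lie_bracket G x y) z + lie_bracket G y (lie_bracket G x z)"
    and killing_neg: "v \<noteq> 0 \<Longrightarrow> killing G v v < 0"
    and subspace_k: "subspace (lie_subalg G K)"
    and bracket_k: "v \<in> lie_subalg G K \<Longrightarrow> w \<in> lie_subalg G K
        \<Longrightarrow> lie_bracket G v w \<in> lie_subalg G K"
    and Ad_linear: "g \<in> K \<Longrightarrow> linear (Ad G g)"
    and Ad_bracket: "g \<in> K \<Longrightarrow> lie_bracket G (Ad G g v) (Ad G g w) = Ad G g (lie_bracket G v w)"
    and Ad_k: "g \<in> K \<Longrightarrow> v \<in> lie_subalg G K \<Longrightarrow> Ad G g v \<in> lie_subalg G K"
    and Ad_inverse: "g \<in> K \<Longrightarrow> \<exists>h\<in>K. \<forall>v. Ad G g (Ad G h v) = v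
        \<and> Ad G h (Ad G g v) = v"
begin

abbreviation br where "br \<equiv> lie_bracket G"
abbreviation g where "g \<equiv> gB G"
abbreviation kk where "kk \<equiv> lie_subalg G K"
abbreviation mm where "mm \<equiv> red_compl G K"
abbreviation pk where "pk \<equiv> proj_k G K"
abbreviation pm where "pm \<equiv> proj_m G K"

lemmas br_linear = bilinear_linear[OF bil]
lemmas br_simps = linear_add[OF br_linear(1)] linear_add[OF br_linear(2)] linear_diff[OF br_linear(1)]
  linear_diff[OF br_linear(2)] linear_cmul[OF br_linear(1)] linear_cmul[OF br_linear(2)]
  linear_neg[OF br_linear(1)] linear_neg[OF br_linear(2)] linear_0[OF br_linear(1)] linear_0[OF br_linear(2)]

lemma br_self: "br x x = 0"
proof -
  have "br x x + br x x = 0" using skew[of x x] by (metis add.right_inverse)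
  then show ?thesis by (simp add: scaleR_2[symmetric])
qed

lemma linear_comp: "linear P \<Longrightarrow> linear Q \<Longrightarrow> linear (\<lambda>x. P (Q x))"
  using linear_compose[of Q P] by (simp add: o_def)

lemma killing_sym: "killing G x y = killing G y x"
  unfolding killing_def by (rule lin_trace_commute[OF br_linear(1) br_linear(1)])

lemma killing_linear: "linear (killing G x)"
  by (rule linearI) (simp_all add: killing_def br_simps lin_trace_add lin_trace_scaleR)

text \<open>Expanding \<open>ad [x, y]\<close> by the Jacobi identity leaves two traces that differ by a cyclic permutation.\<close>

lemma killing_assoc: "killing G (br x y) z = killing G x (br y z)"
proof -
  have e: "br (br p q) r = br p (br q r) - br q (br p r)" for p q r
    using jacobi[of p q r] by simp
  have "killing G (br x y) z = lin_trace (\<lambda>u. br x (br y (br z u))) - lin_trace (\<lambda>u. br y (br x (br z u)))"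
    unfolding killing_def e lin_trace_diff ..
  moreover have "killing G x (br y z)
      = lin_trace (\<lambda>u. br x (br y (br z u))) - lin_trace (\<lambda>u. br x (br z (br y u)))"
    unfolding killing_def e by (simp add: br_simps lin_trace_diff)
  moreover have "lin_trace (\<lambda>u. br y (br x (br z u))) = lin_trace (\<lambda>u. br x (br z (br y u)))"
    by (rule lin_trace_commute[OF br_linear(1) linear_comp[OF br_linear(1) br_linear(1)]])
  ultimately show ?thesis by simp
qed

lemma g_bilinear: "bilinear g"
proof -
  have "linear (g x)" for x
    by (rule linearI) (simp_all add: gB_def linear_add[OF killing_linear] linear_cmul[OF killing_linear])
  moreover have "(\<lambda>x. g x y) = g y" for y by (simp add: gB_def fun_eq_iff killing_sym)
  ultimately show ?thesis by (simp add: bilinear_def)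
qed

lemma g_sym: "g x y = g y x" by (simp add: gB_def killing_sym)

lemma g_pos: "x \<noteq> 0 \<Longrightarrow> 0 < g x x" using killing_neg by (simp add: gB_def)

lemmas g_linear = bilinear_linear[OF g_bilinear]
lemmas g_simps = linear_add[OF g_linear(1)] linear_add[OF g_linear(2)] linear_diff[OF g_linear(1)]
  linear_diff[OF g_linear(2)] linear_cmul[OF g_linear(1)] linear_cmul[OF g_linear(2)]
  linear_neg[OF g_linear(1)] linear_neg[OF g_linear(2)] linear_0[OF g_linear(1)] linear_0[OF g_linear(2)]

lemma g_skew: "g (br x y) z = - g y (br x z)"
  using killing_assoc[of y x z] by (simp add: gB_def skew[of x y] linear_neg[OF killing_linear] killing_sym[of _ z]
      killing_sym[of "br x z"])

lemma mm_iff: "w \<in> mm \<longleftrightarrow> (\<forall>v\<in>kk. g v w = 0)"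
  by (simp add: red_compl_def gB_def)

lemma subspace_m: "subspace mm"
  unfolding subspace_def by (auto simp: mm_iff g_simps)

lemma k_m_orth: "v \<in> kk \<Longrightarrow> w \<in> mm \<Longrightarrow> g v w = 0" "v \<in> kk
    \<Longrightarrow> w \<in> mm \<Longrightarrow> g w v = 0"
  using mm_iff g_sym by auto

lemma k_m_disjoint: "v \<in> kk \<Longrightarrow> v \<in> mm \<Longrightarrow> v = 0"
  using g_pos[of v] k_m_orth by fastforce

text \<open>The form \<open>g\<close> is definite on \<open>\<kk>\<close>, so the orthogonal projection onto \<open>\<kk>\<close> exists.\<close>

lemma decomposition: "\<exists>p. linear p \<and> (\<forall>x. p x \<in> kk \<and> x - p x \<in> mm)"
proof -
  obtain F where F: "finite F" "span F = kk" "orthonormal_wrt g F"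
    using orthonormal_basis_wrt_exists[OF g_bilinear g_sym subspace_k g_pos] by blast
  define p where "p = (\<lambda>x. \<Sum>f\<in>F. g x f *\<^sub>R f)"
  have "linear p"
    by (rule linearI) (simp_all add: p_def g_simps scaleR_add_left sum.distrib scaleR_sum_right)
  moreover have pk: "p x \<in> kk" for x
    unfolding p_def F(2)[symmetric] by (intro span_sum span_scale span_base)
  moreover have "x - p x \<in> mm" for x
  proof -
    have "g v (x - p x) = 0" if v: "v \<in> kk" for v
    proof -
      have f0: "g f (x - p x) = 0" if "f \<in> F" for f
        using orthonormal_coeff[OF g_bilinear F(1,3) that, of "g x"]
        by (simp add: g_simps p_def g_sym[of f])
      have "v \<in> span F" using v F(2) by simp
      from orthonormal_expansion[OF g_bilinear F(1,3) this]
      have "g v (x - p x) = g (\<Sum>f\<in>F. g v f *\<^sub>R f) (x - p x)" by simp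
      also have "\<dots> = (\<Sum>f\<in>F. g v f * g f (x - p x))"
        by (simp add: linear_sum[OF g_linear(2)] linear_cmul[OF g_linear(2)])
      also have "\<dots> = 0" using f0 by simp
      finally show ?thesis .
    qed
    then show ?thesis by (simp add: mm_iff)
  qed
  ultimately show ?thesis by blast
qed

lemma decomposition_unique:
  assumes "a + b = c + d" "a \<in> kk" "c \<in> kk" "b \<in> mm" "d \<in> mm"
  shows "a = c" "b = d"
proof -
  have "a - c = d - b" using assms(1) by (simp add: algebra_simps)
  moreover have "a - c \<in> kk" "d - b \<in> mm"
    using assms subspace_k subspace_m by (auto intro: subspace_diff)
  ultimately have "a - c = 0" using k_m_disjoint by metis
  then show "a = c" "b = d" using assms(1) by auto
qed

lemma proj_k_eqI: "a \<in> kk \<Longrightarrow> b \<in> mm \<Longrightarrow> z = a + b \<Longrightarrow> pk z = a"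
  unfolding proj_k_def
proof (rule the_equality)
  fix W assume z: "a \<in> kk" "b \<in> mm" "z = a + b" and W: "W \<in> kk \<and> z - W \<in> mm"
  show "W = a" by (rule decomposition_unique(1)[of W "z - W" a b]) (use z W in auto)
qed simp

lemma proj_m_eqI: "a \<in> kk \<Longrightarrow> b \<in> mm \<Longrightarrow> z = a + b \<Longrightarrow> pm z = b"
  unfolding proj_m_def
proof (rule the_equality)
  fix W assume z: "a \<in> kk" "b \<in> mm" "z = a + b" and W: "W \<in> mm \<and> z - W \<in> kk"
  show "W = b" by (rule decomposition_unique(2)[of "z - W" W a b]) (use z W in auto)
qed simp

lemma proj: "pk z \<in> kk" "pm z \<in> mm" "pm z = z - pk z" and proj_k_linear: "linear pk"
proof -
  obtain p where p: "linear p" "\<And>x. p x \<in> kk" "\<And>x. x - p x \<in> mm" using decomposition by blast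
  have 1: "pk x = p x" for x by (rule proj_k_eqI[of _ "x - p x"]) (use p in auto)
  have 2: "pm x = x - p x" for x by (rule proj_m_eqI[of "p x"]) (use p in auto)
  show "pk z \<in> kk" "pm z \<in> mm" "pm z = z - pk z" using p by (auto simp: 1 2)
  have "pk = p" using 1 by (simp add: fun_eq_iff)
  then show "linear pk" using p by simp
qed

lemma proj_m_linear: "linear pm"
proof -
  have "pm = (\<lambda>z. z - pk z)" by (simp add: proj(3) fun_eq_iff)
  then show ?thesis using linear_compose_sub[OF linear_ident proj_k_linear] by simp
qed

lemmas p_simps = linear_add[OF proj_k_linear] linear_cmul[OF proj_k_linear] linear_0[OF proj_k_linear]
  linear_add[OF proj_m_linear] linear_cmul[OF proj_m_linear] linear_0[OF proj_m_linear]
  linear_neg[OF proj_k_linear] linear_neg[OF proj_m_linear]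
  linear_diff[OF proj_k_linear] linear_diff[OF proj_m_linear]

lemma proj_on: "v \<in> kk \<Longrightarrow> pk v = v" "w \<in> mm \<Longrightarrow> pk w = 0" "w \<in> mm
    \<Longrightarrow> pm w = w"
  using proj_k_eqI[of v 0 v] proj_k_eqI[of 0 w w] proj_m_eqI[of 0 w w]
    subspace_0[OF subspace_m] subspace_0[OF subspace_k] by auto

lemma g_proj: "w \<in> mm \<Longrightarrow> g (pm z) w = g z w" "g (pk x) y = g x (pk y)"
proof -
  show "w \<in> mm \<Longrightarrow> g (pm z) w = g z w"
    using k_m_orth(1)[OF proj(1)] by (simp add: proj(3) g_simps)
  have "g (pk x) (pm y) = 0" "g (pm x) (pk y) = 0" using k_m_orth proj by blast+
  then show "g (pk x) y = g x (pk y)" by (simp add: proj(3) g_simps)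
qed

lemma bracket_k_m: "v \<in> kk \<Longrightarrow> w \<in> mm \<Longrightarrow> br v w \<in> mm"
proof -
  assume v: "v \<in> kk" and w: "w \<in> mm"
  have "g u (br v w) = 0" if u: "u \<in> kk" for u
    using g_skew[of v w u] k_m_orth(2)[OF bracket_k[OF v u] w] g_sym[of u] by simp
  then show "br v w \<in> mm" by (simp add: mm_iff)
qed

lemma bracket_m_k: "w \<in> mm \<Longrightarrow> v \<in> kk \<Longrightarrow> br w v \<in> mm"
  using bracket_k_m[of v w] skew[of w v] subspace_neg[OF subspace_m] by metis

lemma Ad_killing:
  assumes h: "h \<in> K" shows "killing G (Ad G h v) (Ad G h w) = killing G v w"
proof -
  obtain h' where h': "h' \<in> K" "\<And>v. Ad G h (Ad G h' v) = v" "\<And>v. Ad G h' (Ad G h v) = v"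
    using Ad_inverse[OF h] by blast
  have "br (Ad G h v) (br (Ad G h w) u) = Ad G h (br v (br w (Ad G h' u)))" for u
    using Ad_bracket[OF h, of w "Ad G h' u"] Ad_bracket[OF h, of v "br w (Ad G h' u)"] h'(2) by simp
  then show ?thesis
    unfolding killing_def
    using lin_trace_conjugate[OF linear_comp[OF br_linear(1) br_linear(1)] Ad_linear[OF h] Ad_linear[OF h'(1)] h'(3)]
    by simp
qed

lemma Ad_m: assumes h: "h \<in> K" and w: "w \<in> mm" shows "Ad G h w \<in> mm"
  unfolding mm_iff
proof
  fix v assume v: "v \<in> kk"
  obtain h' where h': "h' \<in> K" "\<And>v. Ad G h (Ad G h' v) = v" using Ad_inverse[OF h] by blast
  have "g v (Ad G h w) = g (Ad G h' v) w"
    using Ad_killing[OF h, of "Ad G h' v" w] by (simp add: gB_def h'(2))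
  also have "\<dots> = 0" using k_m_orth(1)[OF Ad_k[OF h'(1) v] w] .
  finally show "g v (Ad G h w) = 0" .
qed

lemma Ad_proj:
  assumes h: "h \<in> K" shows "pm (Ad G h z) = Ad G h (pm z)" "pk (Ad G h z) = Ad G h (pk z)"
proof -
  have eq: "Ad G h z = Ad G h (pk z) + Ad G h (pm z)"
    using linear_add[OF Ad_linear[OF h], of "pk z" "pm z"] by (simp add: proj(3))
  show "pm (Ad G h z) = Ad G h (pm z)"
    by (rule proj_m_eqI[OF Ad_k[OF h proj(1)] Ad_m[OF h proj(2)] eq])
  show "pk (Ad G h z) = Ad G h (pk z)"
    by (rule proj_k_eqI[OF Ad_k[OF h proj(1)] Ad_m[OF h proj(2)] eq])
qed

text \<open>In terms of an orthonormal basis \<open>f\<close> of \<open>\<kk>\<close> this is \<open>g (\<Sum> (ad f)\<^sup>2 x) y\<close> for \<open>x\<close> and \<open>y\<close> in \<open>\<mm>\<close>: the Casimir operator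
  of the isotropy representation read as a form. Written as a trace, it is visibly invariant.\<close>

definition casimir :: "'e \<Rightarrow> 'e \<Rightarrow> real" where
  "casimir x y = lin_trace (\<lambda>z. pk (br x (br y z)))"

lemma onb_exists: "\<exists>E. orthonormal_basis G K E"
proof -
  obtain E where "finite E" "span E = mm" "orthonormal_wrt g E"
    using orthonormal_basis_wrt_exists[OF g_bilinear g_sym subspace_m g_pos] by blast
  then show ?thesis unfolding orthonormal_basis_def orthonormal_wrt_def by blast
qed

lemma onb: "orthonormal_basis G K (some_onb G K)"
  unfolding some_onb_def by (rule someI_ex[OF onb_exists])

abbreviation E where "E \<equiv> some_onb G K"

lemma E: "finite E" "span E = mm" "orthonormal_wrt g E" "e \<in> E \<Longrightarrow> e \<in> mm" "card E = dim mm"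
proof -
  show 1: "finite E" "span E = mm" "orthonormal_wrt g E"
    using onb by (auto simp: orthonormal_basis_def orthonormal_wrt_def)
  show "e \<in> E \<Longrightarrow> e \<in> mm" using 1(2) span_base by blast
  show "card E = dim mm"
    using dim_eq_card_independent[OF orthonormal_independent[OF g_bilinear 1(1,3)]] dim_span[of E] 1(2) by simp
qed

lemma trace_over_m: assumes "linear F" shows "(\<Sum>e\<in>E. g (F e) e) = lin_trace (\<lambda>x. F (pm x))"
proof -
  have "pm x = (\<Sum>e\<in>E. g x e *\<^sub>R e)" for x
  proof -
    have "pm x = (\<Sum>e\<in>E. g (pm x) e *\<^sub>R e)"
      by (rule orthonormal_expansion[OF g_bilinear E(1,3)]) (simp add: E(2) proj(2))
    then show ?thesis using g_proj(1)[OF E(4)] by simp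
  qed
  from lin_trace_orthonormal[OF g_bilinear assms this] show ?thesis by simp
qed

text \<open>Skewness of \<open>ad y\<close> turns the sum into a trace over \<open>\<mm>\<close>; it extends to a trace over \<open>\<gg>\<close> because
  \<open>[x, \<kk>] \<subseteq> \<mm>\<close> is killed by the projection.\<close>

lemma sum_k_part:
  assumes "x \<in> mm"
  shows "(\<Sum>e\<in>E. g (pk (br x e)) (br y e)) = - casimir x y"
proof -
  have l: "linear (\<lambda>z. br y (pk (br x z)))"
    by (rule linear_comp[OF br_linear(1) linear_comp[OF proj_k_linear br_linear(1)]])
  have "g (pk (br x e)) (br y e) = - g (br y (pk (br x e))) e" for e
    using g_skew[of y "pk (br x e)" e] by simp
  then have "(\<Sum>e\<in>E. g (pk (br x e)) (br y e)) = - lin_trace (\<lambda>z. br y (pk (br x (pm z))))"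
    using trace_over_m[OF l] by (simp add: sum_negf)
  also have "(\<lambda>z. br y (pk (br x (pm z)))) = (\<lambda>z. br y (pk (br x z)))"
    using proj_on(2)[OF bracket_m_k[OF assms proj(1)]] by (simp add: proj(3) br_simps p_simps fun_eq_iff)
  also have "lin_trace (\<lambda>z. br y (pk (br x z))) = casimir x y"
    unfolding casimir_def by (rule lin_trace_commute[OF br_linear(1) linear_comp[OF proj_k_linear br_linear(1)]])
  finally show ?thesis .
qed

lemma casimir_sym:
  assumes "x \<in> mm" "y \<in> mm" shows "casimir x y = casimir y x"
proof -
  have "g (pk (br x e)) (br y e) = g (pk (br y e)) (br x e)" for e
    using g_proj(2)[of "br x e" "br y e"] g_sym by simp
  then show ?thesis using sum_k_part[OF assms(1), of y] sum_k_part[OF assms(2), of x] by simp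
qed

text \<open>Here the trace over \<open>\<mm>\<close> is the full trace, the Killing form, minus the part over \<open>\<kk>\<close>, the Casimir form.\<close>

lemma sum_bracket: "(\<Sum>e\<in>E. g (br x e) (br y e)) = g x y + casimir y x"
proof -
  have l: "linear (\<lambda>z. br y (br x z))" by (rule linear_comp[OF br_linear(1) br_linear(1)])
  have "g (br x e) (br y e) = - g (br y (br x e)) e" for e
    using g_skew[of y "br x e" e] by simp
  then have "(\<Sum>e\<in>E. g (br x e) (br y e)) = - lin_trace (\<lambda>z. br y (br x (pm z)))"
    using trace_over_m[OF l] by (simp add: sum_negf)
  also have "\<dots> = - (killing G y x - lin_trace (\<lambda>z. br y (br x (pk z))))"
    by (simp add: proj(3) br_simps killing_def lin_trace_diff)
  also have "lin_trace (\<lambda>z. br y (br x (pk z))) = lin_trace (\<lambda>z. pk (br y (br x z)))"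
    by (rule lin_trace_commute[OF l proj_k_linear])
  finally show ?thesis
    by (simp add: casimir_def gB_def killing_sym[of y x])
qed

text \<open>Since \<open>[e, e] = 0\<close>, three terms of the curvature \<open>R(x, e) e\<close> survive; paired with \<open>y\<close> they are multiples of the
  summands of \<open>sum_bracket\<close> and \<open>sum_k_part\<close>.\<close>

lemma Ric_nomizu_alpha:
  fixes \<alpha> :: real
  defines "c \<equiv> (1 - \<alpha>) / 2"
  assumes x: "x \<in> mm" and y: "y \<in> mm"
  shows "Ric G K (nomizu_alpha G K \<alpha>) x y = c * (1 - c) * (g x y + 2 * casimir x y) - casimir x y"
proof -
  define \<Lambda> where "\<Lambda> = nomizu_alpha G K \<alpha>"
  have L: "\<Lambda> u v = c *\<^sub>R pm (br u v)" for u v by (simp add: \<Lambda>_def nomizu_alpha_def c_def)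
  define k where "k = (\<lambda>e. g (pk (br x e)) (br y e))"
  define a where "a = (\<lambda>e. g (br x e) (br y e) - k e)"
  have move: "g (br e u) y = g u (br y e)" for e u
    using g_skew[of e u y] skew[of e y] by (simp add: g_simps)
  have "g (curvature G K \<Lambda> x e e) y = (c - c * c) * a e + k e" for e
  proof -
    have curv: "curvature G K \<Lambda> x e e = - (c * c) *\<^sub>R pm (br e (pm (br x e)))
        + c *\<^sub>R pm (br e (pm (br x e))) + br e (pk (br x e))"
      unfolding curvature_def L using skew[of "pm (br x e)" e] skew[of "pk (br x e)" e]
      by (simp add: br_self p_simps br_simps)
    have "g (curvature G K \<Lambda> x e e) y = (c - c * c) * g (pm (br x e)) (br y e) + k e"
      unfolding curv by (simp add: g_simps g_proj(1)[OF y] move k_def algebra_simps)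
    moreover have "g (pm (br x e)) (br y e) = a e"
      by (simp add: a_def k_def proj(3) g_simps)
    ultimately show ?thesis by simp
  qed
  then have "Ric G K \<Lambda> x y = (c - c * c) * (\<Sum>e\<in>E. a e) + (\<Sum>e\<in>E. k e)"
    unfolding Ric_def by (simp add: sum.distrib sum_distrib_left)
  moreover have "(\<Sum>e\<in>E. k e) = - casimir x y" unfolding k_def by (rule sum_k_part[OF x])
  moreover have "(\<Sum>e\<in>E. a e) = g x y + 2 * casimir x y"
    using sum_bracket[of x y] sum_k_part[OF x, of y] casimir_sym[OF x y] by (simp add: a_def k_def sum_subtractf)
  ultimately show ?thesis by (simp add: \<Lambda>_def algebra_simps)
qed

text \<open>The Ricci tensor is then symmetric and equal to \<open>\<mu> g\<close>, and \<open>\<mu>\<close> is determined by taking the trace. If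
  \<open>\<mm> = 0\<close>, all tensors vanish.\<close>

lemma nabla_einstein_if_casimir_scalar:
  assumes casimir: "\<And>x y. x \<in> mm \<Longrightarrow> y \<in> mm \<Longrightarrow> casimir x y = \<kappa> * g x y"
  shows "nabla_einstein G K (nomizu_alpha G K \<alpha>)"
proof -
  define c where "c = (1 - \<alpha>) / 2"
  define \<mu> where "\<mu> = c * (1 - c) * (1 + 2 * \<kappa>) - \<kappa>"
  define \<Lambda> where "\<Lambda> = nomizu_alpha G K \<alpha>"
  have L: "\<Lambda> u v = c *\<^sub>R pm (br u v)" for u v by (simp add: \<Lambda>_def nomizu_alpha_def c_def)
  have Ric: "Ric G K \<Lambda> x y = \<mu> * g x y" if "x \<in> mm" "y \<in> mm" for x y
    using Ric_nomizu_alpha[OF that, of \<alpha>, folded c_def \<Lambda>_def] unfolding casimir[OF that]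
    by (simp add: \<mu>_def algebra_simps)
  have "Scal G K \<Lambda> = (\<Sum>e\<in>E. \<mu>)"
    unfolding Scal_def using E(3,4) Ric by (intro sum.cong) (auto simp: orthonormal_wrt_def)
  then have Scal: "Scal G K \<Lambda> = real (dim mm) * \<mu>" by (simp add: E(5))
  have "Ric_S G K \<Lambda> x y = Scal G K \<Lambda> / real (dim mm) * g x y" if "x \<in> mm" "y \<in> mm" for x y
  proof (cases "dim mm = 0")
    case True
    then have "mm \<subseteq> {0}" by (simp add: dim_eq_0)
    then have "x = 0" using that by blast
    then show ?thesis using Ric[OF that] Ric[OF that(2,1)] by (simp add: Ric_S_def g_simps)
  next
    case False
    then show ?thesis using Ric[OF that] Ric[OF that(2,1)] by (simp add: Ric_S_def Scal g_sym[of y x])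
  qed
  moreover have "is_nomizu_map G K \<Lambda>"
    unfolding is_nomizu_map_def L
    using subspace_scale[OF subspace_m proj(2)] Ad_linear Ad_bracket Ad_proj(1)
    by (simp add: br_simps p_simps scaleR_add_right mult.commute linear_cmul)
  moreover have "metric_connection G K \<Lambda>"
    unfolding metric_connection_def L
  proof (intro ballI)
    fix x y z assume "x \<in> mm" "y \<in> mm" "z \<in> mm"
    then show "g (c *\<^sub>R pm (br x y)) z + g y (c *\<^sub>R pm (br x z)) = 0"
      using g_proj(1)[of z "br x y"] g_proj(1)[of y "br x z"] g_skew[of x y z] g_sym[of y]
      by (simp add: g_simps)
  qed
  moreover have "skew_torsion G K \<Lambda>"
    unfolding skew_torsion_def torsion_def L
  proof (intro ballI)
    fix x y z assume "x \<in> mm" "y \<in> mm" "z \<in> mm"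
    moreover have "c *\<^sub>R pm (br x y) - c *\<^sub>R pm (br y x) - pm (br x y)
        = (c + c - 1) *\<^sub>R pm (br x y)" for x y
    proof -
      have "pm (br y x) = - pm (br x y)" unfolding skew[of y x] by (rule linear_neg[OF proj_m_linear])
      moreover have "c *\<^sub>R v - c *\<^sub>R (- v) - v = (c + c - 1) *\<^sub>R v" for v :: 'e
        unfolding scaleR_left.diff scaleR_left.add by simp
      ultimately show ?thesis by simp
    qed
    moreover have "g (br x y) z = - g (br x z) y" using g_skew[of x y z] g_sym by simp
    ultimately show "g (c *\<^sub>R pm (br x y) - c *\<^sub>R pm (br y x) - pm (br x y)) z
       = - g (c *\<^sub>R pm (br x z) - c *\<^sub>R pm (br z x) - pm (br x z)) y"
      by (simp add: g_simps g_proj(1))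
  qed
  ultimately show ?thesis
    using g_pos by (simp add: nabla_einstein_def \<Lambda>_def)
qed

lemma casimir_bilinear: "bilinear casimir"
  unfolding bilinear_def
  by (intro conjI allI linearI) (simp_all add: casimir_def br_simps p_simps lin_trace_add lin_trace_scaleR)

text \<open>The adjoint action commutes with brackets and with the projection, so it conjugates the operator
  under the trace.\<close>

lemma casimir_Ad:
  assumes h: "h \<in> K" shows "casimir (Ad G h x) (Ad G h y) = casimir x y"
proof -
  obtain h' where h': "h' \<in> K" "\<And>v. Ad G h (Ad G h' v) = v" "\<And>v. Ad G h' (Ad G h v) = v"
    using Ad_inverse[OF h] by blast
  have "br (Ad G h x) (br (Ad G h y) u) = Ad G h (br x (br y (Ad G h' u)))" for u
    using Ad_bracket[OF h, of y "Ad G h' u"] Ad_bracket[OF h, of x "br y (Ad G h' u)"] h'(2) by simp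
  then have "casimir (Ad G h x) (Ad G h y) = lin_trace (\<lambda>u. Ad G h (pk (br x (br y (Ad G h' u)))))"
    unfolding casimir_def by (simp add: Ad_proj(2)[OF h])
  also have "\<dots> = casimir x y"
    unfolding casimir_def
    by (rule lin_trace_conjugate[OF linear_comp[OF proj_k_linear linear_comp[OF br_linear(1) br_linear(1)]]
         Ad_linear[OF h] Ad_linear[OF h'(1)] h'(3)])
  finally show ?thesis .
qed

text \<open>Schur's lemma for symmetric forms. Let \<open>\<kappa>\<close> be the maximum of the quotient \<open>C(x, x) / g(x, x)\<close>, attained at \<open>x0\<close>.
  The form \<open>D = \<kappa> g - C\<close> is positive semidefinite with a nonzero null vector, so its radical is a
  nonzero invariant subspace and hence all of \<open>\<mm>\<close>.\<close>

lemma casimir_scalar_if_irreducible: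
  assumes irr: "isotropy_irreducible G K"
  shows "\<exists>\<kappa>. \<forall>x\<in>mm. \<forall>y\<in>mm. casimir x y = \<kappa> * g x y"
proof -
  define S where "S = mm \<inter> sphere 0 1"
  define f where "f = (\<lambda>x. casimir x x / g x x)"
  have "compact S"
    unfolding S_def using closed_subspace[OF subspace_m] by (intro closed_Int_compact) auto
  moreover have "S \<noteq> {}"
  proof -
    obtain x where "x \<in> mm" "x \<noteq> 0"
      using irr subspace_0[OF subspace_m] unfolding isotropy_irreducible_def by blast
    then have "(1 / norm x) *\<^sub>R x \<in> S" using subspace_scale[OF subspace_m] by (simp add: S_def)
    then show ?thesis by blast
  qed
  moreover have "continuous_on S f"
  proof -
    have c: "continuous_on S (\<lambda>x. h x x)" if "bilinear h" for h :: "'e \<Rightarrow> 'e \<Rightarrow> real"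
      using that by (intro bounded_bilinear.continuous_on[of h] continuous_on_id) (simp add: bilinear_conv_bounded_bilinear)
    have "g x x \<noteq> 0" if "x \<in> S" for x
    proof -
      have "x \<noteq> 0" using that by (auto simp: S_def)
      then show ?thesis using g_pos[of x] by simp
    qed
    then show ?thesis unfolding f_def by (intro continuous_on_divide c casimir_bilinear g_bilinear) auto
  qed
  ultimately obtain x0 where x0: "x0 \<in> S" "\<And>x. x \<in> S \<Longrightarrow> f x \<le> f x0"
    using continuous_attains_sup by metis
  define \<kappa> where "\<kappa> = f x0"
  define D where "D = (\<lambda>x y. \<kappa> * g x y - casimir x y)"
  note c_linear = bilinear_linear[OF casimir_bilinear]
  note D_simps = D_def g_simps linear_add[OF c_linear(1)] linear_add[OF c_linear(2)]
    linear_cmul[OF c_linear(1)] linear_cmul[OF c_linear(2)] linear_0[OF c_linear(2)]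
  have x0m: "x0 \<in> mm" "x0 \<noteq> 0" using x0(1) by (auto simp: S_def)
  have D0: "D x0 x0 = 0" using g_pos[OF x0m(2)] by (simp add: D_def \<kappa>_def f_def)
  have Dpos: "0 \<le> D x x" if "x \<in> mm" for x
  proof (cases "x = 0")
    case False
    define u where "u = (1 / norm x) *\<^sub>R x"
    have u: "u \<in> S" "x = norm x *\<^sub>R u"
      using that False subspace_scale[OF subspace_m] by (auto simp: u_def S_def)
    have "0 < g u u" using u False by (intro g_pos) auto
    then have "0 \<le> D u u" using x0(2)[OF u(1)] by (simp add: D_def \<kappa>_def f_def divide_le_eq)
    moreover have "D x x = (norm x * norm x) * D u u"
      by (subst (1 2) u(2)) (simp add: D_simps algebra_simps)
    ultimately show ?thesis by simp
  qed (simp add: D_simps)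
  have Dsym: "D x y = D y x" if "x \<in> mm" "y \<in> mm" for x y
    using casimir_sym[OF that] g_sym[of x y] by (simp add: D_def)
  have D1: "D x0 y = 0" if y: "y \<in> mm" for y
  proof (rule ccontr)
    assume ne: "D x0 y \<noteq> 0"
    define q where "q = D y y"
    define d where "d = D x0 y"
    \<comment> \<open>a null vector of a semidefinite form lies in its radical: otherwise this \<open>t\<close>
        would give a negative value\<close>
    define t where "t = - d / (q + 1)"
    have q: "0 \<le> q" using Dpos[OF y] by (simp add: q_def)
    have "x0 + t *\<^sub>R y \<in> mm" using x0m y subspace_m by (intro subspace_add subspace_scale)
    from Dpos[OF this] have "0 \<le> D x0 x0 + t * D x0 y + t * D y x0 + t * t * D y y"
      by (simp add: D_simps algebra_simps)
    then have "0 \<le> 2 * t * d + t * t * q" using D0 Dsym[OF x0m(1) y] by (simp add: d_def q_def)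
    also have "\<dots> = - (d * d) * (q + 2) / ((q + 1) * (q + 1))"
    proof -
      define r where "r = q + 1"
      have r: "q = r - 1" "r \<noteq> 0" using q by (simp_all add: r_def)
      show ?thesis unfolding t_def r(1) using r(2) by (simp add: field_simps)
    qed
    also have "\<dots> < 0"
    proof -
      have "0 < d * d" using ne not_real_square_gt_zero[of d] unfolding d_def by blast
      then show ?thesis using q by (intro divide_neg_pos mult_neg_pos) auto
    qed
    finally show False by simp
  qed
  define V where "V = {x \<in> mm. \<forall>y\<in>mm. D x y = 0}"
  have "subspace V"
    unfolding V_def subspace_def using subspace_m by (auto simp: D_simps subspace_def algebra_simps)
  moreover have "V \<subseteq> mm" by (auto simp: V_def)
  moreover have "Ad G h v \<in> V" if h: "h \<in> K" and v: "v \<in> V" for h v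
  proof -
    obtain h' where h': "h' \<in> K" "\<And>v. Ad G h (Ad G h' v) = v" using Ad_inverse[OF h] by blast
    have "D (Ad G h v) y = 0" if "y \<in> mm" for y
    proof -
      have "D (Ad G h v) (Ad G h (Ad G h' y)) = D v (Ad G h' y)"
        by (simp add: D_def casimir_Ad[OF h] gB_def Ad_killing[OF h] del: h'(2))
      also have "\<dots> = 0" using v Ad_m[OF h'(1) that] by (simp add: V_def)
      finally show ?thesis by (simp add: h'(2))
    qed
    then show ?thesis using v Ad_m[OF h] by (simp add: V_def)
  qed
  ultimately have "V = {0} \<or> V = mm"
    using irr unfolding isotropy_irreducible_def by blast
  moreover have "x0 \<in> V" using x0m D1 by (simp add: V_def)
  ultimately have "V = mm" using x0m by blast
  then have "casimir x y = \<kappa> * g x y" if "x \<in> mm" "y \<in> mm" for x y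
  proof -
    have "x \<in> V" using that \<open>V = mm\<close> by simp
    then have "D x y = 0" using that by (simp add: V_def)
    then show ?thesis by (simp add: D_def)
  qed
  then show ?thesis by blast
qed

end

section \<open>Isotropy irreducible spaces\<close>

lemma nabla_einstein_isotropy_irreducible:
  assumes simple: "simple_lie_group G" and cpt: "compact_space (space_of G)" and K: "subgroup K G"
    and irr: "isotropy_irreducible G K"
  shows "nabla_einstein G K (nomizu_alpha G K \<alpha>)"
proof -
  interpret lie_grp G
    using simple by unfold_locales (simp add: simple_lie_group_def)
  have Kc: "g \<in> carrier G" if "g \<in> K" for g using subgroup.mem_carrier[OF K that] .
  interpret reductive G K
  proof (rule reductive.intro)
    show "bilinear (lie_bracket G)" by (rule bilinear_lie_bracket)
    show "lie_bracket G x y = - lie_bracket G y x" for x y by (rule lie_bracket_skew)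
    show "lie_bracket G x (lie_bracket G y z)
       = lie_bracket G (lie_bracket G x y) z + lie_bracket G y (lie_bracket G x z)" for x y z
      by (rule jacobi)
    show "\<exists>h\<in>K. \<forall>v. Ad G g (Ad G h v) = v \<and> Ad G h (Ad G g v) = v" if "g \<in> K" for g
      using Ad_inv[OF Kc[OF that]] subgroup.m_inv_closed[OF K that] by blast
    show "linear (Ad G g)" if "g \<in> K" for g by (rule linear_Ad[OF Kc[OF that]])
    show "killing G v v < 0" if "v \<noteq> 0" for v by (rule killing_negative[OF simple cpt that])
    show "lie_bracket G (Ad G g v) (Ad G g w) = Ad G g (lie_bracket G v w)" if "g \<in> K" for g v w
      by (rule Ad_bracket[OF Kc[OF that]])
  qed (rule subspace_lie_subalg[OF K] lie_subalg_bracket[OF K] lie_subalg_Ad[OF K]; assumption)+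
  obtain \<kappa> where "\<forall>x\<in>red_compl G K. \<forall>y\<in>red_compl G K. casimir x y = \<kappa> * gB G x y"
    using casimir_scalar_if_irreducible[OF irr] by blast
  then show ?thesis by (intro nabla_einstein_if_casimir_scalar) auto
qed

section \<open>Componentwise calculus and powers of a Lie group\<close>

lemma has_derivative_vec:
  fixes f :: "'q::finite \<Rightarrow> 'a::euclidean_space \<Rightarrow> 'b::euclidean_space"
  assumes "\<And>i. (f i has_derivative f' i) (at x)"
  shows "((\<lambda>y. (\<chi> i. f i y) :: 'b ^ 'q) has_derivative (\<lambda>v. \<chi> i. f' i v)) (at x)"
proof -
  have l: "linear (axis i :: 'b \<Rightarrow> 'b ^ 'q)" for i
    by (rule linearI) (auto simp: axis_def vec_eq_iff)
  have e: "(\<Sum>i\<in>UNIV. (axis i (g i) :: 'b ^ 'q)) = (\<chi> i. g i)" for g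
    by (simp add: vec_eq_iff axis_def if_distrib cong: if_cong)
  have "((\<lambda>y. \<Sum>i\<in>UNIV. (axis i (f i y) :: 'b ^ 'q))
      has_derivative (\<lambda>v. \<Sum>i\<in>UNIV. axis i (f' i v))) (at x)"
    by (intro has_derivative_sum bounded_linear.has_derivative[OF l[unfolded linear_conv_bounded_linear] assms])
  then show ?thesis by (simp add: e)
qed

lemma lin_trace_vec:
  fixes F :: "'f::euclidean_space ^ 'q::finite \<Rightarrow> 'f ^ 'q"
  shows "lin_trace F = (\<Sum>i\<in>UNIV. lin_trace (\<lambda>b. F (axis i b) $ i))"
proof -
  have B: "(Basis :: ('f ^ 'q) set) = (\<lambda>(i, b). axis i b) ` (UNIV \<times> Basis)"
    by (auto simp: Basis_vec_def)
  have inj: "inj_on (\<lambda>(i, b). axis i b :: 'f ^ 'q) (UNIV \<times> Basis)"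
  proof (rule inj_onI, clarsimp)
    fix i j and b c :: 'f assume "b \<in> Basis" "c \<in> Basis" and e: "(axis i b :: 'f ^ 'q) = axis j c"
    then have "b \<noteq> 0" "c \<noteq> 0" by auto
    then show "i = j \<and> b = c" using e by (auto simp: axis_eq_axis)
  qed
  show ?thesis
    unfolding lin_trace_def B sum.reindex[OF inj]
    by (simp add: o_def case_prod_unfold inner_axis sum.cartesian_product)
qed

lemma lie_power_simps:
  "carrier (lie_power H :: ('q::finite \<Rightarrow> 'h, 'f::euclidean_space ^ 'q) lie_data)
      = (\<Pi>\<^sub>E i\<in>UNIV. carrier H)"
  "x \<otimes>\<^bsub>(lie_power H :: ('q::finite \<Rightarrow> 'h, 'f::euclidean_space ^ 'q) lie_data)\<^esub>
      y = (\<lambda>i. x i \<otimes>\<^bsub>H\<^esub> y i)"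
  "\<one>\<^bsub>(lie_power H :: ('q::finite \<Rightarrow> 'h, 'f::euclidean_space ^ 'q) lie_data)\<^esub>
      = (\<lambda>i. \<one>\<^bsub>H\<^esub>)"
  "space_of (lie_power H :: ('q::finite \<Rightarrow> 'h, 'f::euclidean_space ^ 'q) lie_data)
      = product_topology (\<lambda>_. space_of H) UNIV"
  "atlas_of (lie_power H :: ('q::finite \<Rightarrow> 'h, 'f::euclidean_space ^ 'q) lie_data) =
    {(\<Pi>\<^sub>E i\<in>UNIV. fst (c i), \<lambda>x. \<chi> i. snd (c i) (x i)) | c. \<forall>i. c i \<in> atlas_of H}"
  by (simp_all add: lie_power_def monoid.defs lie_data.defs product_group_def fun_eq_iff)

lemma lie_power_carrier:
  "x \<in> carrier (lie_power H :: ('q::finite \<Rightarrow> 'h, 'f::euclidean_space ^ 'q) lie_data)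
      \<longleftrightarrow> (\<forall>i. x i \<in> carrier H)"
  by (auto simp: lie_power_simps PiE_UNIV_domain)

lemma lie_power_group:
  assumes "group H" shows "group (lie_power H :: ('q::finite \<Rightarrow> 'h, 'f::euclidean_space ^ 'q) lie_data)"
proof -
  interpret group H by fact
  show ?thesis
  proof (rule groupI)
    show "\<exists>y\<in>carrier (lie_power H :: ('q \<Rightarrow> 'h, 'f ^ 'q) lie_data).
        y \<otimes>\<^bsub>(lie_power H :: ('q \<Rightarrow> 'h, 'f ^ 'q) lie_data)\<^esub> x = \<one>\<^bsub>(lie_power H :: ('q \<Rightarrow> 'h, 'f ^ 'q) lie_data)\<^esub>"
      if "x \<in> carrier (lie_power H :: ('q \<Rightarrow> 'h, 'f ^ 'q) lie_data)" for x
      using that by (intro bexI[of _ "\<lambda>i. inv\<^bsub>H\<^esub> (x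
          i)"]) (auto simp: lie_power_carrier lie_power_simps(2,3))
  qed (auto simp: lie_power_carrier lie_power_simps(2,3) m_assoc)
qed

lemma lie_quotient_simps:
  "carrier (lie_quotient G N) = rcosets\<^bsub>G\<^esub> N"
  "x \<otimes>\<^bsub>lie_quotient G N\<^esub> y = x <#>\<^bsub>G\<^esub> y"
  "\<one>\<^bsub>lie_quotient G N\<^esub> = N"
  "space_of (lie_quotient G N) = quotient_top (space_of G) (quotient_proj G N)"
  "atlas_of (lie_quotient G N) =
     {(quotient_proj G N ` V, \<phi> \<circ> inv_into V (quotient_proj G N)) | U \<phi> V.
             (U, \<phi>) \<in> atlas_of G \<and> V \<subseteq> U \<and> openin (space_of G) V \<and>
             inj_on (quotient_proj G N) V}"
  by (simp_all add: lie_quotient_def monoid.defs lie_data.defs FactGroup_def)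


lemma lie_bracket_eq_bracket_of:
  "lie_bracket G = bracket_of (\<lambda>x y. crd G (par G x \<otimes>\<^bsub>G\<^esub> par G y)) (unit_crd G)"
  by (simp add: lie_bracket_def[abs_def] bracket_of_def[abs_def] left_inv_field_def[abs_def]
      left_field_def[abs_def])

lemma eventually_componentwise:
  fixes p :: "'b::euclidean_space ^ 'q::finite"
  assumes "\<And>i. \<forall>\<^sub>F y in nhds (p $ i). P i y"
  shows "\<forall>\<^sub>F x in nhds p. \<forall>i. P i (x $ i)"
proof -
  have "\<forall>\<^sub>F x in nhds p. P i (x $ i)" for i
    by (rule eventually_isCont[where f = "\<lambda>x. x $ i" and P = "P i", OF _ assms]) (intro continuous_intros)
  then show ?thesis by (rule eventually_all_finite)
qed

lemma smooth_at_nth: "smooth_at (\<lambda>x. x $ i) (p :: 'b::euclidean_space ^ 'q::finite)"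
  by (rule smooth_at_linear) (rule bounded_linear_vec_nth)

section \<open>Discreteness of the centre\<close>

context lie_grp
begin

text \<open>The derivative of \<open>x \<mapsto> Ad x\<close> at the unit is \<open>ad\<close>, which is injective, so near the unit only the unit acts
  trivially. Injectivity is used in the quantitative form that the sum \<open>N w\<close> of the norms \<open>|[w, b]|\<close> over the
  standard basis is bounded below on the unit sphere.\<close>

lemma Ad_separates:
  assumes simple: "simple_lie_group G"
  shows "\<exists>W. openin X W \<and> \<one> \<in> W \<and> (\<forall>g\<in>W. (\<forall>b. Ad G g b = b)
      \<longrightarrow> g = \<one>)"
proof -
  let ?a = "unit_crd G"
  have l: "linear (\<lambda>u. lie_bracket G u b)" for b using bilinear_lie_bracket by (rule bilinear_linear)
  have l': "linear (lie_bracket G u)" for u using bilinear_lie_bracket by (rule bilinear_linear)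
  define N where "N = (\<lambda>w. \<Sum>b\<in>Basis. norm (lie_bracket G w b))"
  have "continuous_on (sphere 0 1) N"
    unfolding N_def by (intro continuous_on_sum continuous_on_norm linear_continuous_on l[unfolded linear_conv_bounded_linear])
  moreover have "sphere (0 :: 'e) 1 \<noteq> {}"
  proof -
    obtain b :: 'e where "b \<in> Basis" using nonempty_Basis by blast
    then show ?thesis by (intro ex_in_conv[THEN iffD1] exI[of _ b]) simp
  qed
  ultimately obtain w0 where w0: "w0 \<in> sphere 0 1" "\<And>w. w \<in> sphere 0 1 \<Longrightarrow> N w0 \<le> N w"
    using continuous_attains_inf[OF compact_sphere] by metis
  have "0 < N w0"
  proof (rule ccontr)
    assume "\<not> 0 < N w0"
    moreover have "0 \<le> N w0" unfolding N_def by (intro sum_nonneg) auto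
    ultimately have "N w0 = 0" by simp
    then have z: "lie_bracket G w0 b = 0" if "b \<in> Basis" for b
      using that by (simp add: N_def sum_nonneg_eq_0_iff)
    have "lie_bracket G w0 x = 0" for x
      using linear_basis_expansion[OF l', of w0 x] z by simp
    from centre_trivial[OF simple this] show False using w0(1) by simp
  qed
  \<comment> \<open>small enough that the linearisation error of all basis vectors together is at most half of
      the bound \<open>N w0\<close>\<close>
  define \<epsilon> where "\<epsilon> = N w0 / (2 * real DIM('e))"
  have \<epsilon>: "0 < \<epsilon>" using \<open>0 < N w0\<close> by (simp add: \<epsilon>_def)
  have "\<forall>\<^sub>F x in nhds ?a. norm (Ad G (par G x) b - b - lie_bracket G (x - ?a) b)
      \<le> \<epsilon> * norm (x - ?a)" for b
  proof -
    obtain d where "0 < d" "\<And>y. norm (y - ?a) < d \<Longrightarrow>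
        norm (Ad G (par G y) b - Ad G (par G ?a) b - lie_bracket G (y - ?a) b) \<le> \<epsilon> * norm (y - ?a)"
      using Ad_derivative[of b] \<epsilon> unfolding has_derivative_at_alt by blast
    then show ?thesis
      unfolding eventually_nhds_metric dist_norm by (auto simp: par_unit Ad_one)
  qed
  then have "\<forall>\<^sub>F x in nhds ?a. \<forall>b\<in>(Basis :: 'e set). norm (Ad G (par G x) b - b
      - lie_bracket G (x - ?a) b) \<le> \<epsilon> * norm (x - ?a)"
    by (intro eventually_ball_finite finite_Basis ballI)
  then obtain T where T: "open T" "?a \<in> T"
    "\<And>x b. x \<in> T \<Longrightarrow> b \<in> Basis
        \<Longrightarrow> norm (Ad G (par G x) b - b - lie_bracket G (x - ?a) b) \<le> \<epsilon> * norm (x - ?a)"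
    unfolding eventually_nhds by blast
  have sep: "x = ?a" if x: "x \<in> T" and fix_b: "\<And>b. Ad G (par G x) b = b" for x
  proof (rule ccontr)
    assume "x \<noteq> ?a"
    define u where "u = x - ?a"
    have u: "0 < norm u" using \<open>x \<noteq> ?a\<close> by (simp add: u_def)
    have "N u = norm u * N ((1 / norm u) *\<^sub>R u)"
      using u linear_cmul[OF l] by (simp add: N_def sum_distrib_left)
    moreover have "N w0 \<le> N ((1 / norm u) *\<^sub>R u)" using u by (intro w0(2)) simp
    ultimately have "norm u * N w0 \<le> N u" using u by simp
    also have "N u \<le> (\<Sum>b\<in>(Basis :: 'e set). \<epsilon> * norm u)"
      unfolding N_def
    proof (rule sum_mono)
      fix b :: 'e assume "b \<in> Basis"
      from T(3)[OF x this] show "norm (lie_bracket G u b) \<le> \<epsilon> * norm u"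
        by (simp add: fix_b u_def)
    qed
    also have "\<dots> = norm u * N w0 / 2" by (simp add: \<epsilon>_def field_simps)
    finally show False using mult_pos_pos[OF u \<open>0 < N w0\<close>] by linarith
  qed
  obtain W where W: "openin X W" "\<one> \<in> W" "W \<subseteq> unit_dom" "crd G ` W \<subseteq> T"
    using eventually_crd[OF T(1,2)] by blast
  have "g = \<one>" if g: "g \<in> W" and fix_b: "\<And>b. Ad G g b = b" for g
  proof -
    have "crd G g = ?a" using g W par_crd fix_b by (intro sep) auto
    then show ?thesis using g W(3) unit_chart(2) chartD(5)[OF unit_chart(1)] by (meson inj_onD subsetD)
  qed
  then show ?thesis using W(1,2) by blast
qed

lemma centre_Ad:
  assumes z: "z \<in> group_centre G" shows "Ad G z v = v"
proof -
  have zc: "z \<in> carrier G" "\<And>h. h \<in> carrier G \<Longrightarrow> z \<otimes> h = h \<otimes> z"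
      using z by (auto simp: group_centre_def)
  have "\<forall>\<^sub>F y in nhds (unit_crd G). conj_map z y = y"
    using eventually_par_carrier
  proof (rule eventually_mono)
    fix y assume y: "par G y \<in> unit_dom \<and> par G y \<in> carrier G \<and> crd G (par G y) = y"
    then have "z \<otimes> par G y \<otimes> inv z = par G y" using zc by (simp add: m_assoc)
    then show "conj_map z y = y" using y by (simp add: conj_map_def)
  qed
  from frechet_derivative_cong_nhds[OF this] show ?thesis by (simp add: Ad_eq)
qed

text \<open>The neighbourhood is chosen such that quotients of its elements lie in the neighbourhood of
  \<open>Ad_separates\<close>, where the unit is the only central element. This is what makes the projection to the
  quotient by the centre injective on small sets.\<close>

lemma centre_discrete:
  assumes simple: "simple_lie_group G"
  shows "\<exists>W. openin X W \<and> \<one> \<in> W \<and> W \<subseteq> unit_dom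
      \<and> (\<forall>x\<in>W. \<forall>y\<in>W. x \<otimes> inv y \<in> group_centre G \<longrightarrow> x = y)"
proof -
  obtain W where W: "openin X W" "\<one> \<in> W" "\<And>g. g \<in> W \<Longrightarrow> (\<forall>b. Ad G g b
      = b) \<Longrightarrow> g = \<one>"
    using Ad_separates[OF simple] by blast
  have "continuous_map (prod_topology X X) (prod_topology X X) (\<lambda>P. (fst P, inv (snd P)))"
    using continuous_map_compose[OF continuous_map_snd continuous_inv]
    by (intro continuous_map_pairedI continuous_map_fst) (simp add: o_def)
  from continuous_map_compose[OF this continuous_mult]
  have "continuous_map (prod_topology X X) X (\<lambda>P. fst P \<otimes> inv (snd P))" by (simp add: o_def)
  then have op: "openin (prod_topology X X) {P \<in> topspace (prod_topology X X). fst P \<otimes> inv (snd P) \<in> W}"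
    using W(1) by (rule openin_continuous_map_preimage)
  have mem: "(\<one>, \<one>) \<in> {P \<in> topspace (prod_topology X X). fst P \<otimes> inv (snd P) \<in> W}"
    using W(2) by (simp add: topspace_X)
  obtain A B where AB: "openin X A" "openin X B" "\<one> \<in> A" "\<one> \<in> B"
      "A \<times> B \<subseteq> {P \<in> topspace (prod_topology X X). fst P \<otimes> inv (snd P) \<in> W}"
    using op[unfolded openin_prod_topology_alt, rule_format, OF mem] by (elim exE conjE)
  have "x = y" if x: "x \<in> A" and y: "y \<in> B" and c: "x \<otimes> inv y \<in> group_centre G" for x y
  proof -
    have "x \<otimes> inv y \<in> W" using subsetD[OF AB(5), of "(x, y)"] x y by simp
    then have "x \<otimes> inv y = \<one>" using W(3) centre_Ad[OF c] by blast
    moreover have "x \<in> carrier G" "y \<in> carrier G"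
      using openin_subset[OF AB(1)] openin_subset[OF AB(2)] x y by (auto simp: topspace_X)
    ultimately show ?thesis using inv_equality by (metis inv_inv inv_closed)
  qed
  then show ?thesis
    using AB(1-4) chartD(1)[OF unit_chart(1)] unit_chart(2)
    by (intro exI[of _ "A \<inter> B \<inter> unit_dom"]) (auto intro!: openin_Int)
qed

end

section \<open>The quotient of a power by the diagonal centre\<close>

text \<open>The type argument \<open>q\<close> fixes the index type of the power.\<close>

locale simple_power =
  fixes H :: "('h, 'f::euclidean_space) lie_data" (structure) and q :: "'q::finite itself"
  assumes simple: "simple_lie_group H" and cpt: "compact_space (space_of H)"

sublocale simple_power \<subseteq> H: lie_grp H
  using simple by unfold_locales (simp add: simple_lie_group_def)

context simple_power
begin

abbreviation HQ :: "('q \<Rightarrow> 'h, 'f ^ 'q) lie_data" where "HQ \<equiv> lie_power H"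
abbreviation Z where "Z \<equiv> group_centre H"
abbreviation N :: "('q \<Rightarrow> 'h) set" where "N \<equiv> diag Z"
abbreviation G' where "G' \<equiv> lie_quotient HQ N"
abbreviation proj where "proj \<equiv> quotient_proj HQ N"

lemma HQ_group: "group HQ" by (rule lie_power_group[OF H.is_group])

lemmas HQ_simps = lie_power_simps(2,3)[where H = H and ?'q = 'q]

lemma HQ_carrier: "x \<in> carrier HQ \<longleftrightarrow> (\<forall>i. x i \<in> carrier H)"
  by (rule lie_power_carrier)

lemma HQ_inv: assumes "x \<in> carrier HQ" shows "inv\<^bsub>HQ\<^esub> x = (\<lambda>i. inv (x i))"
  by (rule group.inv_equality[OF HQ_group]) (use assms in \<open>auto simp: HQ_carrier HQ_simps\<close>)

lemma centreD: "z \<in> Z \<Longrightarrow> z \<in> carrier H" "z \<in> Z \<Longrightarrow> h \<in> carrier H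
    \<Longrightarrow> z \<otimes> h = h \<otimes> z"
  by (auto simp: group_centre_def)

lemma centre_subgroup: "subgroup Z H"
proof
  show "Z \<subseteq> carrier H" using centreD by blast
  show "x \<otimes> y \<in> Z" if "x \<in> Z" "y \<in> Z" for x y
  proof -
    have xy: "x \<in> carrier H" "y \<in> carrier H" using that centreD by blast+
    have "x \<otimes> y \<otimes> h = h \<otimes> (x \<otimes> y)" if h: "h \<in> carrier H" for h
    proof -
      have "x \<otimes> y \<otimes> h = x \<otimes> (h \<otimes> y)"
        using xy h centreD(2)[OF \<open>y \<in> Z\<close> h] by (simp add: H.m_assoc)
      also have "\<dots> = (h \<otimes> x) \<otimes> y"
        using xy h centreD(2)[OF \<open>x \<in> Z\<close> h] by (simp add: H.m_assoc[symmetric])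
      finally show ?thesis using xy h by (simp add: H.m_assoc)
    qed
    then show ?thesis using xy by (simp add: group_centre_def)
  qed
  show "\<one> \<in> Z" by (auto simp: group_centre_def)
  show "inv x \<in> Z" if x: "x \<in> Z" for x
  proof -
    have xc: "x \<in> carrier H" using centreD x by blast
    have "inv x \<otimes> h = h \<otimes> inv x" if h: "h \<in> carrier H" for h
    proof -
      have "inv (x \<otimes> inv h) = inv (inv h \<otimes> x)"
        using centreD(2)[OF x, of "inv h"] h by simp
      then show ?thesis using xc h by (simp add: H.inv_mult_group)
    qed
    then show ?thesis using xc by (simp add: group_centre_def)
  qed
qed

lemma diag_mem: "(\<lambda>_. s) \<in> diag S \<longleftrightarrow> s \<in> S"
  by (auto simp: diag_def fun_eq_iff)

lemma N_iff: "n \<in> N \<longleftrightarrow> (\<exists>z\<in>Z. n = (\<lambda>_. z))" by (auto simp: diag_def)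

lemma N_subgroup: "subgroup N HQ"
proof
  show "N \<subseteq> carrier HQ" using centreD by (auto simp: N_iff HQ_carrier)
  show "x \<otimes>\<^bsub>HQ\<^esub> y \<in> N" if "x \<in> N" "y \<in> N" for x y
    using that subgroup.m_closed[OF centre_subgroup] by (auto simp: N_iff HQ_simps)
  show "\<one>\<^bsub>HQ\<^esub> \<in> N" using subgroup.one_closed[OF centre_subgroup] by (auto simp: N_iff HQ_simps)
  show "inv\<^bsub>HQ\<^esub> x \<in> N" if "x \<in> N" for x
    using that subgroup.m_inv_closed[OF centre_subgroup] centreD by (auto simp: N_iff HQ_inv HQ_carrier)
qed

lemma N_normal: "normal N HQ"
proof (rule group.normalI[OF HQ_group N_subgroup], intro ballI)
  fix x assume "x \<in> carrier HQ"
  then have "n \<otimes>\<^bsub>HQ\<^esub> x = x \<otimes>\<^bsub>HQ\<^esub> n" if n: "n \<in> N" for n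
  proof -
    obtain z where "z \<in> Z" "n = (\<lambda>_. z)" using N_iff[THEN iffD1, OF n] by blast
    then show ?thesis using \<open>x \<in> carrier HQ\<close> centreD(2)[of z] by (simp add: HQ_simps HQ_carrier)
  qed
  then show "N #>\<^bsub>HQ\<^esub> x = x <#\<^bsub>HQ\<^esub> N" by (simp add: r_coset_def l_coset_def)
qed

lemma proj_eq_iff:
  assumes x: "x \<in> carrier HQ" and y: "y \<in> carrier HQ"
  shows "proj x = proj y \<longleftrightarrow> (\<exists>n\<in>Z. x = (\<lambda>i. n \<otimes> y i))"
proof
  assume "proj x = proj y"
  moreover have "x \<in> N #>\<^bsub>HQ\<^esub> x" by (rule group.rcos_self[OF HQ_group x N_subgroup])
  ultimately have "x \<in> N #>\<^bsub>HQ\<^esub> y" by (simp add: quotient_proj_def)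
  then show "\<exists>n\<in>Z. x = (\<lambda>i. n \<otimes> y i)" by (auto simp: r_coset_def N_iff HQ_simps)
next
  assume "\<exists>n\<in>Z. x = (\<lambda>i. n \<otimes> y i)"
  then obtain n where n: "n \<in> Z" "x = (\<lambda>i. n \<otimes> y i)" by blast
  then have "(\<lambda>_. n) \<in> N" "x = (\<lambda>_. n) \<otimes>\<^bsub>HQ\<^esub> y"
      by (simp_all add: diag_mem HQ_simps)
  then have "x \<in> N #>\<^bsub>HQ\<^esub> y" unfolding r_coset_def by blast
  from group.repr_independence[OF HQ_group this y N_subgroup]
  show "proj x = proj y" by (simp add: quotient_proj_def)
qed

lemma proj_mult: "x \<in> carrier HQ \<Longrightarrow> y \<in> carrier HQ
    \<Longrightarrow> proj x \<otimes>\<^bsub>G'\<^esub> proj y = proj (\<lambda>i. x i \<otimes> y i)"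
  using normal.rcos_sum[OF N_normal] by (simp add: quotient_proj_def lie_quotient_simps HQ_simps)

lemma proj_one: "proj (\<lambda>i. \<one>) = \<one>\<^bsub>G'\<^esub>"
  using group.coset_mult_one[OF HQ_group subgroup.subset[OF N_subgroup]]
  by (simp add: quotient_proj_def lie_quotient_simps HQ_simps)

lemma proj_inv: assumes "x \<in> carrier HQ" shows "inv\<^bsub>G'\<^esub> (proj x) = proj (\<lambda>i. inv (x i))"
proof -
  have "inv\<^bsub>G'\<^esub> (proj x) = inv\<^bsub>HQ Mod N\<^esub> (proj x)"
    by (simp add: m_inv_def lie_quotient_simps FactGroup_def)
  also have "\<dots> = set_inv\<^bsub>HQ\<^esub> (N #>\<^bsub>HQ\<^esub> x)"
    unfolding quotient_proj_def
    by (rule normal.inv_FactGroup[OF N_normal])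
      (use assms in \<open>auto simp: FactGroup_def intro: group.rcosetsI[OF HQ_group subgroup.subset[OF N_subgroup]]\<close>)
  also have "\<dots> = N #>\<^bsub>HQ\<^esub> inv\<^bsub>HQ\<^esub> x" by (rule normal.rcos_inv[OF N_normal assms])
  finally show ?thesis by (simp add: quotient_proj_def HQ_inv[OF assms])
qed

abbreviation XQ where "XQ \<equiv> space_of HQ"

lemma XQ_eq: "XQ = product_topology (\<lambda>_. space_of H) UNIV"
  by (simp add: lie_power_simps)

lemma topspace_XQ: "topspace XQ = carrier HQ"
  by (auto simp: XQ_eq H.topspace_X lie_power_simps)

lemma XQ_conjugate:
  assumes g: "g \<in> carrier HQ" and h: "h \<in> carrier HQ"
  shows "continuous_map XQ XQ (\<lambda>x i. g i \<otimes> x i \<otimes> h i)"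
  unfolding XQ_eq continuous_map_componentwise_UNIV
proof
  fix i
  have "continuous_map (space_of H) (space_of H) (\<lambda>x. g i \<otimes> x \<otimes> h i)"
    using continuous_map_compose[OF H.continuous_left H.continuous_right, of "g i" "h i"] g h
    by (simp add: o_def HQ_carrier)
  from continuous_map_compose[OF continuous_map_product_projection[of i UNIV "\<lambda>_. space_of H"] this]
  show "continuous_map (product_topology (\<lambda>_. space_of H) UNIV) (space_of H) (\<lambda>x. g i \<otimes>
      x i \<otimes> h i)"
    by (simp add: o_def)
qed

lemma XQ_left:
  assumes g: "g \<in> carrier HQ" shows "continuous_map XQ XQ (\<lambda>x i. g i \<otimes> x i)"
proof -
  have 1: "(\<lambda>_. \<one>) \<in> carrier HQ" by (simp add: HQ_carrier)
  show ?thesis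
    by (rule continuous_map_eq[OF XQ_conjugate[OF g 1]]) (use g in \<open>simp add: topspace_XQ HQ_carrier\<close>)
qed

text \<open>A product of small neighbourhoods of the unit, on which the projection is injective by discreteness of
  the centre, pushes down to a chart.\<close>

lemma chart_at_unit_exists: "\<exists>c. c \<in> atlas_of G' \<and> \<one>\<^bsub>G'\<^esub> \<in> fst c"
proof -
  obtain W where W: "openin (space_of H) W" "\<one> \<in> W" "W \<subseteq> H.unit_dom"
     "\<forall>x\<in>W. \<forall>y\<in>W. x \<otimes> inv y \<in> Z \<longrightarrow> x = y"
    using H.centre_discrete[OF simple] by (elim exE conjE)
  have Wc: "W \<subseteq> carrier H" using openin_subset[OF W(1)] H.topspace_X by simp
  define V where "V = (\<Pi>\<^sub>E i\<in>(UNIV :: 'q set). W)"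
  define U where "U = (\<Pi>\<^sub>E i\<in>(UNIV :: 'q set). H.unit_dom)"
  define \<phi> where "\<phi> = (\<lambda>x. \<chi> i. crd H (x (i :: 'q)))"
  have "(U, \<phi>) \<in> atlas_of HQ"
    unfolding lie_power_simps U_def \<phi>_def using H.unit_chart
    by (intro CollectI exI[of _ "\<lambda>_. (H.unit_dom, crd H)"]) simp
  moreover have "V \<subseteq> U" unfolding V_def U_def using W(3) by (intro PiE_mono) auto
  moreover have "openin XQ V" unfolding V_def XQ_eq using W(1) by (simp add: openin_PiE)
  moreover have "inj_on proj V"
  proof (rule inj_onI)
    fix x y assume x: "x \<in> V" and y: "y \<in> V" and e: "proj x = proj y"
    have xy: "x i \<in> W" "y i \<in> W" for i using x y by (auto simp: V_def PiE_iff)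
    then have "x \<in> carrier HQ" "y \<in> carrier HQ" using Wc by (auto simp: HQ_carrier)
    then obtain n where n: "n \<in> Z" "x = (\<lambda>i. n \<otimes> y i)" using proj_eq_iff e by blast
    show "x = y"
    proof
      fix i
      have "x i \<otimes> inv (y i) = n" using n centreD(1) xy(2)[of i] Wc by (auto simp: H.m_assoc subset_iff)
      then show "x i = y i" using W(4)[rule_format, OF xy] n(1) by simp
    qed
  qed
  ultimately have "(proj ` V, \<phi> \<circ> inv_into V proj) \<in> atlas_of G'"
    unfolding lie_quotient_simps by blast
  moreover have "\<one>\<^bsub>G'\<^esub> \<in> proj ` V"
    using W(2) by (intro image_eqI[where x = "\<lambda>_. \<one>"]) (simp_all add: V_def PiE_iff proj_one)
  ultimately show ?thesis by fastforce
qed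

text \<open>The chosen unit chart of the quotient comes from a product chart of the power restricted to some
  \<open>V\<close> on which the projection is injective. It need not contain the unit of the power: the unit coset is
  represented in \<open>V\<close> by a diagonal central element \<open>z0\<close>, and \<open>V\<close> is to be read as a translate by \<open>z0\<close>.\<close>

lemma unit_chart_form:
  "\<exists>c V z0. (\<forall>i. c i \<in> atlas_of H)
      \<and> V \<subseteq> (\<Pi>\<^sub>E i\<in>UNIV. fst (c i)) \<and> openin XQ V \<and> inj_on proj V \<and>
     z0 \<in> Z \<and> (\<lambda>_. z0) \<in> V \<and> unit_chart G' = (proj ` V, (\<lambda>x. \<chi> i. snd (c i) (x i)) \<circ> inv_into V proj)"
proof -
  have "unit_chart G' \<in> atlas_of G'" "\<one>\<^bsub>G'\<^esub> \<in> fst (unit_chart G')"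
    using someI_ex[OF chart_at_unit_exists] unfolding unit_chart_def by blast+
  then obtain U \<phi> V where U: "unit_chart G'
      = (proj ` V, \<phi> \<circ> inv_into V proj)" "(U, \<phi>) \<in> atlas_of HQ"
     "V \<subseteq> U" "openin XQ V" "inj_on proj V" "\<one>\<^bsub>G'\<^esub> \<in> proj ` V"
    unfolding lie_quotient_simps(5) by auto
  obtain c where c: "U = (\<Pi>\<^sub>E i\<in>UNIV. fst (c i))" "\<phi>
      = (\<lambda>x. \<chi> i. snd (c i) (x i))" "\<forall>i. c i \<in> atlas_of H"
    using U(2) unfolding lie_power_simps by blast
  obtain v where v: "v \<in> V" "proj v = \<one>\<^bsub>G'\<^esub>" using U(6) by (metis imageE)
  have "v \<in> carrier HQ" using v(1) openin_subset[OF U(4)] topspace_XQ by blast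
  then obtain z0 where "z0 \<in> Z" "v = (\<lambda>i. z0 \<otimes> \<one>)"
    using proj_eq_iff[of v "\<lambda>_. \<one>"] v(2) proj_one by (auto simp: HQ_carrier)
  then have "z0 \<in> Z" "v = (\<lambda>_. z0)" using centreD by auto
  then show ?thesis using U v c by blast
qed

end

lemma eventually_nhds_fst:
  assumes "\<forall>\<^sub>F x in nhds a. P x" shows "\<forall>\<^sub>F p in nhds (a, b). P (fst p)"
  unfolding nhds_prod by (rule eventually_mono[OF eventually_prodI[OF assms eventually_True]]) blast

lemma eventually_nhds_snd:
  assumes "\<forall>\<^sub>F x in nhds b. P x" shows "\<forall>\<^sub>F p in nhds (a, b). P (snd p)"
  unfolding nhds_prod by (rule eventually_mono[OF eventually_prodI[OF eventually_True assms]]) blast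

section \<open>The unit chart of the quotient\<close>

text \<open>The data of \<open>unit_chart_form\<close>.\<close>

locale power_chart = simple_power H q
  for H :: "('h, 'f::euclidean_space) lie_data" (structure) and q :: "'q::finite itself" +
  fixes c :: "'q \<Rightarrow> ('h, 'f) chart" and V :: "('q \<Rightarrow> 'h) set" and z0 :: 'h
  assumes c: "\<And>i. c i \<in> atlas_of H" and V_sub: "V \<subseteq> (\<Pi>\<^sub>E i\<in>UNIV. fst (c i))"
    and V_open: "openin (space_of (lie_power H :: ('q \<Rightarrow> 'h, 'f ^ 'q) lie_data)) V"
    and V_inj: "inj_on (quotient_proj (lie_power H :: ('q \<Rightarrow> 'h, 'f ^ 'q) lie_data) (diag (group_centre H))) V"
    and z0: "z0 \<in> group_centre H" "(\<lambda>_. z0) \<in> V"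
    and unit_chart: "unit_chart (lie_quotient (lie_power H :: ('q \<Rightarrow> 'h, 'f ^ 'q) lie_data) (diag
        (group_centre H)))
      = (quotient_proj (lie_power H :: ('q \<Rightarrow> 'h, 'f ^ 'q) lie_data) (diag (group_centre H)) ` V,
         (\<lambda>x. \<chi> i. snd (c i) (x i)) \<circ> inv_into V (quotient_proj (lie_power H :: ('q \<Rightarrow> 'h, 'f ^ 'q) lie_data) (diag (group_centre H))))"
begin

text \<open>The product chart on \<open>V\<close>, with components the charts \<open>chart_map i\<close> on \<open>chart_dom i\<close>.\<close>

definition \<phi> :: "('q \<Rightarrow> 'h) \<Rightarrow> 'f ^ 'q" where "\<phi> x = (\<chi> i. snd (c i) (x i))"
definition chart_dom :: "'q \<Rightarrow> 'h set" where "chart_dom i = fst (c i)"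
definition chart_map :: "'q \<Rightarrow> 'h \<Rightarrow> 'f" where "chart_map i = snd (c i)"

lemma chart: "(chart_dom i, chart_map i) \<in> atlas_of H" using c by (simp add: chart_dom_def chart_map_def)

lemma phi_nth: "\<phi> x $ i = chart_map i (x i)" by (simp add: \<phi>_def chart_map_def)

lemma V_chart_dom: "v \<in> V \<Longrightarrow> v i \<in> chart_dom i" using V_sub by (auto simp: chart_dom_def PiE_iff)

lemma V_carrier: "v \<in> V \<Longrightarrow> v \<in> carrier HQ"
  using openin_subset[OF V_open] topspace_XQ by blast

lemma phi_inj: "inj_on \<phi> V"
proof (rule inj_onI)
  fix v w assume vw: "v \<in> V" "w \<in> V" and e: "\<phi> v = \<phi> w"
  show "v = w"
  proof
    fix i
    have "chart_map i (v i) = chart_map i (w i)" using e phi_nth by metis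
    then show "v i = w i" using H.chartD(5)[OF chart] V_chart_dom vw by (meson inj_onD)
  qed
qed

lemma crd_proj: "v \<in> V \<Longrightarrow> crd G' (proj v) = \<phi> v"
  by (simp add: crd_def unit_chart inv_into_f_f[OF V_inj] \<phi>_def)

lemma par_phi: assumes v: "v \<in> V" shows "par G' (\<phi> v) = proj v"
proof -
  have "inj_on (crd G') (proj ` V)"
    using phi_inj by (auto simp: inj_on_def crd_proj)
  from inv_into_f_f[OF this, of "proj v"] v
  show ?thesis by (simp add: par_def unit_chart crd_proj)
qed

lemma z0_carrier: "z0 \<in> carrier H" using centreD z0 by blast

lemma z0_chart_dom: "z0 \<in> chart_dom i" using V_chart_dom[OF z0(2)] by simp

text \<open>The set \<open>V\<close> translated back to the unit.\<close>

definition unit_nbhd :: "('q \<Rightarrow> 'h) set" where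
  "unit_nbhd = {h \<in> carrier HQ. (\<lambda>i. z0 \<otimes> h i) \<in> V}"

lemma unit_nbhd_open: "openin XQ unit_nbhd"
proof -
  have "(\<lambda>_. z0) \<in> carrier HQ" using z0_carrier by (simp add: HQ_carrier)
  from openin_continuous_map_preimage[OF XQ_left[OF this] V_open]
  show ?thesis by (simp add: unit_nbhd_def topspace_XQ)
qed

lemma unit_nbhd_one: "(\<lambda>_. \<one>) \<in> unit_nbhd"
  using z0 z0_carrier by (simp add: unit_nbhd_def HQ_carrier)

lemma proj_shift: assumes "h \<in> carrier HQ" shows "proj (\<lambda>i. z0 \<otimes> h i) = proj h"
proof -
  have "(\<lambda>i. z0 \<otimes> h i) \<in> carrier HQ" using assms z0_carrier by (simp add: HQ_carrier)
  then show ?thesis using proj_eq_iff[OF _ assms] z0(1) by blast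
qed

lemma crd_unit_nbhd: assumes "h \<in> unit_nbhd" shows "crd G' (proj h) = \<phi> (\<lambda>i. z0 \<otimes> h i)"
  using crd_proj[of "\<lambda>i. z0 \<otimes> h i"] proj_shift[of h] assms by (simp add: unit_nbhd_def)

lemma par_unit_nbhd: assumes "h \<in> unit_nbhd" shows "par G' (\<phi> (\<lambda>i. z0 \<otimes> h i)) = proj h"
  using par_phi[of "\<lambda>i. z0 \<otimes> h i"] proj_shift[of h] assms by (simp add: unit_nbhd_def)

definition unit_pt :: "'f ^ 'q" where "unit_pt = (\<chi> i. unit_crd H)"
definition comp_par :: "'f ^ 'q \<Rightarrow> 'q \<Rightarrow> 'h" where "comp_par x = (\<lambda>i. par H (x $ i))"
definition in_unit_chart :: "'f ^ 'q \<Rightarrow> bool" where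
  "in_unit_chart x \<longleftrightarrow> (\<forall>i. par H (x $ i) \<in> H.unit_dom
      \<and> par H (x $ i) \<in> carrier H \<and> crd H (par H (x $ i)) = x $ i)"

text \<open>The maps \<open>\<Phi>\<close> and \<open>\<Psi>\<close> are mutually inverse changes of coordinates, near the unit, between the
  power of the unit chart of \<open>H\<close> and the unit chart of the quotient: apply the parametrisation,
  translate by \<open>z0\<close>, and apply the chart of the quotient.\<close>

definition \<Phi> :: "'f ^ 'q \<Rightarrow> 'f ^ 'q" where "\<Phi> x = \<phi> (\<lambda>i. z0 \<otimes> par H (x $ i))"
definition \<Psi> :: "'f ^ 'q \<Rightarrow> 'f ^ 'q" where
  "\<Psi> y = (\<chi> i. crd H (inv z0 \<otimes> inv_into (chart_dom i) (chart_map i) (y $ i)))"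
definition comp_mult :: "'f ^ 'q \<Rightarrow> 'f ^ 'q \<Rightarrow> 'f ^ 'q"
    where "comp_mult x y = (\<chi> i. H.crd_mult (x $ i) (y $ i))"

lemma Phi_unit: "\<Phi> unit_pt = \<phi> (\<lambda>_. z0)"
  using z0_carrier by (simp add: \<Phi>_def unit_pt_def H.par_unit)

lemma unit_crd_G': "unit_crd G' = \<Phi> unit_pt"
  using crd_unit_nbhd[OF unit_nbhd_one] z0_carrier by (simp add: proj_one Phi_unit)

lemma eventually_comp_par:
  assumes W: "openin XQ W" "(\<lambda>_. \<one>) \<in> W"
  shows "\<forall>\<^sub>F x in nhds unit_pt. comp_par x \<in> W \<and> in_unit_chart x"
proof -
  obtain A where A: "\<And>i. openin (space_of H) (A i)" "\<And>i. \<one>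
      \<in> A i" "(\<Pi>\<^sub>E i\<in>UNIV. A i) \<subseteq> W"
    using product_topology_open_contains_basis[OF W[unfolded XQ_eq]] by (auto simp: PiE_iff)
  have "\<forall>\<^sub>F x in nhds unit_pt. \<forall>i. par H (x $ i) \<in> H.unit_dom
      \<and> par H (x $ i) \<in> A i \<and> par H (x $ i) \<in> carrier H \<and> crd H (par H (x $ i)) = x $ i"
  proof (rule eventually_componentwise[where P = "\<lambda>i y. par H y \<in> H.unit_dom
      \<and> par H y \<in> A i \<and> par H y \<in> carrier H \<and> crd H (par H y) = y"])
    fix i
    show "\<forall>\<^sub>F y in nhds (unit_pt $ i). par H y \<in> H.unit_dom \<and> par H y \<in> A i
        \<and> par H y \<in> carrier H \<and> crd H (par H y) = y"
      unfolding unit_pt_def using H.eventually_par[OF A(1,2)] by simp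
  qed
  then show ?thesis
  proof (rule eventually_mono)
    fix x assume x: "\<forall>i. par H (x $ i) \<in> H.unit_dom \<and> par H (x $ i) \<in> A i
        \<and> par H (x $ i) \<in> carrier H \<and> crd H (par H (x $ i)) = x $ i"
    then have "comp_par x \<in> (\<Pi>\<^sub>E i\<in>UNIV. A i)" by (simp add: comp_par_def PiE_iff)
    then show "comp_par x \<in> W \<and> in_unit_chart x"
      using A(3) x unfolding in_unit_chart_def by blast
  qed
qed

lemmas eventually_comp_par_unit_nbhd = eventually_comp_par[OF unit_nbhd_open unit_nbhd_one]

lemma Phi_smooth: "smooth_at \<Phi> unit_pt"
  unfolding \<Phi>_def[abs_def] \<phi>_def chart_map_def[symmetric]
proof (rule smooth_at_vec)
  fix i
  have "smooth_at (\<lambda>y. chart_map i (z0 \<otimes> par H y)) (unit_pt $ i)"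
    unfolding unit_pt_def H.par_eq
    using H.left_mult_smooth_at[OF H.unit_chart(1) chart z0_carrier H.unit_chart(2)] z0_chart_dom z0_carrier by simp
  then show "smooth_at (\<lambda>x. chart_map i (z0 \<otimes> par H (x $ i))) unit_pt"
    by (rule smooth_at_compose[OF smooth_at_nth])
qed

lemma Psi_smooth: "smooth_at \<Psi> (\<Phi> unit_pt)"
  unfolding \<Psi>_def[abs_def]
proof (rule smooth_at_vec)
  fix i
  have "smooth_at (\<lambda>y. crd H (inv z0 \<otimes> inv_into (chart_dom i) (chart_map i) y)) (\<Phi> unit_pt $ i)"
    unfolding Phi_unit phi_nth
    using H.left_mult_smooth_at[OF chart H.unit_chart(1) H.inv_closed[OF z0_carrier] z0_chart_dom] z0_carrier H.unit_chart(2)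
    by simp
  then show "smooth_at (\<lambda>x. crd H (inv z0 \<otimes> inv_into (chart_dom i) (chart_map i) (x $ i))) (\<Phi> unit_pt)"
    by (rule smooth_at_compose[OF smooth_at_nth])
qed

lemma Psi_phi:
  assumes "v \<in> V" shows "\<Psi> (\<phi> v) = (\<chi> i. crd H (inv z0 \<otimes> v i))"
  using inv_into_f_f[OF H.chartD(5)[OF chart] V_chart_dom[OF assms]] by (simp add: \<Psi>_def phi_nth)

lemma Psi_Phi: "\<forall>\<^sub>F x in nhds unit_pt. \<Psi> (\<Phi> x) = x"
  using eventually_comp_par_unit_nbhd
proof (rule eventually_mono)
  fix x assume x: "comp_par x \<in> unit_nbhd \<and> in_unit_chart x"
  then have "(\<lambda>i. z0 \<otimes> par H (x $ i)) \<in> V" by (simp add: unit_nbhd_def comp_par_def)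
  from Psi_phi[OF this] show "\<Psi> (\<Phi> x) = x"
    using x z0_carrier by (simp add: in_unit_chart_def \<Phi>_def vec_eq_iff H.m_assoc[symmetric])
qed

lemma Psi_Phi_unit: "\<Psi> (\<Phi> unit_pt) = unit_pt"
  using eventually_nhds_x_imp_x[OF Psi_Phi] .

lemma Phi_Psi: "\<forall>\<^sub>F y in nhds (\<Phi> unit_pt). \<Phi> (\<Psi> y) = y"
proof -
  have "\<forall>\<^sub>F y in nhds (\<Phi> unit_pt). \<forall>i. y $ i \<in> chart_map i ` chart_dom i
      \<and> inv_into (chart_dom i) (chart_map i) (y $ i) \<in> {x \<in> carrier H. inv z0 \<otimes> x \<in> H.unit_dom}"
  proof (rule eventually_componentwise[where P = "\<lambda>i y. y \<in> chart_map i ` chart_dom i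
      \<and> inv_into (chart_dom i) (chart_map i) y \<in> {x \<in> carrier H. inv z0 \<otimes> x \<in> H.unit_dom}"])
    fix i
    have o: "openin (space_of H) {x \<in> carrier H. inv z0 \<otimes> x \<in> H.unit_dom}"
      using openin_continuous_map_preimage[OF H.continuous_left[OF H.inv_closed[OF z0_carrier]] H.chartD(1)[OF H.unit_chart(1)]]
      by (simp add: H.topspace_X)
    have m: "z0 \<in> {x \<in> carrier H. inv z0 \<otimes> x \<in> H.unit_dom}"
      using z0_carrier H.unit_chart(2) by simp
    show "\<forall>\<^sub>F y in nhds (\<Phi> unit_pt $ i). y \<in> chart_map i ` chart_dom i
        \<and> inv_into (chart_dom i) (chart_map i) y \<in> {x \<in> carrier H. inv z0 \<otimes> x \<in> H.unit_dom}"
      unfolding Phi_unit phi_nth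
      using H.eventually_chart[OF chart o z0_chart_dom m] by (rule eventually_mono) blast
  qed
  then show ?thesis
  proof (rule eventually_mono)
    fix y assume y: "\<forall>i. y $ i \<in> chart_map i ` chart_dom i
        \<and> inv_into (chart_dom i) (chart_map i) (y $ i) \<in> {x \<in> carrier H. inv z0 \<otimes> x \<in> H.unit_dom}"
    have "z0 \<otimes> par H (\<Psi> y $ i) = inv_into (chart_dom i) (chart_map i) (y $ i)" for i
      using y z0_carrier by (simp add: \<Psi>_def H.par_crd H.m_assoc[symmetric])
    then show "\<Phi> (\<Psi> y) = y"
      using y by (simp add: \<Phi>_def vec_eq_iff phi_nth f_inv_into_f)
  qed
qed

text \<open>The derivatives of \<open>\<Phi>\<close> and \<open>\<Psi>\<close> at corresponding points, hence inverse to each other.\<close>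

definition L :: "'f ^ 'q \<Rightarrow> 'f ^ 'q" where "L = frechet_derivative \<Phi> (at unit_pt)"
definition L' :: "'f ^ 'q \<Rightarrow> 'f ^ 'q" where "L' = frechet_derivative \<Psi> (at (\<Phi> unit_pt))"

lemma L_derivative: "(\<Phi> has_derivative L) (at unit_pt)"
  unfolding L_def by (rule smooth_at_has_derivative[OF Phi_smooth])

lemma L'_derivative: "(\<Psi> has_derivative L') (at (\<Phi> unit_pt))"
  unfolding L'_def by (rule smooth_at_has_derivative[OF Psi_smooth])

lemma L_linear: "linear L" and L'_linear: "linear L'"
  using L_derivative L'_derivative has_derivative_linear by blast+

lemma L'_L: "L' (L v) = v"
proof -
  have "((\<lambda>x. \<Psi> (\<Phi> x)) has_derivative (\<lambda>v. L' (L v))) (at unit_pt)"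
    by (rule has_derivative_compose[OF L_derivative L'_derivative])
  then have "((\<lambda>x. x) has_derivative (\<lambda>v. L' (L v))) (at unit_pt)"
    by (subst (asm) has_derivative_cong_nhds[OF Psi_Phi])
  from has_derivative_unique[OF this has_derivative_ident] show ?thesis by (rule fun_cong)
qed

lemma L_L': "L (L' v) = v"
proof -
  have "(\<Phi> has_derivative L) (at (\<Psi> (\<Phi> unit_pt)))" using L_derivative by (simp add: Psi_Phi_unit)
  from has_derivative_compose[OF L'_derivative this]
  have "((\<lambda>y. \<Phi> (\<Psi> y)) has_derivative (\<lambda>v. L (L' v))) (at (\<Phi> unit_pt))" .
  then have "((\<lambda>x. x) has_derivative (\<lambda>v. L (L' v))) (at (\<Phi> unit_pt))"
    by (subst (asm) has_derivative_cong_nhds[OF Phi_Psi])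
  from has_derivative_unique[OF this has_derivative_ident] show ?thesis by (rule fun_cong)
qed

lemma comp_mult_smooth: "smooth_at (\<lambda>(x, y). comp_mult x y) (unit_pt, unit_pt)"
proof -
  have "smooth_at (\<lambda>P. comp_mult (fst P) (snd P)) (unit_pt, unit_pt)"
    unfolding comp_mult_def
  proof (rule smooth_at_vec)
    fix i
    have 1: "smooth_at (\<lambda>P. (fst P $ i, snd P $ i)) (unit_pt, unit_pt)"
      by (intro smooth_at_Pair smooth_at_compose[OF smooth_at_fst smooth_at_nth] smooth_at_compose[OF smooth_at_snd smooth_at_nth])
    have "smooth_at (\<lambda>(x, y). H.crd_mult x y) (fst (unit_pt, unit_pt) $ i, snd (unit_pt, unit_pt) $ i)"
      using H.crd_mult_smooth by (simp add: unit_pt_def)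
    from smooth_at_compose[OF 1 this]
    show "smooth_at (\<lambda>P. H.crd_mult (fst P $ i) (snd P $ i)) (unit_pt, unit_pt)" by simp
  qed
  then show ?thesis by (simp add: case_prod_unfold)
qed

lemma comp_mult_right: "\<forall>\<^sub>F x in nhds unit_pt. comp_mult x unit_pt = x"
proof -
  have "\<forall>\<^sub>F x in nhds unit_pt. \<forall>i. H.crd_mult (x $ i) (unit_crd H) = x $ i"
    by (rule eventually_componentwise) (simp add: unit_pt_def H.crd_mult_right_unit)
  then show ?thesis by (rule eventually_mono) (simp add: comp_mult_def unit_pt_def vec_eq_iff)
qed

lemma comp_mult_left: "\<forall>\<^sub>F x in nhds unit_pt. comp_mult unit_pt x = x"
proof -
  have "\<forall>\<^sub>F x in nhds unit_pt. \<forall>i. H.crd_mult (unit_crd H) (x $ i) = x $ i"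
    by (rule eventually_componentwise) (simp add: unit_pt_def H.crd_mult_left_unit)
  then show ?thesis by (rule eventually_mono) (simp add: comp_mult_def unit_pt_def vec_eq_iff)
qed

lemma comp_mult_unit: "comp_mult unit_pt unit_pt = unit_pt" using eventually_nhds_x_imp_x[OF comp_mult_left] .

definition quot_mult :: "'f ^ 'q \<Rightarrow> 'f ^ 'q \<Rightarrow> 'f ^ 'q" where
  "quot_mult u v = crd G' (par G' u \<otimes>\<^bsub>G'\<^esub> par G' v)"

lemma Phi_comp_par: "\<Phi> x = \<phi> (\<lambda>i. z0 \<otimes> comp_par x i)" by (simp add: \<Phi>_def comp_par_def)

text \<open>Near the unit the projection is a homomorphism, and in coordinates it is \<open>\<Phi>\<close>.\<close>

lemma Phi_hom: "\<forall>\<^sub>F P in nhds (unit_pt, unit_pt). \<Phi> (comp_mult (fst P) (snd P))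
    = quot_mult (\<Phi> (fst P)) (\<Phi> (snd P))"
proof -
  have fst: "\<forall>\<^sub>F P in nhds (unit_pt, unit_pt). comp_par (fst P) \<in> unit_nbhd \<and> in_unit_chart (fst P)"
    by (rule eventually_nhds_fst[OF eventually_comp_par_unit_nbhd])
  have snd: "\<forall>\<^sub>F P in nhds (unit_pt, unit_pt). comp_par (snd P) \<in> unit_nbhd \<and> in_unit_chart (snd P)"
    by (rule eventually_nhds_snd[OF eventually_comp_par_unit_nbhd])
  have cont: "isCont (\<lambda>P. comp_mult (fst P) (snd P)) (unit_pt, unit_pt)"
    using smooth_at_isCont[OF comp_mult_smooth] by (simp add: case_prod_unfold)
  have ev: "\<forall>\<^sub>F x in nhds (comp_mult (fst (unit_pt, unit_pt)) (snd (unit_pt, unit_pt))). comp_par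
      x \<in> unit_nbhd"
    unfolding fst_conv snd_conv comp_mult_unit using eventually_comp_par_unit_nbhd by (rule eventually_mono) simp
  have mult: "\<forall>\<^sub>F P in nhds (unit_pt, unit_pt). comp_par (comp_mult (fst P) (snd P)) \<in> unit_nbhd"
    by (rule eventually_isCont[OF cont ev])
  have "\<forall>\<^sub>F P in nhds (unit_pt, unit_pt). \<forall>i. par H (fst P $ i) \<otimes> par H (snd P $
      i) \<in> H.unit_dom"
  proof (rule eventually_all_finite)
    fix i
    have ct: "isCont (\<lambda>P. (fst P $ i, snd P $ i)) (unit_pt, unit_pt)"
      by (intro continuous_intros)
    have ev: "\<forall>\<^sub>F Q in nhds (fst (unit_pt, unit_pt) $ i, snd (unit_pt, unit_pt) $ i). par H (fst
        Q) \<otimes> par H (snd Q) \<in> H.unit_dom"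
      using H.eventually_par_par[OF H.chartD(1)[OF H.unit_chart(1)] H.unit_chart(2)]
      by (simp add: unit_pt_def) (erule eventually_mono, simp)
    from eventually_isCont[OF ct ev]
    show "\<forall>\<^sub>F P in nhds (unit_pt, unit_pt). par H (fst P $ i) \<otimes> par H (snd P $ i)
        \<in> H.unit_dom" by simp
  qed
  with fst snd mult show ?thesis
  proof eventually_elim
    fix P
    assume 1: "comp_par (fst P) \<in> unit_nbhd \<and> in_unit_chart (fst P)"
      and 2: "comp_par (snd P) \<in> unit_nbhd \<and> in_unit_chart (snd P)"
      and 3: "comp_par (comp_mult (fst P) (snd P)) \<in> unit_nbhd"
      and 4: "\<forall>i. par H (fst P $ i) \<otimes> par H (snd P $ i) \<in> H.unit_dom"
    have e: "comp_par (comp_mult (fst P) (snd P)) = (\<lambda>i. comp_par (fst P) i \<otimes> comp_par (snd P) i)"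
      using 4 by (simp add: comp_par_def comp_mult_def H.crd_mult_def H.par_crd)
    have "quot_mult (\<Phi> (fst P)) (\<Phi> (snd P))
        = crd G' (proj (comp_par (fst P)) \<otimes>\<^bsub>G'\<^esub> proj (comp_par (snd P)))"
      using 1 2 by (simp add: quot_mult_def Phi_comp_par par_unit_nbhd)
    also have "\<dots> = crd G' (proj (comp_par (comp_mult (fst P) (snd P))))"
      using 1 2 by (simp add: proj_mult unit_nbhd_def e)
    also have "\<dots> = \<Phi> (comp_mult (fst P) (snd P))"
      using crd_unit_nbhd[OF 3] by (simp add: Phi_comp_par)
    finally show "\<Phi> (comp_mult (fst P) (snd P)) = quot_mult (\<Phi> (fst P)) (\<Phi> (snd P))" by simp
  qed
qed

lemma quot_mult_smooth: "smooth_at (\<lambda>(u, v). quot_mult u v) (\<Phi> unit_pt, \<Phi> unit_pt)"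
proof -
  let ?b = "\<Phi> unit_pt"
  have 1: "smooth_at (\<lambda>P. (\<Psi> (fst P), \<Psi> (snd P))) (?b, ?b)"
    by (intro smooth_at_Pair smooth_at_compose[OF smooth_at_fst] smooth_at_compose[OF smooth_at_snd]) (simp_all add: Psi_smooth)
  have "smooth_at (\<lambda>(x, y). comp_mult x y) (\<Psi> (fst (?b, ?b)), \<Psi> (snd (?b, ?b)))"
    using comp_mult_smooth by (simp add: Psi_Phi_unit)
  from smooth_at_compose[OF 1 this]
  have 2: "smooth_at (\<lambda>P. comp_mult (\<Psi> (fst P)) (\<Psi> (snd P))) (?b, ?b)" by simp
  have "smooth_at \<Phi> (comp_mult (\<Psi> (fst (?b, ?b))) (\<Psi> (snd (?b, ?b))))" using Phi_smooth
      by (simp add: Psi_Phi_unit comp_mult_unit)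
  from smooth_at_compose[OF 2 this]
  show ?thesis
  proof (rule smooth_at_cong)
    have ev: "\<forall>\<^sub>F P in nhds (\<Psi> (fst (?b, ?b)), \<Psi> (snd (?b, ?b))). \<Phi> (comp_mult (fst
        P) (snd P)) = quot_mult (\<Phi> (fst P)) (\<Phi> (snd P))"
      using Phi_hom by (simp add: Psi_Phi_unit)
    have h: "\<forall>\<^sub>F P in nhds (?b, ?b). \<Phi> (comp_mult (\<Psi> (fst P)) (\<Psi> (snd P)))
        = quot_mult (\<Phi> (\<Psi> (fst P))) (\<Phi> (\<Psi> (snd P)))"
      using eventually_isCont[OF smooth_at_isCont[OF 1] ev] by simp
    have f: "\<forall>\<^sub>F P in nhds (?b, ?b). \<Phi> (\<Psi> (fst P)) = fst P"
      by (rule eventually_nhds_fst[OF Phi_Psi])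
    have s: "\<forall>\<^sub>F P in nhds (?b, ?b). \<Phi> (\<Psi> (snd P)) = snd P"
      by (rule eventually_nhds_snd[OF Phi_Psi])
    show "\<forall>\<^sub>F P in nhds (?b, ?b). \<Phi> (comp_mult (\<Psi> (fst P)) (\<Psi> (snd P)))
        = (\<lambda>(u, v). quot_mult u v) P"
      using h f s by eventually_elim (simp add: case_prod_unfold)
  qed
qed

definition comp_bracket :: "'f ^ 'q \<Rightarrow> 'f ^ 'q \<Rightarrow> 'f ^ 'q" where
  "comp_bracket v w = (\<chi> i. lie_bracket H (v $ i) (w $ i))"

text \<open>Each component map is a local homomorphism to the group law of \<open>H\<close>.\<close>

lemma bracket_comp_mult: "bracket_of comp_mult unit_pt v w = comp_bracket v w"
proof -
  have "bracket_of comp_mult unit_pt v w $ i = lie_bracket H (v $ i) (w $ i)" for i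
  proof -
    have d: "frechet_derivative (\<lambda>x. x $ i) (at unit_pt) = (\<lambda>x :: 'f ^ 'q. x $ i)"
      using frechet_derivative_at[OF bounded_linear_imp_has_derivative[OF bounded_linear_vec_nth]] by metis
    have "bracket_of H.crd_mult (unit_pt $ i) (frechet_derivative (\<lambda>x. x $ i) (at unit_pt) v)
        (frechet_derivative (\<lambda>x. x $ i) (at unit_pt) w)
       = frechet_derivative (\<lambda>x. x $ i) (at unit_pt) (bracket_of comp_mult unit_pt v w)"
    proof (rule bracket_of_local_hom[OF comp_mult_smooth comp_mult_right comp_mult_left])
      show "smooth_at (\<lambda>(x, y). H.crd_mult x y) (unit_pt $ i, unit_pt $ i)" using H.crd_mult_smooth
          by (simp add: unit_pt_def)
    qed (simp_all add: smooth_at_nth comp_mult_def)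
    then show ?thesis unfolding d by (simp add: H.lie_bracket_eq unit_pt_def)
  qed
  then show ?thesis by (simp add: comp_bracket_def vec_eq_iff)
qed

lemma bracket_L: "lie_bracket G' (L v) (L w) = L (comp_bracket v w)"
proof -
  have "lie_bracket G' = bracket_of quot_mult (\<Phi> unit_pt)"
    unfolding lie_bracket_eq_bracket_of quot_mult_def[abs_def] unit_crd_G' ..
  then show ?thesis
    using bracket_of_local_hom[OF comp_mult_smooth comp_mult_right comp_mult_left quot_mult_smooth Phi_smooth Phi_hom, of v w]
    by (simp add: L_def bracket_comp_mult)
qed

text \<open>In coordinates, conjugation by \<open>proj g\<close> is \<open>\<Phi> \<circ> \<kappa> \<circ> \<Psi>\<close>, where \<open>\<kappa>\<close> conjugates the components by those of \<open>g\<close>.\<close>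

lemma Ad_L:
  assumes g: "g \<in> carrier HQ"
  shows "Ad G' (proj g) (L v) = L (\<chi> i. Ad H (g i) (v $ i))"
proof -
  define \<kappa> where "\<kappa> = (\<lambda>x :: 'f ^ 'q. \<chi> i. H.conj_map (g i) (x $ i))"
  have gi: "g i \<in> carrier H" for i using g by (simp add: HQ_carrier)
  have ka: "\<kappa> unit_pt = unit_pt" using H.conj_map_unit[OF gi] by (simp add: \<kappa>_def unit_pt_def)
  have dk: "(\<kappa> has_derivative (\<lambda>v. \<chi> i. Ad H (g i) (v $ i))) (at unit_pt)"
    unfolding \<kappa>_def
  proof (rule has_derivative_vec)
    fix i
    have "(H.conj_map (g i) has_derivative Ad H (g i)) (at (unit_pt $ i))"
      unfolding H.Ad_eq unit_pt_def using smooth_at_has_derivative[OF H.conj_map_smooth[OF gi]] by simp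
    then show "((\<lambda>x. H.conj_map (g i) (x $ i)) has_derivative (\<lambda>v. Ad H (g i) (v $ i))) (at unit_pt)"
      by (rule has_derivative_compose[OF bounded_linear_imp_has_derivative[OF bounded_linear_vec_nth]])
  qed
  have dk': "(\<kappa> has_derivative (\<lambda>v. \<chi> i. Ad H (g i) (v $ i))) (at (\<Psi> (\<Phi>
      unit_pt)))" using dk by (simp add: Psi_Phi_unit)
  have dP: "(\<Phi> has_derivative L) (at (\<kappa> (\<Psi> (\<Phi> unit_pt))))" using L_derivative
      by (simp add: Psi_Phi_unit ka)
  have comp: "((\<lambda>y. \<Phi> (\<kappa> (\<Psi> y)))
      has_derivative (\<lambda>v. L (\<chi> i. Ad H (g i) (L' v $ i)))) (at (\<Phi> unit_pt))"
    using has_derivative_compose[OF has_derivative_compose[OF L'_derivative dk'] dP] by simp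
  define W where "W = {x \<in> carrier HQ. (\<lambda>i. g i \<otimes> x i \<otimes> inv (g i))
      \<in> unit_nbhd \<inter> (\<Pi>\<^sub>E i\<in>UNIV. H.unit_dom)}"
  have "(\<lambda>i. inv (g i)) \<in> carrier HQ" using gi by (simp add: HQ_carrier)
  note cm = XQ_conjugate[OF g this]
  have "openin XQ (unit_nbhd \<inter> (\<Pi>\<^sub>E i\<in>UNIV. H.unit_dom))"
    using unit_nbhd_open H.chartD(1)[OF H.unit_chart(1)] by (intro openin_Int) (simp_all add: XQ_eq openin_PiE)
  from openin_continuous_map_preimage[OF cm this]
  have oW: "openin XQ W" by (simp add: W_def topspace_XQ)
  have mW: "(\<lambda>_. \<one>) \<in> W" using unit_nbhd_one gi H.unit_chart(2) by (simp add: W_def HQ_carrier PiE_iff)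
  have "openin XQ (W \<inter> unit_nbhd)" "(\<lambda>_. \<one>) \<in> W \<inter> unit_nbhd"
      using oW unit_nbhd_open mW unit_nbhd_one by auto
  note ev = eventually_comp_par[OF this]
  have near: "\<forall>\<^sub>F x in nhds unit_pt. crd G' (proj g \<otimes>\<^bsub>G'\<^esub> par G' (\<Phi> x)
      \<otimes>\<^bsub>G'\<^esub> inv\<^bsub>G'\<^esub> (proj g)) = \<Phi> (\<kappa> x)"
    using ev
  proof (rule eventually_mono)
    fix x
    assume x: "comp_par x \<in> W \<inter> unit_nbhd \<and> in_unit_chart x"
    let ?h = "\<lambda>i. g i \<otimes> comp_par x i \<otimes> inv (g i)"
    have h: "?h \<in> unit_nbhd" "\<And>i. ?h i \<in> H.unit_dom" using x by (auto simp: W_def PiE_iff)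
    have pc: "comp_par x \<in> carrier HQ" using x by (simp add: unit_nbhd_def)
    have gp: "(\<lambda>i. g i \<otimes> comp_par x i) \<in> carrier HQ" "(\<lambda>i. inv (g i)) \<in> carrier HQ"
      using pc gi by (auto simp: HQ_carrier)
    have "proj g \<otimes>\<^bsub>G'\<^esub> par G' (\<Phi> x) \<otimes>\<^bsub>G'\<^esub> inv\<^bsub>G'\<^esub>
        (proj g) = proj ?h"
      using x by (simp add: Phi_comp_par par_unit_nbhd proj_inv[OF g] proj_mult[OF g pc] proj_mult[OF gp])
    then have "crd G' (proj g \<otimes>\<^bsub>G'\<^esub> par G' (\<Phi> x) \<otimes>\<^bsub>G'\<^esub>
        inv\<^bsub>G'\<^esub> (proj g)) = \<phi> (\<lambda>i. z0 \<otimes> ?h i)"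
      using crd_unit_nbhd[OF h(1)] by simp
    also have "\<dots> = \<Phi> (\<kappa> x)"
      using h(2) by (simp add: \<Phi>_def \<kappa>_def H.conj_map_def comp_par_def H.par_crd)
    finally show "crd G' (proj g \<otimes>\<^bsub>G'\<^esub> par G' (\<Phi> x) \<otimes>\<^bsub>G'\<^esub>
        inv\<^bsub>G'\<^esub> (proj g)) = \<Phi> (\<kappa> x)" .
  qed
  have "\<forall>\<^sub>F y in nhds (\<Phi> unit_pt). crd G' (proj g \<otimes>\<^bsub>G'\<^esub> par G' (\<Phi>
      (\<Psi> y)) \<otimes>\<^bsub>G'\<^esub> inv\<^bsub>G'\<^esub> (proj g)) = \<Phi> (\<kappa> (\<Psi> y))"
    by (rule eventually_isCont[OF smooth_at_isCont[OF Psi_smooth]]) (simp add: Psi_Phi_unit near)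
  with Phi_Psi have "\<forall>\<^sub>F y in nhds (\<Phi> unit_pt). \<Phi> (\<kappa> (\<Psi> y))
      = crd G' (proj g \<otimes>\<^bsub>G'\<^esub> par G' y \<otimes>\<^bsub>G'\<^esub> inv\<^bsub>G'\<^esub> (proj g))"
    by eventually_elim simp
  from comp[unfolded has_derivative_cong_nhds[OF this]]
  have "frechet_derivative (\<lambda>y. crd G' (proj g \<otimes>\<^bsub>G'\<^esub> par G' y
      \<otimes>\<^bsub>G'\<^esub> inv\<^bsub>G'\<^esub> (proj g))) (at (\<Phi> unit_pt))
      = (\<lambda>v. L (\<chi> i. Ad H (g i) (L' v $ i)))"
    by (rule frechet_derivative_at[symmetric])
  then show ?thesis by (simp add: Ad_def unit_crd_G' L'_L)
qed

end

section \<open>The isotropy algebra and the Casimir form of the quotient\<close>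

context power_chart
begin

abbreviation K' where "K' \<equiv> proj ` (diag (carrier H) :: ('q \<Rightarrow> 'h) set)"

definition diag_vec :: "'f \<Rightarrow> 'f ^ 'q" where "diag_vec u = (\<chi> i. u)"

lemma diag_vec_linear: "linear diag_vec" by (rule linearI) (simp_all add: diag_vec_def vec_eq_iff)

lemma proj_continuous: "continuous_map XQ (space_of G') proj"
  unfolding lie_quotient_simps using quotient_map_quotient_top quotient_imp_continuous_map by blast

text \<open>The saturation of \<open>V\<close> is the union of its translates by the centre.\<close>

lemma proj_V_open: "openin (space_of G') (proj ` V)"
proof -
  have "{x \<in> topspace XQ. proj x \<in> proj ` V}
      = (\<Union>n\<in>Z. {x \<in> topspace XQ. (\<lambda>i. n \<otimes> x i) \<in> V})" (is "?A = ?B")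
  proof
    show "?A \<subseteq> ?B"
    proof
      fix x assume "x \<in> ?A"
      then obtain v where x: "x \<in> carrier HQ" and v: "v \<in> V" "proj v = proj x"
        by (auto simp: topspace_XQ)
      then obtain n where "n \<in> Z" "v = (\<lambda>i. n \<otimes> x i)" using proj_eq_iff[OF V_carrier[OF v(1)] x] by blast
      then show "x \<in> ?B" using x v by (auto simp: topspace_XQ)
    qed
    show "?B \<subseteq> ?A"
    proof
      fix x assume "x \<in> ?B"
      then obtain n where n: "n \<in> Z" "x \<in> carrier HQ" "(\<lambda>i. n \<otimes> x i) \<in> V"
          by (auto simp: topspace_XQ)
      then have "proj (\<lambda>i. n \<otimes> x i) = proj x" using proj_eq_iff[OF V_carrier[OF n(3)] n(2)] by blast
      then have "proj x \<in> proj ` V" using n(3) by (metis imageI)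
      then show "x \<in> ?A" using n(2) by (simp add: topspace_XQ)
    qed
  qed
  moreover have "openin XQ ?B"
  proof (intro openin_Union ballI, clarify)
    fix n assume "n \<in> Z"
    then have "(\<lambda>_. n) \<in> carrier HQ" using centreD by (simp add: HQ_carrier)
    from openin_continuous_map_preimage[OF XQ_left[OF this] V_open]
    show "openin XQ {x \<in> topspace XQ. (\<lambda>i. n \<otimes> x i) \<in> V}" .
  qed
  moreover have "proj ` V \<subseteq> proj ` topspace XQ" using openin_subset[OF V_open] by blast
  ultimately show ?thesis unfolding lie_quotient_simps openin_quotient_top by simp
qed

text \<open>A straight line through the unit in coordinates, stopped before it leaves the chart so that the curve
  is defined for all times.\<close>

lemma velocity_curve_exists:
  "\<exists>\<gamma>. continuous_map euclideanreal (space_of H) \<gamma>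
      \<and> (\<forall>t. \<gamma> t \<in> carrier H) \<and> \<gamma> 0 = \<one> \<and>
     ((\<lambda>t. crd H (\<gamma> t)) has_vector_derivative u) (at 0)"
proof -
  let ?a = "unit_crd H"
  obtain r where r: "0 < r" "ball ?a r \<subseteq> crd H ` H.unit_dom"
    using H.chartD(2)[OF H.unit_chart(1)] H.unit_chart(2) open_contains_ball by blast
  define d where "d = r / (norm u + 1)"
  have nu: "0 < norm u + 1" by (simp add: add_nonneg_pos)
  have d: "0 < d" using r nu by (simp add: d_def)
  define s where "s = (\<lambda>t :: real. max (- d) (min d t))"
  have s_bound: "\<bar>s t\<bar> \<le> d" for t using d by (auto simp: s_def)
  have s_cont: "continuous_on UNIV s" unfolding s_def by (intro continuous_intros)
  have mem: "?a + s t *\<^sub>R u \<in> crd H ` H.unit_dom" for t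
  proof -
    have "norm (s t *\<^sub>R u) \<le> d * norm u" using s_bound[of t] by (simp add: mult_right_mono)
    also have "\<dots> < d * (norm u + 1)" using d by simp
    also have "\<dots> = r" using nu by (simp add: d_def)
    finally show ?thesis using r(2) by (auto simp: dist_norm)
  qed
  define \<gamma> where "\<gamma> = (\<lambda>t. par H (?a + s t *\<^sub>R u))"
  have g1: "\<gamma> t \<in> H.unit_dom" "crd H (\<gamma> t) = ?a + s t *\<^sub>R u" for t
    using mem[of t] by (auto simp: \<gamma>_def H.par_crd)
  have gc: "\<gamma> t \<in> carrier H" for t using g1(1)[of t] H.chartD(4)[OF H.unit_chart(1)] by blast
  have "continuous_map euclideanreal (space_of H) \<gamma>"
    unfolding continuous_map_def
  proof (intro conjI allI impI)
    show "\<gamma> \<in> topspace euclideanreal \<rightarrow> topspace (space_of H)" using gc by (simp add: H.topspace_X)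
    fix W assume W: "openin (space_of H) W"
    have "{t. \<gamma> t \<in> W} = (\<lambda>t. ?a + s t *\<^sub>R u) -` (crd H ` (H.unit_dom \<inter> W))"
    proof -
      have "\<gamma> t \<in> W \<longleftrightarrow> ?a + s t *\<^sub>R u \<in> crd H ` (H.unit_dom \<inter> W)" for t
      proof
        assume "\<gamma> t \<in> W"
        then have "crd H (\<gamma> t) \<in> crd H ` (H.unit_dom \<inter> W)" using g1(1)[of t] by blast
        then show "?a + s t *\<^sub>R u \<in> crd H ` (H.unit_dom \<inter> W)" using g1(2) by simp
      next
        assume "?a + s t *\<^sub>R u \<in> crd H ` (H.unit_dom \<inter> W)"
        then show "\<gamma> t \<in> W" by (auto simp: \<gamma>_def H.par_crd)
      qed
      then show ?thesis by (simp add: vimage_def)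
    qed
    moreover have "open ((\<lambda>t. ?a + s t *\<^sub>R u) -` (crd H ` (H.unit_dom \<inter> W)))"
      by (intro open_vimage H.chart_image_open[OF H.unit_chart(1) W] continuous_intros s_cont)
    ultimately show "openin euclideanreal {t \<in> topspace euclideanreal. \<gamma> t \<in> W}" by simp
  qed
  moreover have "\<gamma> 0 = \<one>" using d by (simp add: \<gamma>_def s_def H.par_unit)
  moreover have "((\<lambda>t. crd H (\<gamma> t)) has_vector_derivative u) (at 0)"
  proof -
    have "((\<lambda>t. ?a + t *\<^sub>R u) has_vector_derivative u) (at 0)"
      by (auto intro!: derivative_eq_intros)
    moreover have "\<forall>\<^sub>F t in nhds 0. ?a + t *\<^sub>R u = crd H (\<gamma> t)"
    proof -
      have "\<forall>\<^sub>F t in nhds (0 :: real). t \<in> {- d<..<d}" by (rule eventually_nhds_in_open) (use d in auto)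
      then show ?thesis by (rule eventually_mono) (simp add: g1(2) s_def)
    qed
    ultimately show ?thesis by (subst (asm) has_vector_derivative_cong_nhds)
  qed
  ultimately show ?thesis using gc by blast
qed

lemma lie_subalg_L_sup: "L (diag_vec u) \<in> lie_subalg G' K'"
proof -
  obtain \<gamma> where g: "continuous_map euclideanreal (space_of H) \<gamma>" "\<And>t. \<gamma> t
      \<in> carrier H" "\<gamma> 0 = \<one>"
     "((\<lambda>t. crd H (\<gamma> t)) has_vector_derivative u) (at 0)" using velocity_curve_exists by blast
  define \<delta> where "\<delta> = (\<lambda>t (i :: 'q). \<gamma> t)"
  have dc: "continuous_map euclideanreal XQ \<delta>"
    unfolding XQ_eq continuous_map_componentwise_UNIV \<delta>_def using g(1) by simp
  have c: "continuous_map euclideanreal (space_of G') (\<lambda>t. proj (\<delta> t))"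
    using continuous_map_compose[OF dc proj_continuous] by (simp add: o_def)
  have r: "range (\<lambda>t. proj (\<delta> t)) \<subseteq> K'" using g(2) by (auto simp: \<delta>_def diag_mem)
  have o: "proj (\<delta> 0) = \<one>\<^bsub>G'\<^esub>" using proj_one g(3) by (simp add: \<delta>_def)
  have "((\<lambda>t. diag_vec (crd H (\<gamma> t))) has_vector_derivative diag_vec u) (at 0)"
    by (rule has_vector_derivative_chain[OF g(4)])
      (rule bounded_linear_imp_has_derivative[OF diag_vec_linear[unfolded linear_conv_bounded_linear]])
  moreover have "(\<Phi> has_derivative L) (at (diag_vec (crd H (\<gamma> 0))))" using L_derivative
      by (simp add: g(3) diag_vec_def unit_pt_def)
  ultimately have "((\<lambda>t. \<Phi> (diag_vec (crd H (\<gamma> t)))) has_vector_derivative L (diag_vec u)) (at 0)"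
    by (rule has_vector_derivative_chain)
  moreover have "\<forall>\<^sub>F t in nhds 0. \<Phi> (diag_vec (crd H (\<gamma> t))) = crd G' (proj (\<delta> t))"
  proof -
    have "openin euclideanreal {t \<in> topspace euclideanreal. \<delta> t \<in> unit_nbhd}"
      by (rule openin_continuous_map_preimage[OF dc unit_nbhd_open])
    then have op: "open {t. \<delta> t \<in> unit_nbhd}" by simp
    have "\<delta> 0 \<in> unit_nbhd" using unit_nbhd_one g(3) by (simp add: \<delta>_def)
    then have e1: "\<forall>\<^sub>F t in nhds 0. \<delta> t \<in> unit_nbhd"
        using eventually_nhds_in_open[OF op, of 0] by simp
    have e2: "\<forall>\<^sub>F t in nhds 0. \<gamma> t \<in> H.unit_dom"
      by (rule H.curve_eventually[OF g(1,3) H.chartD(1)[OF H.unit_chart(1)] H.unit_chart(2)])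
    from e1 e2 show ?thesis
      by eventually_elim (simp add: crd_unit_nbhd, simp add: \<Phi>_def diag_vec_def \<delta>_def H.par_crd)
  qed
  ultimately have "((\<lambda>t. crd G' (proj (\<delta> t))) has_vector_derivative L (diag_vec u)) (at 0)"
    by (subst (asm) has_vector_derivative_cong_nhds)
  then show ?thesis unfolding lie_subalg_def using c r o by blast
qed

text \<open>Near time zero a curve in the image of the diagonal lifts to \<open>V\<close>, and its lift is diagonal because the
  projection identifies only elements that differ by a diagonal factor.\<close>

lemma lie_subalg_L_sub:
  assumes "v \<in> lie_subalg G' K'" shows "\<exists>u. v = L (diag_vec u)"
proof -
  obtain \<gamma> where g: "continuous_map euclideanreal (space_of G') \<gamma>" "range \<gamma> \<subseteq>
      K'" "\<gamma> 0 = \<one>\<^bsub>G'\<^esub>"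
     "((\<lambda>t. crd G' (\<gamma> t)) has_vector_derivative v) (at 0)"
    using assms unfolding lie_subalg_def by blast
  have "openin euclideanreal {t \<in> topspace euclideanreal. \<gamma> t \<in> proj ` V}"
    by (rule openin_continuous_map_preimage[OF g(1) proj_V_open])
  then have op: "open {t. \<gamma> t \<in> proj ` V}" by simp
  have "\<gamma> 0 \<in> proj ` V"
    using proj_shift[of "\<lambda>_. \<one>"] z0 z0_carrier by (auto simp: g(3) proj_one[symmetric] HQ_carrier)
  then have ev: "\<forall>\<^sub>F t in nhds 0. \<gamma> t \<in> proj ` V" using eventually_nhds_in_open[OF op, of 0] by simp
  have diag: "\<Psi> (crd G' (\<gamma> t)) \<in> range diag_vec" if t: "\<gamma> t \<in> proj ` V" for t
  proof -
    obtain w where w: "w \<in> V" "\<gamma> t = proj w" using t by blast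
    have "\<gamma> t \<in> K'" using g(2) by blast
    then obtain k where k: "k \<in> carrier H" "\<gamma> t = proj (\<lambda>_. k)" by (auto simp: diag_def)
    have "(\<lambda>_. k) \<in> carrier HQ" using k by (simp add: HQ_carrier)
    then obtain n where "w = (\<lambda>i. n \<otimes> k)" using proj_eq_iff[OF V_carrier[OF w(1)]] w k by metis
    then have "\<Psi> (crd G' (\<gamma> t)) = diag_vec (crd H (inv z0 \<otimes> (n \<otimes> k)))"
      using w by (simp add: crd_proj Psi_phi diag_vec_def)
    then show ?thesis by blast
  qed
  have d: "(\<Psi> has_derivative L') (at (crd G' (\<gamma> 0)))" using L'_derivative by (simp add: g(3) unit_crd_G')
  have "L' v \<in> range diag_vec"
  proof (rule velocity_in_subspace[OF _ _ has_vector_derivative_chain[OF g(4) d]])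
    show "subspace (range diag_vec)" by (rule linear_subspace_image[OF diag_vec_linear subspace_UNIV])
    show "\<forall>\<^sub>F t in nhds 0. \<Psi> (crd G' (\<gamma> t)) \<in> range diag_vec" using ev
        by (rule eventually_mono) (rule diag)
  qed
  then show ?thesis by (metis L_L' rangeE)
qed

lemma lie_subalg_eq: "lie_subalg G' K' = (\<lambda>u. L (diag_vec u)) ` UNIV"
  using lie_subalg_L_sup lie_subalg_L_sub by blast

lemma killing_G': "killing G' x y = (\<Sum>i\<in>UNIV. killing H (L' x $ i) (L' y $ i))"
proof -
  have br: "lie_bracket G' x y = L (comp_bracket (L' x) (L' y))" for x y using bracket_L[of "L' x" "L' y"]
      by (simp add: L_L')
  have lb: "linear (lie_bracket H u)" for u using H.bilinear_lie_bracket by (rule bilinear_linear)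
  have l: "linear (\<lambda>u. comp_bracket (L' x) (comp_bracket (L' y) u))"
    by (rule linearI) (simp_all add: comp_bracket_def vec_eq_iff linear_add[OF lb] linear_cmul[OF lb])
  have "killing G' x y = lin_trace (\<lambda>u. L (comp_bracket (L' x) (comp_bracket (L' y) (L' u))))"
    by (simp add: killing_def br L'_L)
  also have "\<dots> = lin_trace (\<lambda>u. comp_bracket (L' x) (comp_bracket (L' y) u))"
    by (rule lin_trace_conjugate[OF l L_linear L'_linear L'_L])
  also have "\<dots> = (\<Sum>i\<in>UNIV. killing H (L' x $ i) (L' y $ i))"
    by (simp add: lin_trace_vec comp_bracket_def killing_def)
  finally show ?thesis .
qed

text \<open>Every property is transported by \<open>L\<close> from the corresponding componentwise statement about \<open>H\<close>.\<close>

lemma reductive_G': "reductive G' K'"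
proof (rule reductive.intro)
  have br: "lie_bracket G' x y = L (comp_bracket (L' x) (L' y))" for x y using bracket_L[of "L' x" "L' y"]
      by (simp add: L_L')
  note lb = bilinear_linear[OF H.bilinear_lie_bracket]
  note lsimps = linear_add[OF L_linear] linear_cmul[OF L_linear] linear_add[OF L'_linear] linear_cmul[OF L'_linear]
  have comp_bracket_diag: "comp_bracket (diag_vec u) (diag_vec w) = diag_vec (lie_bracket H u w)" for u w
      by (simp add: comp_bracket_def diag_vec_def)
  have "bilinear comp_bracket"
    by (rule bilinear_if_linear_combinations) (simp_all add: comp_bracket_def vec_eq_iff linear_add[OF lb(1)] linear_cmul[OF lb(1)]
         linear_add[OF lb(2)] linear_cmul[OF lb(2)])
  note cbl = bilinear_linear[OF this]
  show "bilinear (lie_bracket G')"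
    by (rule bilinear_if_linear_combinations) (simp_all add: br lsimps linear_add[OF cbl(1)] linear_cmul[OF cbl(1)]
         linear_add[OF cbl(2)] linear_cmul[OF cbl(2)])
  show "lie_bracket G' x y = - lie_bracket G' y x" for x y
  proof -
    have "comp_bracket (L' x) (L' y) $ i = (- comp_bracket (L' y) (L' x)) $ i" for i
      using H.lie_bracket_skew[of "L' x $ i" "L' y $ i"] by (simp add: comp_bracket_def)
    then have "comp_bracket (L' x) (L' y) = - comp_bracket (L' y) (L' x)" unfolding vec_eq_iff by blast
    then show ?thesis unfolding br by (simp add: linear_neg[OF L_linear])
  qed
  show "lie_bracket G' x (lie_bracket G' y z)
      = lie_bracket G' (lie_bracket G' x y) z + lie_bracket G' y (lie_bracket G' x z)" for x y z
  proof -
    have "comp_bracket a (comp_bracket b c) $ i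
        = (comp_bracket (comp_bracket a b) c + comp_bracket b (comp_bracket a c)) $ i" for a b c i
      using H.jacobi[of "a $ i" "b $ i" "c $ i"] by (simp add: comp_bracket_def)
    then have e: "comp_bracket a (comp_bracket b c)
        = comp_bracket (comp_bracket a b) c + comp_bracket b (comp_bracket a c)" for a b c unfolding vec_eq_iff by blast
    show ?thesis unfolding br L'_L lsimps(1)[symmetric] by (rule arg_cong[where f = L, OF e])
  qed
  show "killing G' v v < 0" if "v \<noteq> 0" for v
  proof -
    have "L' v \<noteq> 0" using that L_L'[of v] linear_0[OF L_linear] by auto
    then obtain j where j: "L' v $ j \<noteq> 0" by (auto simp: vec_eq_iff)
    have le: "killing H u u \<le> 0" for u
      using H.killing_negative[OF simple cpt, of u]
      by (cases "u = 0") (simp_all add: killing_def linear_0[OF lb(2)] lin_trace_def)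
    have "killing G' v v \<le> killing H (L' v $ j) (L' v $ j)"
      unfolding killing_G' using sum_mono2[of UNIV "{j}" "\<lambda>i. - killing H (L' v $ i) (L' v $ i)"] le
      by (simp add: sum_negf)
    also have "\<dots> < 0" by (rule H.killing_negative[OF simple cpt j])
    finally show ?thesis .
  qed
  have Ldg: "linear (\<lambda>u. L (diag_vec u))" using linear_compose[OF diag_vec_linear L_linear] by (simp add: o_def)
  show "subspace (lie_subalg G' K')"
    unfolding lie_subalg_eq by (rule linear_subspace_image[OF Ldg subspace_UNIV])
  show "lie_bracket G' v w \<in> lie_subalg G' K'" if vw: "v \<in> lie_subalg G' K'" "w \<in> lie_subalg G' K'" for v w
    using vw unfolding lie_subalg_eq by (auto simp: br L'_L comp_bracket_diag)
  have K'E: "\<exists>k. k \<in> carrier H \<and> g = proj (\<lambda>_. k)" if "g \<in> K'" for g using that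
      by (auto simp: diag_def)
  have Ad: "Ad G' (proj (\<lambda>_. k)) v = L (\<chi> i. Ad H k (L' v $ i))" if "k \<in> carrier H" for k v
    using Ad_L[of "\<lambda>_. k" "L' v"] that by (simp add: L_L' HQ_carrier)
  show "linear (Ad G' g)" if g: "g \<in> K'" for g
  proof -
    obtain k where k: "k \<in> carrier H" "g = proj (\<lambda>_. k)" using K'E[OF g] by blast
    have "Ad G' g = (\<lambda>v. L (\<chi> i. Ad H k (L' v $ i)))" using Ad k by (simp add: fun_eq_iff)
    moreover have "linear (\<lambda>v. \<chi> i. Ad H k (L' v $ i))"
      by (rule linearI) (simp_all add: vec_eq_iff lsimps linear_add[OF H.linear_Ad[OF k(1)]] linear_cmul[OF H.linear_Ad[OF k(1)]])
    ultimately show ?thesis using linear_compose[OF _ L_linear] by (simp add: o_def)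
  qed
  show "lie_bracket G' (Ad G' g v) (Ad G' g w) = Ad G' g (lie_bracket G' v w)" if g: "g \<in> K'" for g v w
  proof -
    obtain k where k: "k \<in> carrier H" "g = proj (\<lambda>_. k)" using K'E[OF g] by blast
    show ?thesis by (simp add: k(2) Ad[OF k(1)] br L'_L, simp add: comp_bracket_def H.Ad_bracket[OF k(1)])
  qed
  show "Ad G' g v \<in> lie_subalg G' K'" if g: "g \<in> K'" and v: "v \<in> lie_subalg G' K'" for g v
  proof -
    obtain k where k: "k \<in> carrier H" "g = proj (\<lambda>_. k)" using K'E[OF g] by blast
    obtain u where u: "v = L (diag_vec u)" using v unfolding lie_subalg_eq by blast
    have "Ad G' g v = L (diag_vec (Ad H k u))" by (simp add: k(2) Ad[OF k(1)] u L'_L) (simp add: diag_vec_def)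
    then show ?thesis unfolding lie_subalg_eq by blast
  qed
  show "\<exists>h\<in>K'. \<forall>v. Ad G' g (Ad G' h v) = v \<and> Ad G' h (Ad G' g v) = v" if g: "g \<in> K'" for g
  proof -
    obtain k where k: "k \<in> carrier H" "g = proj (\<lambda>_. k)" using K'E[OF g] by blast
    have "proj (\<lambda>_. inv k) \<in> K'" using k(1) by (auto simp: diag_mem)
    moreover have "Ad G' g (Ad G' (proj (\<lambda>_. inv k)) v) = v
        \<and> Ad G' (proj (\<lambda>_. inv k)) (Ad G' g v) = v" for v
      using k(1) by (simp add: k(2) Ad L'_L H.Ad_inv L_L')
    ultimately show ?thesis by blast
  qed
qed

text \<open>The orthogonal projection onto the diagonal averages the components. On the block of the \<open>i\<close>-th
  component the trace of \<open>F\<close> is therefore \<open>1 / n\<close> times the Killing form of \<open>H\<close> at the \<open>i\<close>-th components.\<close>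

lemma nabla_einstein_G': "nabla_einstein G' K' (nomizu_alpha G' K' \<alpha>)"
proof -
  interpret reductive G' K' by (rule reductive_G')
  have br: "lie_bracket G' x y = L (comp_bracket (L' x) (L' y))" for x y using bracket_L[of "L' x" "L' y"]
      by (simp add: L_L')
  have lb: "linear (lie_bracket H u)" for u using H.bilinear_lie_bracket by (rule bilinear_linear)
  define n where "n = real CARD('q)"
  have n: "n \<noteq> 0" by (simp add: n_def)
  define avg where "avg = (\<lambda>z :: 'f ^ 'q. (1 / n) *\<^sub>R (\<Sum>j\<in>UNIV. z $ j))"
  have kl: "linear (killing H u)" for u
    by (rule linearI) (simp_all add: killing_def lin_trace_add[symmetric] lin_trace_scaleR[symmetric]
        linear_add[OF lb] linear_add[OF bilinear_linear(2)[OF H.bilinear_lie_bracket]]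
        linear_cmul[OF lb] linear_cmul[OF bilinear_linear(2)[OF H.bilinear_lie_bracket]])
  have pk: "proj_k G' K' z = L (diag_vec (avg (L' z)))" for z
  proof (rule proj_k_eqI)
    show "L (diag_vec (avg (L' z))) \<in> lie_subalg G' K'" unfolding lie_subalg_eq by blast
    show "z = L (diag_vec (avg (L' z))) + L (L' z - diag_vec (avg (L' z)))"
      by (simp add: linear_add[OF L_linear, symmetric] L_L')
    show "L (L' z - diag_vec (avg (L' z))) \<in> red_compl G' K'"
      unfolding red_compl_def lie_subalg_eq
    proof (intro CollectI ballI, elim imageE)
      fix v u assume v: "v = L (diag_vec u)"
      have "(\<Sum>i\<in>UNIV. (L' z - diag_vec (avg (L' z))) $ i) = 0"
        using n by (simp add: diag_vec_def avg_def sum_subtractf n_def scaleR_conv_of_real[symmetric] sum_constant_scaleR)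
      then have "killing H u (\<Sum>i\<in>UNIV. (L' z - diag_vec (avg (L' z))) $ i) = 0" using linear_0[OF kl] by simp
      then show "killing G' v (L (L' z - diag_vec (avg (L' z)))) = 0"
        by (simp add: v killing_G' L'_L linear_sum[OF kl]) (simp add: diag_vec_def)
    qed
  qed
  have "casimir x y = - (1 / n) * gB G' x y" for x y
  proof -
    define F where "F = (\<lambda>u. diag_vec (avg (comp_bracket (L' x) (comp_bracket (L' y) u))))"
    have lF: "linear F"
      unfolding F_def
      by (rule linearI) (simp_all add: comp_bracket_def avg_def diag_vec_def vec_eq_iff linear_add[OF lb] linear_cmul[OF lb] sum.distrib
          scaleR_add_right scaleR_sum_right[symmetric])
    have "casimir x y = lin_trace (\<lambda>z. L (F (L' z)))"
      unfolding casimir_def by (simp add: pk br L'_L F_def)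
    also have "\<dots> = lin_trace F"
      by (rule lin_trace_conjugate[OF lF L_linear L'_linear L'_L])
    also have "\<dots> = (\<Sum>i\<in>UNIV. (1 / n) * killing H (L' x $ i) (L' y $ i))"
    proof -
      have "F (axis i b) $ i = (1 / n) *\<^sub>R lie_bracket H (L' x $ i) (lie_bracket H (L' y $ i) b)" for i b
      proof -
        have "(\<Sum>j\<in>UNIV. lie_bracket H (L' x $ j) (lie_bracket H (L' y $ j) (axis i b $ j)))
          = (\<Sum>j\<in>UNIV. if j = i then lie_bracket H (L' x $ i) (lie_bracket H (L' y $ i) b) else 0)"
          by (intro sum.cong) (auto simp: axis_def linear_0[OF lb])
        then show ?thesis by (simp add: F_def diag_vec_def avg_def comp_bracket_def)
      qed
      then show ?thesis by (simp add: lin_trace_vec lin_trace_scaleR killing_def)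
    qed
    also have "\<dots> = (1 / n) * killing G' x y" by (simp add: killing_G' sum_distrib_left)
    finally show ?thesis by (simp add: gB_def)
  qed
  then show ?thesis by (rule nabla_einstein_if_casimir_scalar)
qed

end

lemma nabla_einstein_power_quotient:
  fixes H :: "('h, 'f::euclidean_space) lie_data"
  assumes "simple_lie_group H" and "compact_space (space_of H)"
  defines "HQ \<equiv> lie_power H :: ('q::finite \<Rightarrow> 'h, 'f ^ 'q) lie_data"
    and "\<Delta>Z \<equiv> diag (group_centre H)" and "\<Delta>H \<equiv> diag (carrier H)"
  shows "nabla_einstein (lie_quotient HQ \<Delta>Z) (quotient_proj HQ \<Delta>Z ` \<Delta>H)
            (nomizu_alpha (lie_quotient HQ \<Delta>Z) (quotient_proj HQ \<Delta>Z ` \<Delta>H) \<alpha>)"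
proof -
  interpret P: simple_power H "TYPE('q)" using assms(1,2) by unfold_locales
  obtain c V z0 where "\<forall>i. c i
      \<in> atlas_of H" "V \<subseteq> (\<Pi>\<^sub>E i\<in>UNIV. fst (c i))" "openin P.XQ V" "inj_on P.proj V"
     "z0 \<in> group_centre H" "(\<lambda>_. z0) \<in> V"
     "unit_chart P.G' = (P.proj ` V, (\<lambda>x. \<chi> i. snd (c i) (x i)) \<circ> inv_into V P.proj)"
    using P.unit_chart_form by (elim exE conjE)
  then interpret power_chart H "TYPE('q)" c V z0
    by unfold_locales auto
  show ?thesis unfolding HQ_def \<Delta>Z_def \<Delta>H_def by (rule nabla_einstein_G')
qed

theorem theorem4p7:
  fixes G :: "('g, 'e::euclidean_space) lie_data" and K :: "'g set"
    and H :: "('h, 'f::euclidean_space) lie_data"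
    and HQ :: "('q::finite \<Rightarrow> 'h, 'f ^ 'q) lie_data"
    and \<Delta>Z \<Delta>H :: "('q \<Rightarrow> 'h) set"
  defines "HQ \<equiv> lie_power H"
    and "\<Delta>Z \<equiv> diag (group_centre H)"
    and "\<Delta>H \<equiv> diag (carrier H)"
  shows
    "(simple_lie_group G \<and> compact_space (space_of G) \<and>
      subgroup K G \<and> closedin (space_of G) K \<and> effective_action G K \<and>
      simply_connected_space (coset_space G K) \<and>
      3 \<le> dim (red_compl G K) \<and>
      isotropy_irreducible G K \<and> \<not> type_I_symmetric_coset G K
      \<longrightarrow> (\<forall>\<alpha>::real. nabla_einstein G K (nomizu_alpha G K \<alpha>)))
     \<and>
     (simple_lie_group H \<and> compact_space (space_of H) \<and>
      simply_connected_space (space_of H) \<and> 2 \<le> CARD('q)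
      \<longrightarrow> (\<forall>\<alpha>::real. nabla_einstein (lie_quotient HQ \<Delta>Z) (quotient_proj HQ \<Delta>Z ` \<Delta>H)
            (nomizu_alpha (lie_quotient HQ \<Delta>Z) (quotient_proj HQ \<Delta>Z ` \<Delta>H) \<alpha>)))"
proof (intro conjI impI allI)
  fix \<alpha> :: real
  assume "simple_lie_group G \<and> compact_space (space_of G) \<and>
      subgroup K G \<and> closedin (space_of G) K \<and> effective_action G K \<and>
      simply_connected_space (coset_space G K) \<and>
      3 \<le> dim (red_compl G K) \<and>
      isotropy_irreducible G K \<and> \<not> type_I_symmetric_coset G K"
  then show "nabla_einstein G K (nomizu_alpha G K \<alpha>)"
    using nabla_einstein_isotropy_irreducible by blast
next
  fix \<alpha> :: real
  assume "simple_lie_group H \<and> compact_space (space_of H) \<and>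
      simply_connected_space (space_of H) \<and> 2 \<le> CARD('q)"
  then show "nabla_einstein (lie_quotient HQ \<Delta>Z) (quotient_proj HQ \<Delta>Z ` \<Delta>H)
            (nomizu_alpha (lie_quotient HQ \<Delta>Z) (quotient_proj HQ \<Delta>Z ` \<Delta>H) \<alpha>)"
    unfolding HQ_def \<Delta>Z_def \<Delta>H_def using nabla_einstein_power_quotient by blast
qed

end
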